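(* Let $(\mathcal S,\mathcal A)$ and $(\mathcal T,\mathcal B)$ be two irreducibly acting quantum graphs (on finite-dimensional Hilbert spaces $H$ and $K$, respectively). Assume that $\mathcal S\sim_\Delta\mathcal T$. Then $(\mathcal S,\mathcal A)$ is connected if and only if $(\mathcal T,\mathcal B)$ is connected.
   Context: An operator system in $\mathcal B(H)$ is a norm-closed selfadjoint linear subspace containing $I_H$; $\mathcal A'$ is the commutant; $[\,\cdot\,]$ denotes closed linear span. A quantum graph $(\mathcal S,\mathcal A)$ acting on a finite-dimensional Hilbert space $H$ consists of a von Neumann algebra $\mathcal A=\mathcal A''\subseteq\mathcal B(H)$ (with $I_H\in\mathcal A$) and an operator system $\mathcal S\subseteq\mathcal B(H)$ with $\mathcal A'\mathcal S\mathcal A'\subseteq\mathcal S$. It is irreducibly acting if there is no non-trivial closed subspace $L\subseteq H$ reducing $\mathcal S$ such that the restriction map $\mathcal S\to\mathcal B(L)$, $s\mapsto s|_L$, is completely isometric. It is connected if the C*-algebra $\mathrm C^*(\mathcal S)$ generated by $\mathcal S$ in $\mathcal B(H)$ equals $\mathcal B(H)$. A TRO is a norm-closed subspace $\mathcal M\subseteq\mathcal B(H_1,K_1)$ with $\mathcal M\mathcal M^*\mathcal M\subseteq\mathcal M$, non-degenerate if $I_{H_1}\in[\mathcal M^*\mathcal M]$ and $I_{K_1}\in[\mathcal M\mathcal M^*]$. Operator systems $\mathcal S_1\subseteq\mathcal B(H_1)$, $\mathcal T_1\subseteq\mathcal B(K_1)$ satisfy $\mathcal S_1\sim_{\mathrm{TRO}}\mathcal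 T_1$ if there is a non-degenerate TRO $\mathcal M\subseteq\mathcal B(H_1,K_1)$ with $\mathcal M^*\mathcal T_1\mathcal M\subseteq\mathcal S_1$ and $\mathcal M\mathcal S_1\mathcal M^*\subseteq\mathcal T_1$. $\mathcal S\sim_\Delta\mathcal T$ means that there exist Hilbert spaces $H_1,K_1$ and unital complete order embeddings $\varphi\colon\mathcal S\to\mathcal B(H_1)$, $\psi\colon\mathcal T\to\mathcal B(K_1)$ with $\varphi(\mathcal S)\sim_{\mathrm{TRO}}\psi(\mathcal T)$. *)

theory Defs
  imports "HOL-Analysis.Analysis"
begin

section \<open>Complex Hilbert spaces\<close>

class complex_vector = real_vector +
  fixes scaleC :: "complex \<Rightarrow> 'a \<Rightarrow> 'a"  (infixr "*\<^sub>C" 75)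
  assumes scaleC_add_right: "c *\<^sub>C (x + y) = c *\<^sub>C x + c *\<^sub>C y"
    and scaleC_add_left: "(c + d) *\<^sub>C x = c *\<^sub>C x + d *\<^sub>C x"
    and scaleC_scaleC: "c *\<^sub>C d *\<^sub>C x = (c * d) *\<^sub>C x"
    and scaleC_one: "1 *\<^sub>C x = x"
    and scaleR_scaleC: "r *\<^sub>R x = complex_of_real r *\<^sub>C x"

interpretation complex_vector: vector_space "scaleC :: complex \<Rightarrow> 'a \<Rightarrow> 'a::complex_vector"
  by unfold_locales (simp_all add: scaleC_add_right scaleC_add_left scaleC_scaleC scaleC_one)

abbreviation csubspace :: "'a::complex_vector set \<Rightarrow> bool"
  where "csubspace \<equiv> module.subspace scaleC"

abbreviation cspan :: "'a::complex_vector set \<Rightarrow> 'a set"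
  where "cspan \<equiv> module.span scaleC"

text \<open>The superclass \<^class>\<open>real_inner\<close> supplies the library's norm and topology. Its inner product
  is forced to be the real part of the complex one, so it carries no additional data. The complex
  inner product is linear in the first variable.\<close>

class chilbert_space = complex_vector + real_inner + complete_space +
  fixes cinner :: "'a \<Rightarrow> 'a \<Rightarrow> complex"
  assumes cinner_add_left: "cinner (x + y) z = cinner x z + cinner y z"
    and cinner_scaleC_left: "cinner (c *\<^sub>C x) y = c * cinner x y"
    and cinner_commute: "cinner y x = cnj (cinner x y)"
    and cinner_self: "cinner x x = complex_of_real ((norm x)\<^sup>2)"
    and inner_eq_Re_cinner: "inner x y = Re (cinner x y)"

class fin_dim_chilbert_space = chilbert_space +
  assumes finite_cspanning_set: "\<exists>B. finite B \<and> (\<forall>x. \<exists>c. x = (\<Sum>b\<in>B. c b *\<^sub>C b))"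

lemma norm_scaleC: "norm (c *\<^sub>C x) = cmod c * norm (x :: 'a::chilbert_space)"
proof -
  have "complex_of_real ((norm (c *\<^sub>C x))\<^sup>2) = c * (cnj c * cinner x x)"
    by (metis cinner_commute cinner_scaleC_left cinner_self complex_cnj_mult)
  also have "\<dots> = complex_of_real ((cmod c * norm x)\<^sup>2)"
    using complex_norm_square[of c] by (simp add: cinner_self power_mult_distrib)
  finally have "(norm (c *\<^sub>C x))\<^sup>2 = (cmod c * norm x)\<^sup>2"
    using of_real_eq_iff by blast
  then show ?thesis
    by (simp add: power2_eq_iff_nonneg)
qed

lemma bounded_linear_scaleC: "bounded_linear (\<lambda>x :: 'a::chilbert_space. c *\<^sub>C x)"
  by (rule bounded_linear_intro[where K = "cmod c"])
    (simp_all add: scaleC_add_right scaleR_scaleC scaleC_scaleC norm_scaleC mult.commute)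

section \<open>Bounded operators\<close>

text \<open>The elements of \<open>'a \<Rightarrow>\<^sub>L 'b\<close> are only real-linear; \<open>bops\<close> below singles out the
  complex-linear ones, that is, the space usually written B(H,K).\<close>

instantiation blinfun :: (chilbert_space, chilbert_space) complex_vector
begin

lift_definition scaleC_blinfun :: "complex \<Rightarrow> 'a \<Rightarrow>\<^sub>L 'b \<Rightarrow> 'a \<Rightarrow>\<^sub>L 'b"
  is "\<lambda>c f x. c *\<^sub>C f x"
  by (rule bounded_linear_compose[OF bounded_linear_scaleC])

instance
  by standard (transfer; simp add: fun_eq_iff scaleC_add_right scaleC_add_left scaleC_scaleC
      scaleC_one scaleR_scaleC)+

end

definition bops :: "('a::chilbert_space \<Rightarrow>\<^sub>L 'b::chilbert_space) set"
  where "bops = {f. \<forall>c x. blinfun_apply f (c *\<^sub>C x) = c *\<^sub>C blinfun_apply f x}"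

definition cadjoint :: "('a::chilbert_space \<Rightarrow>\<^sub>L 'b::chilbert_space) \<Rightarrow> ('b \<Rightarrow>\<^sub>L 'a)"
  where "cadjoint f =
    (THE g. \<forall>x y. cinner (blinfun_apply f x) y = cinner x (blinfun_apply g y))"

definition closed_cspan ::
    "('a::chilbert_space \<Rightarrow>\<^sub>L 'b::chilbert_space) set \<Rightarrow> ('a \<Rightarrow>\<^sub>L 'b) set"
  where "closed_cspan X = closure (cspan X)"

definition commutant :: "('a::chilbert_space \<Rightarrow>\<^sub>L 'a) set \<Rightarrow> ('a \<Rightarrow>\<^sub>L 'a) set"
  where "commutant A = {b \<in> bops. \<forall>a\<in>A. a o\<^sub>L b = b o\<^sub>L a}"

definition operator_system :: "('a::chilbert_space \<Rightarrow>\<^sub>L 'a) set \<Rightarrow> bool"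
  where "operator_system S \<longleftrightarrow>
    S \<subseteq> bops \<and> csubspace S \<and> closed S \<and> (\<forall>s\<in>S. cadjoint s \<in> S) \<and> id_blinfun \<in> S"

text \<open>By the double commutant condition \<open>A\<close> is automatically a unital subalgebra of B(H).\<close>

definition von_neumann_algebra :: "('a::chilbert_space \<Rightarrow>\<^sub>L 'a) set \<Rightarrow> bool"
  where "von_neumann_algebra A \<longleftrightarrow>
    A \<subseteq> bops \<and> (\<forall>a\<in>A. cadjoint a \<in> A) \<and> commutant (commutant A) = A"

definition cstar_subalgebra :: "('a::chilbert_space \<Rightarrow>\<^sub>L 'a) set \<Rightarrow> bool"
  where "cstar_subalgebra C \<longleftrightarrow>
    C \<subseteq> bops \<and> csubspace C \<and> closed C \<and> (\<forall>a\<in>C. cadjoint a \<in> C) \<and>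
    (\<forall>a\<in>C. \<forall>b\<in>C. a o\<^sub>L b \<in> C)"

definition cstar_generated :: "('a::chilbert_space \<Rightarrow>\<^sub>L 'a) set \<Rightarrow> ('a \<Rightarrow>\<^sub>L 'a) set"
  where "cstar_generated S = cstar_subalgebra hull S"

section \<open>Matrices of operators\<close>

text \<open>An element of M_n(B(H,K)) is given by the entries \<open>A i j\<close> with \<open>i, j < n\<close>, and an element of
  H^n by the entries \<open>x j\<close> with \<open>j < n\<close>; values at other indices are ignored.\<close>

definition opmat_apply ::
    "nat \<Rightarrow> (nat \<Rightarrow> nat \<Rightarrow> 'a::chilbert_space \<Rightarrow>\<^sub>L 'b::chilbert_space) \<Rightarrow> (nat \<Rightarrow> 'a) \<Rightarrow> nat \<Rightarrow> 'b"
  where "opmat_apply n A x = (\<lambda>i. \<Sum>j<n. blinfun_apply (A i j) (x j))"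

definition tuple_norm :: "nat \<Rightarrow> (nat \<Rightarrow> 'a::chilbert_space) \<Rightarrow> real"
  where "tuple_norm n x = L2_set (\<lambda>i. norm (x i)) {..<n}"

text \<open>The operator norm of the restriction of \<open>A\<close> to L^n; for \<open>L = UNIV\<close> this is the norm of \<open>A\<close>
  in M_n(B(H,K)) = B(H^n,K^n).\<close>

definition opmat_norm_on ::
    "'a::chilbert_space set \<Rightarrow> nat \<Rightarrow> (nat \<Rightarrow> nat \<Rightarrow> 'a \<Rightarrow>\<^sub>L 'b::chilbert_space) \<Rightarrow> real"
  where "opmat_norm_on L n A =
    (SUP x \<in> {x. (\<forall>j<n. x j \<in> L) \<and> tuple_norm n x \<le> 1}. tuple_norm n (opmat_apply n A x))"

definition opmat_positive :: "nat \<Rightarrow> (nat \<Rightarrow> nat \<Rightarrow> 'a::chilbert_space \<Rightarrow>\<^sub>L 'a) \<Rightarrow> bool"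
  where "opmat_positive n A \<longleftrightarrow>
    (\<forall>x. (\<Sum>i<n. cinner (opmat_apply n A x i) (x i)) \<in> \<real>\<^sub>\<ge>\<^sub>0)"

text \<open>A linear map defined on a subspace \<open>S\<close> is given by a total function, of which only the values
  on \<open>S\<close> matter.\<close>

definition completely_positive_on ::
    "('a::chilbert_space \<Rightarrow>\<^sub>L 'a) set \<Rightarrow> (('a \<Rightarrow>\<^sub>L 'a) \<Rightarrow> ('b::chilbert_space \<Rightarrow>\<^sub>L 'b)) \<Rightarrow> bool"
  where "completely_positive_on S \<phi> \<longleftrightarrow>
    (\<forall>n A. (\<forall>i<n. \<forall>j<n. A i j \<in> S) \<longrightarrow> opmat_positive n A \<longrightarrow>
      opmat_positive n (\<lambda>i j. \<phi> (A i j)))"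

definition unital_complete_order_embedding ::
    "('a::chilbert_space \<Rightarrow>\<^sub>L 'a) set \<Rightarrow> (('a \<Rightarrow>\<^sub>L 'a) \<Rightarrow> ('b::chilbert_space \<Rightarrow>\<^sub>L 'b)) \<Rightarrow> bool"
  where "unital_complete_order_embedding S \<phi> \<longleftrightarrow>
    \<phi> ` S \<subseteq> bops \<and>
    (\<forall>s\<in>S. \<forall>t\<in>S. \<phi> (s + t) = \<phi> s + \<phi> t) \<and> (\<forall>c. \<forall>s\<in>S. \<phi> (c *\<^sub>C s) = c *\<^sub>C \<phi> s) \<and>
    \<phi> id_blinfun = id_blinfun \<and>
    inj_on \<phi> S \<and> completely_positive_on S \<phi> \<and> completely_positive_on (\<phi> ` S) (inv_into S \<phi>)"

section \<open>TRO-equivalence and Delta-equivalence\<close>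

definition tro :: "('a::chilbert_space \<Rightarrow>\<^sub>L 'b::chilbert_space) set \<Rightarrow> bool"
  where "tro M \<longleftrightarrow>
    M \<subseteq> bops \<and> csubspace M \<and> closed M \<and>
    (\<forall>a\<in>M. \<forall>b\<in>M. \<forall>c\<in>M. a o\<^sub>L cadjoint b o\<^sub>L c \<in> M)"

definition nondegenerate_tro :: "('a::chilbert_space \<Rightarrow>\<^sub>L 'b::chilbert_space) set \<Rightarrow> bool"
  where "nondegenerate_tro M \<longleftrightarrow>
    tro M \<and>
    id_blinfun \<in> closed_cspan {cadjoint a o\<^sub>L b | a b. a \<in> M \<and> b \<in> M} \<and>
    id_blinfun \<in> closed_cspan {a o\<^sub>L cadjoint b | a b. a \<in> M \<and> b \<in> M}"

definition tro_equivalent ::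
    "('a::chilbert_space \<Rightarrow>\<^sub>L 'a) set \<Rightarrow> ('b::chilbert_space \<Rightarrow>\<^sub>L 'b) set \<Rightarrow> bool"
  where "tro_equivalent S T \<longleftrightarrow>
    (\<exists>M :: ('a \<Rightarrow>\<^sub>L 'b) set. nondegenerate_tro M \<and>
      (\<forall>a\<in>M. \<forall>b\<in>M. \<forall>t\<in>T. cadjoint a o\<^sub>L t o\<^sub>L b \<in> S) \<and>
      (\<forall>a\<in>M. \<forall>b\<in>M. \<forall>s\<in>S. a o\<^sub>L s o\<^sub>L cadjoint b \<in> T))"

text \<open>Delta-equivalence asks for some Hilbert spaces H1 and K1. HOL cannot quantify over types
  inside a formula, so the spaces are parameters here. A theorem with this predicate as a hypothesis,
  the types \<open>'c\<close> and \<open>'d\<close> occurring nowhere else, is universally quantified over all choices of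
  these types, as is required of an existential hypothesis.\<close>

definition delta_equivalent_via ::
    "'c::chilbert_space itself \<Rightarrow> 'd::chilbert_space itself \<Rightarrow>
      ('a::chilbert_space \<Rightarrow>\<^sub>L 'a) set \<Rightarrow> ('b::chilbert_space \<Rightarrow>\<^sub>L 'b) set \<Rightarrow> bool"
  where "delta_equivalent_via TH1 TK1 S T \<longleftrightarrow>
    (\<exists>(\<phi> :: ('a \<Rightarrow>\<^sub>L 'a) \<Rightarrow> ('c \<Rightarrow>\<^sub>L 'c)) (\<psi> :: ('b \<Rightarrow>\<^sub>L 'b) \<Rightarrow> ('d \<Rightarrow>\<^sub>L 'd)).
      unital_complete_order_embedding S \<phi> \<and> unital_complete_order_embedding T \<psi> \<and>
      tro_equivalent (\<phi> ` S) (\<psi> ` T))"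

section \<open>Quantum graphs\<close>

definition quantum_graph ::
    "('a::fin_dim_chilbert_space \<Rightarrow>\<^sub>L 'a) set \<Rightarrow> ('a \<Rightarrow>\<^sub>L 'a) set \<Rightarrow> bool"
  where "quantum_graph S A \<longleftrightarrow>
    von_neumann_algebra A \<and> operator_system S \<and>
    (\<forall>a\<in>commutant A. \<forall>s\<in>S. \<forall>b\<in>commutant A. a o\<^sub>L s o\<^sub>L b \<in> S)"

definition ortho_complement :: "'a::chilbert_space set \<Rightarrow> 'a set"
  where "ortho_complement L = {x. \<forall>y\<in>L. cinner x y = 0}"

definition reduces :: "'a::chilbert_space set \<Rightarrow> ('a \<Rightarrow>\<^sub>L 'a) set \<Rightarrow> bool"
  where "reduces L S \<longleftrightarrow>
    (\<forall>s\<in>S. blinfun_apply s ` L \<subseteq> L \<and> blinfun_apply s ` ortho_complement L \<subseteq> ortho_complement L)"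

definition restriction_completely_isometric ::
    "('a::chilbert_space \<Rightarrow>\<^sub>L 'a) set \<Rightarrow> 'a set \<Rightarrow> bool"
  where "restriction_completely_isometric S L \<longleftrightarrow>
    (\<forall>n A. (\<forall>i<n. \<forall>j<n. A i j \<in> S) \<longrightarrow> opmat_norm_on L n A = opmat_norm_on UNIV n A)"

definition irreducibly_acting ::
    "('a::fin_dim_chilbert_space \<Rightarrow>\<^sub>L 'a) set \<Rightarrow> ('a \<Rightarrow>\<^sub>L 'a) set \<Rightarrow> bool"
  where "irreducibly_acting S A \<longleftrightarrow>
    \<not> (\<exists>L. csubspace L \<and> closed L \<and> L \<noteq> {0} \<and> L \<noteq> UNIV \<and> reduces L S \<and>
        restriction_completely_isometric S L)"

definition connected_quantum_graph ::
    "('a::fin_dim_chilbert_space \<Rightarrow>\<^sub>L 'a) set \<Rightarrow> ('a \<Rightarrow>\<^sub>L 'a) set \<Rightarrow> bool"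
  where "connected_quantum_graph S A \<longleftrightarrow> cstar_generated S = bops"

end

theory Submission
  imports Defs "HOL-Library.Function_Algebras" "HOL-Computational_Algebra.Fundamental_Theorem_Algebra"
begin

text \<open>By symmetry it suffices to show that C*(S) = B(H) if C*(T) = B(K). Since \<open>M* M \<subseteq> \<phi>(S)\<close> and
  \<open>M M* \<subseteq> \<psi>(T)\<close> are finite-dimensional, non-degeneracy gives finitely many elements of \<open>M\<close> with
  \<open>\<Sum> a b* = 1\<close> and \<open>\<Sum> a'* b' = 1\<close>, and only these are used. The completely positive families
  \<open>s \<mapsto> \<psi>\<inverse>(m \<phi>(s) n*)\<close> and \<open>t \<mapsto> \<phi>\<inverse>(m* \<psi>(t) n)\<close> extend to the full matrix algebras (a
  finite-dimensional form of Arveson's theorem) and so have Kraus operators \<open>R m : K \<rightarrow> H\<close> and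
  \<open>Q m : H \<rightarrow> K\<close>. The operators \<open>\<Sum> Q a R b\<close> are the Kraus operators of a map that fixes \<open>T\<close>, so
  they are scalars by Arveson's boundary theorem, and this forces \<open>Q m R n\<close> to be a multiple of
  \<open>\<psi>\<inverse>(m n*)\<close>. If \<open>q\<close> is a projection commuting with \<open>S\<close>, then \<open>Q m q R n\<close> is such a multiple
  too, and for \<open>q\<close> or for \<open>1 - q\<close> the multiple is not zero. In that case the positivity of a matrix
  over \<open>S\<close> can be read off its restriction to the range, so the restriction is completely isometric
  and \<open>q\<close> is trivial. Hence \<open>S\<close> acts irreducibly, and Burnside's theorem gives C*(S) = B(H).\<close>

section \<open>Hilbert spaces and adjoints\<close>

text \<open>Irreducible action is weaker than the absence of reducing subspaces: it only excludes
  those on which the restriction is completely isometric. Therefore each projection \<open>q\<close>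
  commuting with \<open>S\<close> has to be examined, and it must be shown that \<open>q\<close> or
  \<open>1 - q\<close> gives such a restriction. The obstacle is that the C*-algebra generated by an
  embedded system depends on the embedding and that the inverse embeddings are not multiplicative,
  so elements of \<open>M\<close> cannot be moved to operators between H and K. The Kraus operators
  \<open>Q m\<close> and \<open>R n\<close> are the substitutes for \<open>m\<close> and for the
  adjoint of \<open>n\<close>. The boundary theorem enters twice: it makes the inverse of
  \<open>\<psi>\<close> multiplicative on products with elements
  \<open>m o\<^sub>L n\<^sup>\<dagger>\<close>, and it makes the composed Kraus operators scalar.
  The passage from these scalars to single products \<open>Q m o\<^sub>L R n\<close> is the equality
  case of the Cauchy-Schwarz inequality. With \<open>q\<close> in between, the scalar arises
  differently, from the triviality of the commutant of \<open>T\<close>.\<close>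

notation cadjoint ("_\<^sup>\<dagger>" [1000] 1000)

lemma cinner_add_right: "cinner z (x + y) = cinner z x + cinner z y"
  by (metis cinner_add_left cinner_commute complex_cnj_add)

lemma cinner_scaleC_right: "cinner x (c *\<^sub>C y) = cnj c * cinner x y"
  by (metis cinner_commute cinner_scaleC_left complex_cnj_mult)

lemma cinner_zero [simp]: "cinner 0 y = 0" "cinner y 0 = 0"
  using cinner_scaleC_left[of 0 0 y] cinner_scaleC_right[of y 0 0] by simp_all

lemma cinner_minus_left [simp]: "cinner (- x) y = - cinner x y"
  using cinner_scaleC_left[of "-1" x y] by simp

lemma cinner_minus_right [simp]: "cinner x (- y) = - cinner x y"
  using cinner_scaleC_right[of x "-1" y] by simp

lemma cinner_diff_left: "cinner (x - y) z = cinner x z - cinner y z"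
  using cinner_add_left[of x "- y" z] by simp

lemma cinner_diff_right: "cinner z (x - y) = cinner z x - cinner z y"
  using cinner_add_right[of z x "- y"] by simp

lemma cinner_sum_left: "cinner (\<Sum>i\<in>I. f i) y = (\<Sum>i\<in>I. cinner (f i) y)"
  by (induction I rule: infinite_finite_induct) (simp_all add: cinner_add_left)

lemma cinner_sum_right: "cinner y (\<Sum>i\<in>I. f i) = (\<Sum>i\<in>I. cinner y (f i))"
  by (induction I rule: infinite_finite_induct) (simp_all add: cinner_add_right)

lemma cnj_cinner: "cnj (cinner x y) = cinner y x"
  by (metis cinner_commute)

lemma cinner_self_Re: "Re (cinner x x) = (norm x)\<^sup>2"
  by (simp add: cinner_self)

lemma cinner_self_nonneg [simp]: "cinner x x \<in> \<real>\<^sub>\<ge>\<^sub>0"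
  by (simp add: cinner_self)

lemma cinner_self_zero [simp]: "cinner x x = 0 \<longleftrightarrow> x = 0"
  by (simp add: cinner_self)

lemma scaleC_diff_right: "c *\<^sub>C (x - y) = c *\<^sub>C x - c *\<^sub>C (y :: 'a::complex_vector)"
  by (rule complex_vector.scale_right_diff_distrib)

lemma scaleC_sum_right: "c *\<^sub>C (\<Sum>i\<in>I. f i) = (\<Sum>i\<in>I. c *\<^sub>C (f i :: 'a::complex_vector))"
  by (rule complex_vector.scale_sum_right)

lemma scaleC_sum_left: "(\<Sum>i\<in>I. f i) *\<^sub>C x = (\<Sum>i\<in>I. f i *\<^sub>C (x :: 'a::complex_vector))"
  by (rule complex_vector.scale_sum_left)

lemma cinner_Cauchy_Schwarz: "cmod (cinner x y) \<le> norm x * norm y"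
proof (cases "cinner x y = 0")
  case False
  \<comment> \<open>A unit scalar that rotates \<open>cinner x y\<close> onto its modulus; after the
    rotation the real Cauchy-Schwarz inequality applies.\<close>
  define u where "u = cnj (cinner x y) / of_real (cmod (cinner x y))"
  have u: "cmod u = 1" using False by (simp add: u_def norm_divide)
  have "u * cinner x y = of_real (cmod (cinner x y))"
  proof -
    have "cnj (cinner x y) * cinner x y = of_real (cmod (cinner x y)) * of_real (cmod (cinner x y))"
      using complex_norm_square[of "cinner x y"] by (simp add: power2_eq_square)
    then show ?thesis using False by (simp add: u_def)
  qed
  then have "cmod (cinner x y) = Re (cinner (u *\<^sub>C x) y)"
    by (simp add: cinner_scaleC_left)
  also have "\<dots> = inner (u *\<^sub>C x) y" by (simp add: inner_eq_Re_cinner)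
  also have "\<dots> \<le> norm (u *\<^sub>C x) * norm y" by (rule norm_cauchy_schwarz)
  finally show ?thesis by (simp add: norm_scaleC u)
qed simp

lemma cinner_eqI: "(\<And>x. cinner x y = cinner x z) \<Longrightarrow> y = z"
  using cinner_self_zero[of "y - z"] by (simp add: cinner_diff_right)

text \<open>The complex inner product is determined by its real part; this carries representing
  vectors for the real inner product over to the complex one.\<close>

lemma cinner_eq_inner: "cinner x y = Complex (inner x y) (inner ((- \<i>) *\<^sub>C x) y)"
  by (simp add: complex_eq_iff inner_eq_Re_cinner cinner_scaleC_left)

text \<open>If \<open>z\<close> represents \<open>f\<close>, then
  \<open>(norm x)\<^sup>2 - 2 * f x\<close> equals
  \<open>(norm (x - z))\<^sup>2 - (norm z)\<^sup>2\<close>. So a minimiser of this function is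
  sought: the parallelogram law makes a minimising sequence Cauchy, and stationarity at its limit
  gives the representation.\<close>

lemma riesz_representation:
  fixes f :: "'a::{real_inner, complete_space} \<Rightarrow> real"
  assumes "bounded_linear f"
  shows "\<exists>z. \<forall>x. f x = inner x z"
proof -
  interpret f: bounded_linear f by fact
  obtain K where K: "\<And>x. norm (f x) \<le> norm x * K" using f.bounded by blast
  define g where "g x = (norm x)\<^sup>2 - 2 * f x" for x
  have lower: "- K\<^sup>2 \<le> g x" for x
  proof -
    have "0 \<le> (norm x - K)\<^sup>2" by simp
    moreover have "f x \<le> norm x * K" using K[of x] by simp
    ultimately show ?thesis by (simp add: g_def power2_diff)
  qed
  have bdd: "bdd_below (range g)" using lower by (auto intro!: bdd_belowI)
  define d where "d = Inf (range g)"
  have d: "d \<le> g x" for x unfolding d_def using bdd by (simp add: cInf_lower)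
  have "\<exists>x. g x < d + 1 / (real n + 1)" for n
    using cInf_lessD[of "range g" "d + 1 / (real n + 1)"] by (fastforce simp: d_def)
  then obtain X where X: "\<And>n. g (X n) < d + 1 / (real n + 1)" by metis
  \<comment> \<open>The parallelogram law, with the lower bound \<open>d\<close> used at the
    midpoint of \<open>x\<close> and \<open>y\<close>.\<close>
  have par: "(norm (x - y))\<^sup>2 \<le> 2 * (g x - d) + 2 * (g y - d)" for x y
  proof -
    have "d \<le> g ((1/2) *\<^sub>R (x + y))" by (rule d)
    also have "\<dots> = (norm (x + y))\<^sup>2 / 4 - f x - f y"
      by (simp add: g_def f.scaleR f.add power_mult_distrib power_divide add_divide_distrib)
    also have "(norm (x + y))\<^sup>2 = 2 * (norm x)\<^sup>2 + 2 * (norm y)\<^sup>2 - (norm (x - y))\<^sup>2"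
      by (simp add: power2_norm_eq_inner inner_add inner_diff inner_commute)
    finally show ?thesis by (simp add: g_def field_simps)
  qed
  have "Cauchy X"
  proof (rule metric_CauchyI)
    fix e :: real assume "e > 0"
    obtain N where "4 / e\<^sup>2 < real N" using reals_Archimedean2[of "4 / e\<^sup>2"] by auto
    then have "4 < real N * e\<^sup>2" using \<open>e > 0\<close> by (simp add: pos_divide_less_eq)
    also have "\<dots> \<le> (real N + 1) * e\<^sup>2" by (simp add: mult_right_mono)
    finally have N: "4 * (1 / (real N + 1)) < e\<^sup>2"
      by (simp add: pos_divide_less_eq add_pos_nonneg mult.commute)
    show "\<exists>M. \<forall>m\<ge>M. \<forall>n\<ge>M. dist (X m) (X n) < e"
    proof (intro exI allI impI)
      fix m n assume mn: "N \<le> m" "N \<le> n"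
      have "1 / (real m + 1) \<le> 1 / (real N + 1)" "1 / (real n + 1) \<le> 1 / (real N + 1)"
        using mn by (auto simp: field_simps)
      then have "(norm (X m - X n))\<^sup>2 < e\<^sup>2"
        using par[of "X m" "X n"] X[of m] X[of n] N by argo
      then show "dist (X m) (X n) < e"
        using \<open>e > 0\<close> by (simp add: dist_norm power_less_imp_less_base)
    qed
  qed
  then obtain z where z: "X \<longlonglongrightarrow> z" unfolding Cauchy_convergent_iff convergent_def by (elim exE)
  have "(\<lambda>n. g (X n)) \<longlonglongrightarrow> g z"
    unfolding g_def by (intro tendsto_intros z f.tendsto)
  moreover have "(\<lambda>n. d + 1 / (real n + 1)) \<longlonglongrightarrow> d"
    using tendsto_add[OF tendsto_const[of d] LIMSEQ_inverse_real_of_nat] by (simp add: field_simps)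
  ultimately have gz: "g z \<le> d"
    by (rule LIMSEQ_le) (use X in \<open>auto intro: less_imp_le\<close>)
  have "f x = inner x z" for x
  proof -
    define a where "a = inner x z - f x"
    have ineq: "0 \<le> t * t * (norm x)\<^sup>2 + 2 * t * a" for t
    proof -
      have "0 \<le> g (z + t *\<^sub>R x) - g z" using gz d[of "z + t *\<^sub>R x"] by simp
      also have "\<dots> = t * t * (norm x)\<^sup>2 + 2 * t * a"
        by (simp add: g_def a_def f.add f.scaleR power2_norm_eq_inner inner_add inner_commute
            algebra_simps)
      finally show ?thesis .
    qed
    have "a = 0"
    proof (rule ccontr)
      assume "a \<noteq> 0"
      \<comment> \<open>For nonzero \<open>x\<close> the quadratic inequality already fails at
        \<open>t = - a / (norm x)\<^sup>2\<close>; the summand 1 keeps the denominator positive for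
        \<open>x = 0\<close> as well.\<close>
      define p where "p = (norm x)\<^sup>2 + 1"
      have p: "p > 0" by (simp add: p_def add_nonneg_pos)
      define t where "t = - a / p"
      have tp: "t * p = - a" using p by (simp add: t_def)
      have "0 \<le> t * t * (norm x)\<^sup>2 + 2 * t * a" by (rule ineq)
      also have "\<dots> \<le> t * (t * p) + 2 * t * a"
        by (simp add: p_def algebra_simps)
      also have "\<dots> = - (a * a) / p" unfolding tp by (simp add: t_def)
      also have "\<dots> < 0" using p \<open>a \<noteq> 0\<close> by (simp add: divide_pos_pos flip: power2_eq_square)
      finally show False by simp
    qed
    then show ?thesis by (simp add: a_def)
  qed
  then show ?thesis by blast
qed

lemma bopsD: "f \<in> bops \<Longrightarrow> f (c *\<^sub>C x) = c *\<^sub>C f x"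
  by (simp add: bops_def)

lemma blinfun_apply_scaleC [simp]: "blinfun_apply (c *\<^sub>C f) x = c *\<^sub>C f x"
  by transfer simp

lemma bops_zero [simp]: "0 \<in> bops"
  and bops_id [simp]: "id_blinfun \<in> bops"
  and bops_add [intro]: "f \<in> bops \<Longrightarrow> g \<in> bops \<Longrightarrow> f + g \<in> bops"
  and bops_scaleC [intro]: "f \<in> bops \<Longrightarrow> c *\<^sub>C f \<in> bops"
  and bops_uminus [intro]: "f \<in> bops \<Longrightarrow> - f \<in> bops"
  and bops_diff [intro]: "f \<in> bops \<Longrightarrow> g \<in> bops \<Longrightarrow> f - g \<in> bops"
  by (simp_all add: bops_def blinfun.bilinear_simps scaleC_add_right scaleC_diff_right scaleC_scaleC
      mult.commute)

lemma bops_compose [intro]: "f \<in> bops \<Longrightarrow> g \<in> bops \<Longrightarrow> f o\<^sub>L g \<in> bops"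
  by (simp add: bops_def)

lemma bops_sum [intro]: "(\<And>i. i \<in> I \<Longrightarrow> f i \<in> bops) \<Longrightarrow> (\<Sum>i\<in>I. f i) \<in> bops"
  by (induction I rule: infinite_finite_induct) auto

lemma csubspace_bops: "csubspace bops"
  by (rule complex_vector.subspaceI) auto

lemma closed_bops: "closed (bops :: ('a::chilbert_space \<Rightarrow>\<^sub>L 'b::chilbert_space) set)"
proof -
  have "closed {f :: 'a \<Rightarrow>\<^sub>L 'b. blinfun_apply f (c *\<^sub>C x) = c *\<^sub>C blinfun_apply f x}" for c x
    by (intro closed_Collect_eq continuous_intros
        bounded_linear.continuous_on[OF bounded_linear_scaleC])
  then have "closed (\<Inter>c x. {f :: 'a \<Rightarrow>\<^sub>L 'b. blinfun_apply f (c *\<^sub>C x) = c *\<^sub>C blinfun_apply f x})"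
    by blast
  moreover have "bops = (\<Inter>c x. {f :: 'a \<Rightarrow>\<^sub>L 'b. blinfun_apply f (c *\<^sub>C x) = c *\<^sub>C blinfun_apply f x})"
    by (auto simp: bops_def)
  ultimately show ?thesis by simp
qed

lemma cadjoint_eqI:
  assumes "\<And>x y. cinner (blinfun_apply f x) y = cinner x (blinfun_apply g y)"
  shows "f\<^sup>\<dagger> = g"
  unfolding cadjoint_def
proof (rule the_equality)
  fix h assume "\<forall>x y. cinner (blinfun_apply f x) y = cinner x (blinfun_apply h y)"
  with assms show "h = g"
    by (intro blinfun_eqI cinner_eqI) metis
qed (use assms in blast)

text \<open>\<open>cadjoint\<close> is a definite description, so it is meaningful only once
  existence is known. The real Riesz theorem gives \<open>g\<close>, and complex linearity of
  \<open>f\<close> lets the factor \<open>- \<i>\<close> in the imaginary part move into the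
  argument.\<close>

lemma cadjoint_exists:
  fixes f :: "'a::chilbert_space \<Rightarrow>\<^sub>L 'b::chilbert_space"
  assumes f: "f \<in> bops"
  shows "\<exists>g. \<forall>x y. cinner (blinfun_apply f x) y = cinner x (blinfun_apply g y)"
proof -
  have "\<exists>z. \<forall>x. inner (f x) y = inner x z" for y
    by (rule riesz_representation) (intro bounded_linear_intros)
  then obtain g where g: "\<And>x y. inner (f x) y = inner x (g y)" by metis
  have cg: "cinner (f x) y = cinner x (g y)" for x y
    by (simp add: cinner_eq_inner flip: g) (simp add: g bopsD[OF f, symmetric])
  have bl: "bounded_linear g"
  proof (rule bounded_linear_intro[where K = "norm f"])
    fix x y show "g (x + y) = g x + g y"
      by (rule cinner_eqI) (simp add: cg[symmetric] cinner_add_right)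
  next
    fix r x show "g (r *\<^sub>R x) = r *\<^sub>R g x"
      by (rule cinner_eqI) (simp add: cg[symmetric] cinner_scaleC_right scaleR_scaleC)
  next
    fix x
    have "(norm (g x))\<^sup>2 = inner (f (g x)) x" by (simp add: g power2_norm_eq_inner)
    also have "\<dots> \<le> norm (f (g x)) * norm x" by (rule norm_cauchy_schwarz)
    also have "\<dots> \<le> norm f * norm (g x) * norm x" by (simp add: norm_blinfun mult_right_mono)
    finally have "norm (g x) * norm (g x) \<le> norm (g x) * (norm x * norm f)"
      by (simp add: power2_eq_square mult_ac)
    then show "norm (g x) \<le> norm x * norm f"
      by (cases "g x = 0") auto
  qed
  then show ?thesis by (intro exI[of _ "Blinfun g"]) (simp add: cg bounded_linear_Blinfun_apply)
qed

lemma cinner_adj_left: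
  assumes "f \<in> bops"
  shows "cinner (blinfun_apply f x) y = cinner x (blinfun_apply (f\<^sup>\<dagger>) y)"
proof -
  obtain g where g: "\<And>x y. cinner (blinfun_apply f x) y = cinner x (blinfun_apply g y)"
    using cadjoint_exists[OF assms] by blast
  have "f\<^sup>\<dagger> = g" by (rule cadjoint_eqI) (rule g)
  then show ?thesis by (simp add: g)
qed

lemma cinner_adj_right:
  "f \<in> bops \<Longrightarrow> cinner x (blinfun_apply f y) = cinner (blinfun_apply (f\<^sup>\<dagger>) x) y"
  using cinner_adj_left[of f y x] cinner_commute[of x "f y"] cinner_commute[of "f\<^sup>\<dagger> x" y]
  by (metis complex_cnj_cnj)

lemma cadjoint_bops [intro]:
  assumes "f \<in> bops"
  shows "f\<^sup>\<dagger> \<in> bops"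
proof -
  have "(f\<^sup>\<dagger>) (c *\<^sub>C x) = c *\<^sub>C (f\<^sup>\<dagger>) x" for c x
    by (rule cinner_eqI) (simp add: cinner_adj_left[OF assms, symmetric] cinner_scaleC_right)
  then show ?thesis by (simp add: bops_def)
qed

lemma cadjoint_cadjoint [simp]: "f \<in> bops \<Longrightarrow> f\<^sup>\<dagger>\<^sup>\<dagger> = f"
  by (rule cadjoint_eqI) (simp add: cinner_adj_right)

lemma cadjoint_compose: "f \<in> bops \<Longrightarrow> g \<in> bops \<Longrightarrow> (f o\<^sub>L g)\<^sup>\<dagger> = g\<^sup>\<dagger> o\<^sub>L f\<^sup>\<dagger>"
  by (rule cadjoint_eqI) (simp add: cinner_adj_left)

lemma cadjoint_add: "f \<in> bops \<Longrightarrow> g \<in> bops \<Longrightarrow> (f + g)\<^sup>\<dagger> = f\<^sup>\<dagger> + g\<^sup>\<dagger>"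
  by (rule cadjoint_eqI)
    (simp add: cinner_adj_left blinfun.bilinear_simps cinner_add_left cinner_add_right)

lemma cadjoint_scaleC: "f \<in> bops \<Longrightarrow> (c *\<^sub>C f)\<^sup>\<dagger> = cnj c *\<^sub>C f\<^sup>\<dagger>"
  by (rule cadjoint_eqI) (simp add: cinner_adj_left cinner_scaleC_left cinner_scaleC_right)

lemma cadjoint_zero [simp]: "0\<^sup>\<dagger> = 0"
  by (rule cadjoint_eqI) simp

lemma cadjoint_id [simp]: "id_blinfun\<^sup>\<dagger> = id_blinfun"
  by (rule cadjoint_eqI) simp

lemma cadjoint_diff: "f \<in> bops \<Longrightarrow> g \<in> bops \<Longrightarrow> (f - g)\<^sup>\<dagger> = f\<^sup>\<dagger> - g\<^sup>\<dagger>"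
  by (rule cadjoint_eqI)
    (simp add: cinner_adj_left blinfun.bilinear_simps cinner_diff_left cinner_diff_right)

lemma cadjoint_sum: "(\<And>i. i \<in> I \<Longrightarrow> f i \<in> bops) \<Longrightarrow> (\<Sum>i\<in>I. f i)\<^sup>\<dagger> = (\<Sum>i\<in>I. (f i)\<^sup>\<dagger>)"
  by (induction I rule: infinite_finite_induct) (simp_all add: cadjoint_add bops_sum)

lemma norm_cadjoint_le:
  assumes "f \<in> bops"
  shows "norm (f\<^sup>\<dagger>) \<le> norm f"
proof (rule norm_blinfun_bound)
  fix x
  have "(norm (f\<^sup>\<dagger> x))\<^sup>2 = Re (cinner (f (f\<^sup>\<dagger> x)) x)"
    by (simp add: cinner_adj_left assms cinner_self_Re)
  also have "\<dots> \<le> norm (f (f\<^sup>\<dagger> x)) * norm x"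
    using cinner_Cauchy_Schwarz complex_Re_le_cmod order_trans by blast
  also have "\<dots> \<le> norm f * norm (f\<^sup>\<dagger> x) * norm x" by (simp add: norm_blinfun mult_right_mono)
  finally have "norm (f\<^sup>\<dagger> x) * norm (f\<^sup>\<dagger> x) \<le> norm (f\<^sup>\<dagger> x) * (norm f * norm x)"
    by (simp add: power2_eq_square mult_ac)
  then show "norm (f\<^sup>\<dagger> x) \<le> norm f * norm x"
    by (cases "f\<^sup>\<dagger> x = 0") auto
qed simp

lemma tendsto_cadjoint:
  assumes "X \<longlonglongrightarrow> f" "\<And>n. X n \<in> bops" "f \<in> bops"
  shows "(\<lambda>n. (X n)\<^sup>\<dagger>) \<longlonglongrightarrow> f\<^sup>\<dagger>"
proof (rule LIM_zero_cancel, rule Lim_null_comparison)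
  show "\<forall>\<^sub>F n in sequentially. norm ((X n)\<^sup>\<dagger> - f\<^sup>\<dagger>) \<le> norm (X n - f)"
    using norm_cadjoint_le[of "X _ - f"] assms by (simp add: cadjoint_diff bops_diff)
  show "(\<lambda>n. norm (X n - f)) \<longlonglongrightarrow> 0"
    using assms(1) by (simp add: LIM_zero tendsto_norm_zero)
qed

lemma blinfun_compose_assoc: "(f o\<^sub>L g) o\<^sub>L h = f o\<^sub>L (g o\<^sub>L h)"
  by (rule blinfun_eqI) simp

lemma compose_id [simp]: "f o\<^sub>L id_blinfun = f" "id_blinfun o\<^sub>L f = f"
  by (auto intro: blinfun_eqI)

lemmas compose_simps =
  bounded_bilinear.add_left[OF bounded_bilinear_blinfun_compose]
  bounded_bilinear.add_right[OF bounded_bilinear_blinfun_compose]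
  bounded_bilinear.diff_left[OF bounded_bilinear_blinfun_compose]
  bounded_bilinear.diff_right[OF bounded_bilinear_blinfun_compose]
  bounded_bilinear.sum_left[OF bounded_bilinear_blinfun_compose]
  bounded_bilinear.sum_right[OF bounded_bilinear_blinfun_compose]

lemma compose_scaleC_left: "(c *\<^sub>C f) o\<^sub>L g = c *\<^sub>C (f o\<^sub>L g)"
  by (rule blinfun_eqI) simp

lemma compose_scaleC_right: "f \<in> bops \<Longrightarrow> f o\<^sub>L (c *\<^sub>C g) = c *\<^sub>C (f o\<^sub>L g)"
  by (rule blinfun_eqI) (simp add: bopsD)

section \<open>Orthonormal bases\<close>

definition orthonormal :: "'a::chilbert_space set \<Rightarrow> bool"
  where "orthonormal B \<longleftrightarrow> (\<forall>x\<in>B. \<forall>y\<in>B. cinner x y = (if x = y then 1 else 0))"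

lemma orthonormal_coefficient:
  assumes "orthonormal B" "finite B" "b \<in> B"
  shows "cinner (\<Sum>x\<in>B. c x *\<^sub>C x) b = c b"
proof -
  have "cinner (\<Sum>x\<in>B. c x *\<^sub>C x) b = (\<Sum>x\<in>B. c x * cinner x b)"
    by (simp add: cinner_sum_left cinner_scaleC_left)
  also have "\<dots> = (\<Sum>x\<in>B. if x = b then c x else 0)"
    using assms by (intro sum.cong) (auto simp: orthonormal_def)
  finally show ?thesis using assms by simp
qed

lemma orthonormal_independent:
  assumes "orthonormal B" "finite B"
  shows "complex_vector.independent B"
proof (rule complex_vector.independent_if_scalars_zero[OF assms(2)])
  fix f x assume "(\<Sum>x\<in>B. f x *\<^sub>C x) = 0" "x \<in> B"
  then show "f x = 0" using orthonormal_coefficient[OF assms, of x f] by simp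
qed

lemma orthonormal_card_bound:
  "\<exists>n. \<forall>B :: 'a::fin_dim_chilbert_space set. orthonormal B \<longrightarrow> finite B \<longrightarrow> card B \<le> n"
proof -
  obtain C :: "'a set" where C: "finite C" "\<forall>x. \<exists>c. x = (\<Sum>b\<in>C. c b *\<^sub>C b)"
    using finite_cspanning_set by blast
  have "x \<in> cspan C" for x
  proof -
    obtain c where "x = (\<Sum>b\<in>C. c b *\<^sub>C b)" using C(2) by blast
    then show ?thesis
      by (simp add: complex_vector.span_sum complex_vector.span_scale complex_vector.span_base)
  qed
  then show ?thesis
    using complex_vector.independent_span_bound[OF C(1) orthonormal_independent] by blast
qed

text \<open>A Gram-Schmidt step: a vector of \<open>L\<close> that differs from its projection onto
  the span of \<open>B\<close> leaves a nonzero residue, which is normalised.\<close>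

lemma orthonormal_extend:
  assumes L: "csubspace L" and B: "finite B" "orthonormal B" "B \<subseteq> L"
    and x: "x \<in> L" "x \<noteq> (\<Sum>b\<in>B. cinner x b *\<^sub>C b)"
  shows "\<exists>u\<in>L. u \<notin> B \<and> orthonormal (insert u B)"
proof -
  define y where "y = x - (\<Sum>b\<in>B. cinner x b *\<^sub>C b)"
  define u where "u = of_real (inverse (norm y)) *\<^sub>C y"
  have y0: "y \<noteq> 0" using x by (simp add: y_def)
  have yb: "cinner y b = 0" if "b \<in> B" for b
    using orthonormal_coefficient[OF B(2,1) that] by (simp add: y_def cinner_diff_left)
  have "y \<in> L" unfolding y_def
    by (intro complex_vector.subspace_diff[OF L] x complex_vector.subspace_sum[OF L]
        complex_vector.subspace_scale[OF L]) (use B in auto)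
  then have uL: "u \<in> L" by (simp add: u_def complex_vector.subspace_scale[OF L])
  have "norm u = 1" using y0 by (simp add: u_def norm_scaleC norm_inverse)
  then have uu: "cinner u u = 1" by (simp add: cinner_self)
  have ub: "cinner u b = 0" "cinner b u = 0" if "b \<in> B" for b
    using yb[OF that] cinner_commute[of b u] by (simp_all add: u_def cinner_scaleC_left)
  have "u \<notin> B" using ub uu by force
  moreover have "orthonormal (insert u B)" using B uu ub by (auto simp: orthonormal_def)
  ultimately show ?thesis using uL by blast
qed

text \<open>An orthonormal subset of \<open>L\<close> of maximal cardinality exists because the
  cardinalities are bounded; a vector without the expansion would enlarge it.\<close>

lemma orthonormal_basis_exists:
  fixes L :: "'a::fin_dim_chilbert_space set"
  assumes L: "csubspace L"
  shows "\<exists>B. finite B \<and> orthonormal B \<and> B \<subseteq> L \<and> (\<forall>x\<in>L. x = (\<Sum>b\<in>B. cinner x b *\<^sub>C b))"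
proof -
  define P where "P B \<longleftrightarrow> finite B \<and> orthonormal B \<and> B \<subseteq> L" for B
  obtain n where n: "\<And>B :: 'a set. orthonormal B \<Longrightarrow> finite B \<Longrightarrow> card B \<le> n"
    using orthonormal_card_bound by blast
  have "P {}" by (simp add: P_def orthonormal_def)
  then obtain B where B: "P B" and max: "\<And>B'. P B' \<Longrightarrow> card B' \<le> card B"
    using ex_has_greatest_nat[of P "{}" card "Suc n"] n
    by (metis P_def less_Suc_eq_le)
  have fin: "finite B" and orth: "orthonormal B" and BL: "B \<subseteq> L" using B by (auto simp: P_def)
  have "x = (\<Sum>b\<in>B. cinner x b *\<^sub>C b)" if x: "x \<in> L" for x
  proof (rule ccontr)
    assume "x \<noteq> (\<Sum>b\<in>B. cinner x b *\<^sub>C b)"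
    then obtain u where u: "u \<in> L" "u \<notin> B" "orthonormal (insert u B)"
      using orthonormal_extend[OF L fin orth BL x] by blast
    then have "P (insert u B)" using fin BL by (auto simp: P_def)
    then show False using max[of "insert u B"] fin u(2) by simp
  qed
  then show ?thesis using fin orth BL by blast
qed

text \<open>One basis is chosen for each type; its vectors serve directly as row and column indices,
  so matrix entries need no enumeration.\<close>

definition onb :: "'a::fin_dim_chilbert_space set"
  where "onb = (SOME B. finite B \<and> orthonormal B \<and> (\<forall>x. x = (\<Sum>b\<in>B. cinner x b *\<^sub>C b)))"

lemma onb:
  fixes x :: "'a::fin_dim_chilbert_space"
  shows "finite (onb :: 'a set)" "orthonormal (onb :: 'a set)" "x = (\<Sum>b\<in>onb. cinner x b *\<^sub>C b)"
proof -
  have "\<exists>B :: 'a set. finite B \<and> orthonormal B \<and> (\<forall>x. x = (\<Sum>b\<in>B. cinner x b *\<^sub>C b))"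
    using orthonormal_basis_exists[of "UNIV :: 'a set"] by auto
  then have *: "finite (onb :: 'a set) \<and> orthonormal (onb :: 'a set) \<and>
      (\<forall>x :: 'a. x = (\<Sum>b\<in>onb. cinner x b *\<^sub>C b))"
    unfolding onb_def by (rule someI_ex)
  show "finite (onb :: 'a set)" "orthonormal (onb :: 'a set)" using * by blast+
  show "x = (\<Sum>b\<in>onb. cinner x b *\<^sub>C b)"
    by (rule *[THEN conjunct2, THEN conjunct2, rule_format])
qed

lemmas finite_onb [simp] = onb(1)

lemma cinner_onb: "a \<in> onb \<Longrightarrow> b \<in> onb \<Longrightarrow> cinner a b = (if a = b then 1 else 0)"
  using onb(2) unfolding orthonormal_def by blast

lemma onb_eqI:
  fixes x y :: "'a::fin_dim_chilbert_space"
  assumes "\<And>b. b \<in> onb \<Longrightarrow> cinner x b = cinner y b"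
  shows "x = y"
  by (subst (1 2) onb(3)) (simp add: assms cong: sum.cong)

text \<open>The rank-one operator of \<open>u\<close> and \<open>v\<close>; for basis vectors these
  are the matrix units.\<close>

lift_definition ketbra :: "'b::chilbert_space \<Rightarrow> 'a::chilbert_space \<Rightarrow> 'a \<Rightarrow>\<^sub>L 'b"
  is "\<lambda>u v x. cinner x v *\<^sub>C u"
proof (rule bounded_linear_intro)
  fix u v and x y :: 'a and r
  show "cinner (x + y) v *\<^sub>C (u :: 'b) = cinner x v *\<^sub>C u + cinner y v *\<^sub>C u"
    by (simp add: cinner_add_left scaleC_add_left)
  show "cinner (r *\<^sub>R x) v *\<^sub>C u = r *\<^sub>R cinner x v *\<^sub>C u"
    by (simp add: scaleR_scaleC cinner_scaleC_left scaleC_scaleC)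
  show "norm (cinner x v *\<^sub>C u) \<le> norm x * (norm v * norm u)"
    using mult_right_mono[OF cinner_Cauchy_Schwarz[of x v] norm_ge_zero[of u]]
    by (simp add: norm_scaleC mult_ac)
qed

declare ketbra.rep_eq [simp]

lemma ketbra_bops [simp]: "ketbra u v \<in> bops"
  by (simp add: bops_def cinner_scaleC_left scaleC_scaleC)

lemma blinfun_sum_apply: "blinfun_apply (\<Sum>i\<in>I. f i) x = (\<Sum>i\<in>I. blinfun_apply (f i) x)"
  by (simp add: blinfun.sum_left)

lemma bops_apply_sum: "f \<in> bops \<Longrightarrow> f (\<Sum>i\<in>I. c i *\<^sub>C x i) = (\<Sum>i\<in>I. c i *\<^sub>C f (x i))"
  by (simp add: blinfun.sum_right bopsD)

lemma bops_onb_eqI: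
  fixes f g :: "'a::fin_dim_chilbert_space \<Rightarrow>\<^sub>L 'b::chilbert_space"
  assumes "f \<in> bops" "g \<in> bops" "\<And>e. e \<in> onb \<Longrightarrow> f e = g e"
  shows "f = g"
proof (rule blinfun_eqI)
  fix x show "f x = g x"
    by (subst (1 2) onb(3)[of x]) (simp add: bops_apply_sum assms cong: sum.cong)
qed

lemma ex_bops_on_onb:
  fixes h :: "'a::fin_dim_chilbert_space \<Rightarrow> 'b::chilbert_space"
  shows "\<exists>f \<in> bops. \<forall>e\<in>onb. blinfun_apply f e = h e"
proof (intro bexI ballI)
  fix e :: 'a assume e: "e \<in> onb"
  have "(\<Sum>b\<in>onb. ketbra (h b) b) e = (\<Sum>b\<in>onb. (if b = e then h b else 0))"
    unfolding blinfun_sum_apply using e by (intro sum.cong) (auto simp: cinner_onb)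
  then show "(\<Sum>b\<in>onb. ketbra (h b) b) e = h e" using e by simp
qed (intro bops_sum ketbra_bops)

lemma bops_expand:
  fixes f :: "'a::fin_dim_chilbert_space \<Rightarrow>\<^sub>L 'b::fin_dim_chilbert_space"
  assumes "f \<in> bops"
  shows "f = (\<Sum>e\<in>onb. \<Sum>d\<in>onb. cinner (f e) d *\<^sub>C ketbra d e)"
proof (rule bops_onb_eqI[OF assms])
  show "(\<Sum>e\<in>onb. \<Sum>d\<in>onb. cinner (f e) d *\<^sub>C ketbra d e) \<in> bops"
    by (intro bops_sum bops_scaleC ketbra_bops)
  fix x :: 'a assume x: "x \<in> onb"
  have "(\<Sum>e\<in>onb. \<Sum>d\<in>onb. cinner (f e) d *\<^sub>C ketbra d e) x
      = (\<Sum>e\<in>onb. cinner x e *\<^sub>C (\<Sum>d\<in>onb. cinner (f e) d *\<^sub>C d))"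
    by (simp add: blinfun_sum_apply scaleC_sum_right scaleC_scaleC mult.commute)
  also have "\<dots> = (\<Sum>e\<in>onb. if e = x then f e else 0)"
    using x by (intro sum.cong refl) (auto simp: cinner_onb onb(3)[symmetric])
  finally show "f x = (\<Sum>e\<in>onb. \<Sum>d\<in>onb. cinner (f e) d *\<^sub>C ketbra d e) x"
    using x by simp
qed

section \<open>Positivity of operator matrices\<close>

text \<open>An arbitrary index set allows pairs as indices, such as a matrix index with a basis
  vector, without coding them as numbers.\<close>

definition psd :: "'i set \<Rightarrow> ('i \<Rightarrow> 'i \<Rightarrow> 'a::chilbert_space \<Rightarrow>\<^sub>L 'a) \<Rightarrow> bool"
  where "psd J A \<longleftrightarrow> (\<forall>x. (\<Sum>i\<in>J. \<Sum>j\<in>J. cinner (A i j (x j)) (x i)) \<in> \<real>\<^sub>\<ge>\<^sub>0)"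

lemma opmat_positive_iff_psd: "opmat_positive n A \<longleftrightarrow> psd {..<n} A"
  by (simp add: opmat_positive_def psd_def opmat_apply_def cinner_sum_left)

lemma psd_reindex:
  fixes A :: "'j \<Rightarrow> 'j \<Rightarrow> 'a::chilbert_space \<Rightarrow>\<^sub>L 'a" and h :: "'i \<Rightarrow> 'j"
  assumes "bij_betw h I J"
  shows "psd J A \<longleftrightarrow> psd I (\<lambda>i j. A (h i) (h j))"
proof -
  have eq: "(\<Sum>i\<in>J. \<Sum>j\<in>J. F i j) = (\<Sum>i\<in>I. \<Sum>j\<in>I. F (h i) (h j))" for F :: "_ \<Rightarrow> _ \<Rightarrow> complex"
    by (simp add: sum.reindex_bij_betw[OF assms, symmetric])
  have cover: "\<exists>y. \<forall>i\<in>I. y (h i) = x i" for x :: "'i \<Rightarrow> 'a"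
  proof (intro exI ballI)
    fix i assume "i \<in> I"
    then show "(\<lambda>j. x (inv_into I h j)) (h i) = x i"
      using assms by (simp add: bij_betw_inv_into_left)
  qed
  show ?thesis
  proof
    assume L: "psd J A"
    show "psd I (\<lambda>i j. A (h i) (h j))"
      unfolding psd_def
    proof
      fix x :: "'i \<Rightarrow> 'a"
      obtain y where y: "\<forall>i\<in>I. y (h i) = x i" using cover by blast
      have "(\<Sum>i\<in>I. \<Sum>j\<in>I. cinner (A (h i) (h j) (x j)) (x i)) =
          (\<Sum>i\<in>I. \<Sum>j\<in>I. cinner (A (h i) (h j) (y (h j))) (y (h i)))"
        using y by (intro sum.cong) auto
      then show "(\<Sum>i\<in>I. \<Sum>j\<in>I. cinner (A (h i) (h j) (x j)) (x i)) \<in> \<real>\<^sub>\<ge>\<^sub>0"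
        using L[unfolded psd_def, rule_format, of y] by (simp add: eq)
    qed
  next
    assume R: "psd I (\<lambda>i j. A (h i) (h j))"
    show "psd J A"
      unfolding psd_def
    proof
      fix x
      show "(\<Sum>i\<in>J. \<Sum>j\<in>J. cinner (A i j (x j)) (x i)) \<in> \<real>\<^sub>\<ge>\<^sub>0"
        unfolding eq using R[unfolded psd_def, rule_format, of "\<lambda>i. x (h i)"] by simp
    qed
  qed
qed

text \<open>Complete positivity is defined for matrices numbered from 0; transport along a bijection
  makes it available for every finite index set.\<close>

lemma completely_positive_on_psd:
  assumes "completely_positive_on S \<phi>" "finite J" "\<And>i j. i \<in> J \<Longrightarrow> j \<in> J \<Longrightarrow> A i j \<in> S" "psd J A"
  shows "psd J (\<lambda>i j. \<phi> (A i j))"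
proof -
  obtain h where h: "bij_betw h {..<card J} J"
    using ex_bij_betw_nat_finite[OF assms(2)] by (auto simp: atLeast0LessThan)
  have "h i \<in> J" if "i < card J" for i using h that by (auto simp: bij_betw_def)
  then have "\<forall>i<card J. \<forall>j<card J. A (h i) (h j) \<in> S" using assms(3) by simp
  moreover have "opmat_positive (card J) (\<lambda>i j. A (h i) (h j))"
    using assms(4) psd_reindex[OF h, of A] by (simp add: opmat_positive_iff_psd)
  ultimately have "opmat_positive (card J) (\<lambda>i j. \<phi> (A (h i) (h j)))"
    by (rule assms(1)[unfolded completely_positive_on_def, THEN spec, THEN spec, THEN mp, THEN mp])
  then show ?thesis
    using psd_reindex[OF h, of "\<lambda>i j. \<phi> (A i j)"] by (simp add: opmat_positive_iff_psd)
qed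

lemma psd_cong: "psd J A \<Longrightarrow> (\<And>i j. i \<in> J \<Longrightarrow> j \<in> J \<Longrightarrow> A i j = B i j) \<Longrightarrow> psd J B"
  by (simp add: psd_def cong: sum.cong)

section \<open>Extension of positive functionals\<close>

text \<open>The scalar multiplication is a parameter because the extension is applied to complex
  matrices regarded as a real vector space. \<open>f\<close> is total, but only its values on
  \<open>W\<close> matter.\<close>

definition positive_functional_on ::
    "(real \<Rightarrow> 'v \<Rightarrow> 'v) \<Rightarrow> 'v::ab_group_add set \<Rightarrow> 'v set \<Rightarrow> ('v \<Rightarrow> real) \<Rightarrow> bool"
  where "positive_functional_on scl P W f \<longleftrightarrow>
    module.subspace scl W \<and> (\<forall>x\<in>W. \<forall>y\<in>W. f (x + y) = f x + f y) \<and>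
    (\<forall>r. \<forall>x\<in>W. f (scl r x) = r * f x) \<and> (\<forall>x\<in>W \<inter> P. 0 \<le> f x)"

text \<open>The M. Riesz extension step: the value at the new vector \<open>v\<close> is the supremum of \<open>f w\<close> over
  the \<open>w\<close> below \<open>v\<close>; the order unit \<open>u\<close> makes that supremum finite.\<close>

lemma positive_functional_extension_step:
  fixes scl :: "real \<Rightarrow> 'v::ab_group_add \<Rightarrow> 'v"
  assumes vs: "vector_space scl" and f: "positive_functional_on scl P W f"
    and Padd: "\<And>x y. x \<in> P \<Longrightarrow> y \<in> P \<Longrightarrow> x + y \<in> P"
    and Pscale: "\<And>r x. 0 \<le> r \<Longrightarrow> x \<in> P \<Longrightarrow> scl r x \<in> P"
    and u: "u \<in> W" and unit: "\<And>x. \<exists>c. scl c u + x \<in> P"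
  shows "\<exists>W' f'. positive_functional_on scl P W' f' \<and> insert v W \<subseteq> W' \<and> (\<forall>x\<in>W. f' x = f x)"
proof (cases "v \<in> W")
  case True
  then show ?thesis using f by blast
next
  case v: False
  interpret V: vector_space scl by fact
  have W: "V.subspace W" and fadd: "\<And>x y. x \<in> W \<Longrightarrow> y \<in> W \<Longrightarrow> f (x + y) = f x + f y"
    and fscale: "\<And>r x. x \<in> W \<Longrightarrow> f (scl r x) = r * f x"
    and fpos: "\<And>x. x \<in> W \<Longrightarrow> x \<in> P \<Longrightarrow> 0 \<le> f x"
    using f by (auto simp: positive_functional_on_def)
  have fdiff: "f (x - y) = f x - f y" if "x \<in> W" "y \<in> W" for x y
    using fadd[of "x - y" y] that V.subspace_diff[OF W] by simp
  define A where "A = f ` {w \<in> W. v - w \<in> P}"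
  define c where "c = Sup A"
  have upper: "f w \<le> f w'" if "w \<in> W" "v - w \<in> P" "w' \<in> W" "w' - v \<in> P" for w w'
    using fpos[of "w' - w"] Padd[OF that(2,4)] that V.subspace_diff[OF W] by (simp add: fdiff)
  obtain k1 where "scl k1 u + v \<in> P" using unit by blast
  then have "v - scl (- k1) u \<in> P" by (simp add: add.commute)
  then have ne: "A \<noteq> {}" unfolding A_def using V.subspace_scale[OF W u] by blast
  obtain k2 where "scl k2 u + - v \<in> P" using unit by blast
  then have k2: "scl k2 u - v \<in> P" by simp
  have bdd: "bdd_above A"
    unfolding A_def using upper[OF _ _ V.subspace_scale[OF W u] k2] by (auto intro!: bdd_aboveI)
  have c1: "f w \<le> c" if "w \<in> W" "v - w \<in> P" for w
    unfolding c_def by (rule cSup_upper[OF _ bdd]) (use that in \<open>auto simp: A_def\<close>)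
  have c2: "c \<le> f w" if "w \<in> W" "w - v \<in> P" for w
    unfolding c_def by (rule cSup_least[OF ne]) (use that upper in \<open>auto simp: A_def\<close>)
  \<comment> \<open>The coordinate along \<open>v\<close>. It is unique because \<open>v\<close>
    lies outside \<open>W\<close>, so the choice operator recovers it.\<close>
  define \<alpha> where "\<alpha> x = (SOME a. x - scl a v \<in> W)" for x
  have \<alpha>: "\<alpha> (w + scl a v) = a" if w: "w \<in> W" for w a
  proof -
    have "b = a" if "w + scl a v - scl b v \<in> W" for b
    proof (rule ccontr)
      assume "b \<noteq> a"
      have "(w + scl a v - scl b v) - w \<in> W" by (rule V.subspace_diff[OF W that w])
      then have "scl (a - b) v \<in> W" by (simp add: V.scale_left_diff_distrib)
      then have "scl (inverse (a - b)) (scl (a - b) v) \<in> W" by (rule V.subspace_scale[OF W])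
      then show False using v \<open>b \<noteq> a\<close> by simp
    qed
    then show ?thesis unfolding \<alpha>_def 
      using w by (intro some_equality) (simp_all only: add_diff_cancel_right')
  qed
  define f' where "f' x = f (x - scl (\<alpha> x) v) + \<alpha> x * c" for x
  have f': "f' (w + scl a v) = f w + a * c" if "w \<in> W" for w a
    by (simp add: f'_def \<alpha>[OF that])
  define W' where "W' = {w + scl a v | w a. w \<in> W}"
  have WW': "w \<in> W'" if "w \<in> W" for w
  proof -
    have "w = w + scl 0 v" by simp
    then show ?thesis unfolding W'_def using that by blast
  qed
  have vW': "v \<in> W'"
  proof -
    have "v = 0 + scl 1 v" by simp
    then show ?thesis unfolding W'_def using V.subspace_0[OF W] by blast
  qed
  have sum_eq: "(w1 + scl a1 v) + (w2 + scl a2 v) = (w1 + w2) + scl (a1 + a2) v"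
    and scale_eq: "scl r (w1 + scl a1 v) = scl r w1 + scl (r * a1) v" for w1 w2 a1 a2 r
    by (simp_all add: V.scale_left_distrib V.scale_right_distrib)
  have subW': "V.subspace W'"
  proof (rule V.subspaceI)
    show "0 \<in> W'" using WW' V.subspace_0[OF W] by blast
    show "x + y \<in> W'" if "x \<in> W'" "y \<in> W'" for x y
      using that unfolding W'_def by (auto simp: sum_eq) (metis V.subspace_add[OF W])
    show "scl r x \<in> W'" if "x \<in> W'" for r x
      using that unfolding W'_def by (auto simp: scale_eq) (metis V.subspace_scale[OF W])
  qed
  \<comment> \<open>After division by the modulus of \<open>a\<close>, membership in
    \<open>P\<close> compares \<open>v\<close> with an element of \<open>W\<close>, from below or
    from above according to the sign of \<open>a\<close>; the two cases are \<open>c1\<close> and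
    \<open>c2\<close>.\<close>
  have pos': "0 \<le> f w + a * c" if w: "w \<in> W" and P: "w + scl a v \<in> P" for w a
  proof -
    consider "a = 0" | "a > 0" | "a < 0" by linarith
    then show ?thesis
    proof cases
      case 1 then show ?thesis using fpos[OF w] P by simp
    next
      case 2
      have "scl (inverse a) (w + scl a v) \<in> P" using 2 P by (intro Pscale) auto
      then have "v - scl (- inverse a) w \<in> P" using 2 by (simp add: V.scale_right_distrib add.commute)
      then have "- inverse a * f w \<le> c" using c1 w V.subspace_scale[OF W w] fscale[OF w] by metis
      then show ?thesis using 2 by (simp add: field_simps)
    next
      case 3
      have "scl (inverse (- a)) (w + scl a v) \<in> P" using 3 P by (intro Pscale) auto
      then have "scl (- inverse a) w - v \<in> P" 
        using 3 by (simp add: V.scale_right_distrib minus_diff_commute[of v])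
      then have "c \<le> - inverse a * f w" using c2 w V.subspace_scale[OF W w] fscale[OF w] by metis
      then show ?thesis using 3 by (simp add: field_simps)
    qed
  qed
  have "positive_functional_on scl P W' f'"
    unfolding positive_functional_on_def
  proof (intro conjI ballI allI)
    show "f' (x + y) = f' x + f' y" if xy: "x \<in> W'" "y \<in> W'" for x y
    proof -
      obtain w1 a1 w2 a2 where "x = w1 + scl a1 v" "y = w2 + scl a2 v" "w1 \<in> W" "w2 \<in> W"
        using xy unfolding W'_def by blast
      then show ?thesis
        using V.subspace_add[OF W] by (simp only: sum_eq f' fadd) (simp add: algebra_simps)
    qed
    show "f' (scl r x) = r * f' x" if x: "x \<in> W'" for r x
    proof -
      obtain w1 a1 where "x = w1 + scl a1 v" "w1 \<in> W" using x unfolding W'_def by blast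
      then show ?thesis
        using V.subspace_scale[OF W] by (simp only: scale_eq f' fscale) (simp add: algebra_simps)
    qed
    show "0 \<le> f' x" if "x \<in> W' \<inter> P" for x
      using that pos' by (auto simp: W'_def f')
  qed (rule subW')
  moreover have "f' x = f x" if "x \<in> W" for x using f'[OF that, of 0] by simp
  ultimately show ?thesis using WW' vW' by blast
qed

text \<open>\<open>B\<close> will be a real basis of a space of matrices. Being finite, it is
  reached by iterating the single step, without a maximality argument.\<close>

lemma positive_functional_extension:
  fixes scl :: "real \<Rightarrow> 'v::ab_group_add \<Rightarrow> 'v"
  assumes vs: "vector_space scl" and f: "positive_functional_on scl P W f"
    and Padd: "\<And>x y. x \<in> P \<Longrightarrow> y \<in> P \<Longrightarrow> x + y \<in> P"
    and Pscale: "\<And>r x. 0 \<le> r \<Longrightarrow> x \<in> P \<Longrightarrow> scl r x \<in> P"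
    and u: "u \<in> W" and unit: "\<And>x. \<exists>c. scl c u + x \<in> P"
    and "finite B"
  shows "\<exists>W' f'. positive_functional_on scl P W' f' \<and> B \<union> W \<subseteq> W' \<and> (\<forall>x\<in>W. f' x = f x)"
  using \<open>finite B\<close>
proof induction
  case empty
  show ?case using f by auto
next
  case (insert b B)
  then obtain W' f' where 1: "positive_functional_on scl P W' f'" "B \<union> W \<subseteq> W'" "\<forall>x\<in>W. f' x = f x"
    by blast
  obtain W'' f'' where 2: "positive_functional_on scl P W'' f''" "insert b W' \<subseteq> W''"
      "\<forall>x\<in>W'. f'' x = f' x"
    using positive_functional_extension_step[OF vs 1(1) Padd Pscale _ unit, of b] u 1(2) by blast
  show ?case
  proof (intro exI conjI)
    show "insert b B \<union> W \<subseteq> W''" using 1(2) 2(2) by blast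
    show "\<forall>x\<in>W. f'' x = f x" using 1 2 by (simp add: subset_iff)
  qed (rule 2(1))
qed

text \<open>The quadratic form at the vector with entry 1 at \<open>i\<close> and entry
  \<open>c\<close> at \<open>p\<close>. Varying \<open>c\<close> yields what is needed about single
  entries of a positive kernel.\<close>

lemma psd_kernel_two_points:
  fixes k :: "'i \<Rightarrow> 'i \<Rightarrow> complex"
  assumes "finite J" and psd: "\<And>x. (\<Sum>i\<in>J. \<Sum>j\<in>J. k i j * x i * cnj (x j)) \<in> \<real>\<^sub>\<ge>\<^sub>0"
    and "i \<in> J" "p \<in> J" "i \<noteq> p"
  shows "k i i + k i p * cnj c + k p i * c + k p p * (c * cnj c) \<in> \<real>\<^sub>\<ge>\<^sub>0"
proof -
  define x where "x q = (if q = i then 1 else if q = p then c else 0)" for q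
  have r: "(\<Sum>q\<in>J. G q) = (\<Sum>q\<in>{i,p}. G q)" if "\<And>q. q \<notin> {i,p} \<Longrightarrow> G q = 0" for G :: "'i \<Rightarrow> complex"
    by (rule sum.mono_neutral_right) (use assms that in auto)
  have "(\<Sum>a\<in>J. \<Sum>b\<in>J. k a b * x a * cnj (x b)) = (\<Sum>a\<in>{i,p}. \<Sum>b\<in>{i,p}. k a b * x a * cnj (x b))"
    by (subst r, simp add: x_def, rule sum.cong[OF refl], rule r, simp add: x_def)
  also have "\<dots> = k i i + k i p * cnj c + k p i * c + k p p * (c * cnj c)"
    using assms by (simp add: x_def algebra_simps)
  finally show ?thesis using psd[of x] by simp
qed

lemma psd_kernel_diag:
  fixes k :: "'i \<Rightarrow> 'i \<Rightarrow> complex"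
  assumes "finite J" and psd: "\<And>x. (\<Sum>i\<in>J. \<Sum>j\<in>J. k i j * x i * cnj (x j)) \<in> \<real>\<^sub>\<ge>\<^sub>0" and "p \<in> J"
  shows "k p p \<in> \<real>\<^sub>\<ge>\<^sub>0"
proof -
  define x where "x q = (if q = p then 1 else 0 :: complex)" for q
  have "(\<Sum>a\<in>J. \<Sum>b\<in>J. k a b * x a * cnj (x b)) = (\<Sum>a\<in>J. \<Sum>b\<in>J. if b = p then (if a = p then k a b else 0) else 0)"
    by (intro sum.cong) (auto simp: x_def)
  also have "\<dots> = k p p" using assms by simp
  finally show ?thesis using psd[of x] by simp
qed

text \<open>The two-point form takes real values; its imaginary parts at \<open>c = 1\<close> and
  \<open>c = \<i>\<close> give the two real equations that make up the claim.\<close>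

lemma psd_kernel_hermitian:
  fixes k :: "'i \<Rightarrow> 'i \<Rightarrow> complex"
  assumes "finite J" and psd: "\<And>x. (\<Sum>i\<in>J. \<Sum>j\<in>J. k i j * x i * cnj (x j)) \<in> \<real>\<^sub>\<ge>\<^sub>0"
    and "i \<in> J" "p \<in> J"
  shows "k p i = cnj (k i p)"
proof (cases "i = p")
  case True
  then show ?thesis using psd_kernel_diag[OF assms(1,2,4)]
    by (simp add: complex_eq_iff complex_nonneg_Reals_iff)
next
  case False
  note * = psd_kernel_two_points[OF assms(1,2,3,4) False]
  show ?thesis
    using *[of 1] *[of \<i>] psd_kernel_diag[OF assms(1,2,3)] psd_kernel_diag[OF assms(1,2,4)]
    by (simp add: complex_eq_iff complex_nonneg_Reals_iff)
qed

text \<open>With a zero diagonal entry the two-point form has no quadratic term in \<open>c\<close>,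
  so it would become negative in a suitable direction unless its linear term vanished.\<close>

lemma psd_kernel_zero_row:
  fixes k :: "'i \<Rightarrow> 'i \<Rightarrow> complex"
  assumes "finite J" and psd: "\<And>x. (\<Sum>i\<in>J. \<Sum>j\<in>J. k i j * x i * cnj (x j)) \<in> \<real>\<^sub>\<ge>\<^sub>0"
    and "i \<in> J" "p \<in> J" and 0: "k p p = 0"
  shows "k p i = 0"
proof (cases "i = p")
  case False
  define n where "n = (cmod (k p i))\<^sup>2"
  have herm: "k i p = cnj (k p i)" by (rule psd_kernel_hermitian[OF assms(1,2,4,3)])
  have nk: "k p i * cnj (k p i) = of_real n" unfolding n_def by (rule complex_norm_square[symmetric])
  have *: "0 \<le> Re (k i i) - 2 * t * n" for t :: real
  proof -
    \<comment> \<open>This direction makes the linear term equal to \<open>- 2 * t * n\<close>,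
      where \<open>n\<close> is the squared modulus of the entry.\<close>
    define c where "c = of_real (- t) * cnj (k p i)"
    have "k i i + k i p * cnj c + k p i * c + k p p * (c * cnj c)
        = k i i - of_real (2 * t) * (k p i * cnj (k p i))"
      by (simp add: herm 0 c_def algebra_simps)
    also have "\<dots> = k i i - of_real (2 * t * n)" unfolding nk by simp
    finally have eq: "k i i + k i p * cnj c + k p i * c + k p p * (c * cnj c)
        = k i i - of_real (2 * t * n)" .
    have "k i i - of_real (2 * t * n) \<in> \<real>\<^sub>\<ge>\<^sub>0"
      using psd_kernel_two_points[OF assms(1,2,3,4) False, of c] unfolding eq .
    then show ?thesis by (simp add: complex_nonneg_Reals_iff)
  qed
  have "n = 0"
  proof (rule ccontr)
    assume "n \<noteq> 0"
    then have n: "n > 0" by (simp add: n_def)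
    show False using *[of "(Re (k i i) + 1) / (2 * n)"] n by simp
  qed
  then show ?thesis by (simp add: n_def)
qed (use 0 in simp)

text \<open>Cholesky decomposition: removing the index \<open>p\<close> by a Schur complement leaves
  a positive kernel on \<open>J\<close>, and the subtracted rank-one kernel contributes one more
  Gram vector.\<close>

lemma psd_kernel_gram:
  fixes k :: "'i \<Rightarrow> 'i \<Rightarrow> complex"
  assumes "finite J" "\<And>x. (\<Sum>i\<in>J. \<Sum>j\<in>J. k i j * x i * cnj (x j)) \<in> \<real>\<^sub>\<ge>\<^sub>0"
  shows "\<exists>(N::nat) u. \<forall>i\<in>J. \<forall>j\<in>J. k i j = (\<Sum>l<N. cnj (u l i) * u l j)"
  using assms
proof (induction J arbitrary: k rule: finite_induct)
  case empty
  then show ?case by simp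
next
  case (insert p J k)
  have fin: "finite (insert p J)" using insert.hyps by simp
  note psd = insert.prems
  note herm = psd_kernel_hermitian[OF fin psd]
  define d where "d = Re (k p p)"
  have d: "k p p = of_real d" "d \<ge> 0"
    using psd_kernel_diag[OF fin psd, of p] by (auto simp: d_def complex_eq_iff complex_nonneg_Reals_iff)
  \<comment> \<open>For \<open>d = 0\<close> the quotient is 0 by convention and \<open>k'\<close>
    is \<open>k\<close>; row and column \<open>p\<close> then vanish already by positivity.\<close>
  define k' where "k' i j = k i j - k i p * k p j / of_real d" for i j
  have k'_zero: "k' i p = 0" "k' p i = 0" if "i \<in> insert p J" for i
    using that d psd_kernel_zero_row[OF fin psd, of i p] herm[of p i] by (auto simp: k'_def)
  have "(\<Sum>i\<in>J. \<Sum>j\<in>J. k' i j * x i * cnj (x j)) \<in> \<real>\<^sub>\<ge>\<^sub>0" for x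
  proof -
    define s where "s = (\<Sum>i\<in>J. k i p * x i)"
    \<comment> \<open>The entry at \<open>p\<close> that minimises the form of \<open>k\<close> for
      given entries on \<open>J\<close>; the minimum is the form of the Schur complement.\<close>
    define y where "y = x(p := - s / of_real d)"
    define Q where "Q = (\<Sum>i\<in>J. \<Sum>j\<in>J. k i j * x i * cnj (x j))"
    have s': "(\<Sum>j\<in>J. k p j * cnj (x j)) = cnj s"
      unfolding s_def cnj_sum using herm[of _ p] by (intro sum.cong) auto
    have yJ: "y i = x i" if "i \<in> J" for i using that insert.hyps by (auto simp: y_def)
    have "(\<Sum>i\<in>insert p J. \<Sum>j\<in>insert p J. k i j * y i * cnj (y j))
        = k p p * y p * cnj (y p) + y p * (\<Sum>j\<in>J. k p j * cnj (x j)) + cnj (y p) * s + Q"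
      using insert.hyps yJ
      by (simp add: Q_def s_def sum.distrib sum_distrib_left algebra_simps cong: sum.cong)
    also have "\<dots> = Q - s * cnj s / of_real d"
      unfolding s' d by (simp add: y_def)
    also have "\<dots> = (\<Sum>i\<in>J. \<Sum>j\<in>J. k' i j * x i * cnj (x j))"
    proof -
      have "(\<Sum>i\<in>J. \<Sum>j\<in>J. k' i j * x i * cnj (x j))
          = Q - (\<Sum>i\<in>J. \<Sum>j\<in>J. (k i p * x i) * (k p j * cnj (x j)) / of_real d)"
        by (simp add: Q_def k'_def sum_subtractf algebra_simps)
      also have "(\<Sum>i\<in>J. \<Sum>j\<in>J. (k i p * x i) * (k p j * cnj (x j)) / of_real d) = s * cnj s / of_real d"
        by (subst s'[symmetric], subst s_def) (simp only: sum_product sum_divide_distrib)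
      finally show ?thesis by simp
    qed
    finally show ?thesis using psd[of y] by simp
  qed
  from insert.IH[OF this] obtain N and u :: "nat \<Rightarrow> 'i \<Rightarrow> complex"
    where u: "\<And>i j. i \<in> J \<Longrightarrow> j \<in> J \<Longrightarrow> k' i j = (\<Sum>l<N. cnj (u l i) * u l j)" by blast
  \<comment> \<open>The vectors for \<open>J\<close> are continued by 0 at \<open>p\<close>; the
    vector with number \<open>N\<close> accounts for the subtracted kernel, hence
    \<open>Suc N\<close> of them.\<close>
  define v where "v l i = (if l < N then (if i = p then 0 else u l i) else k p i / of_real (sqrt d))" for l i
  have sq: "of_real (sqrt d) * of_real (sqrt d) = (of_real d :: complex)"
    using d(2) by (simp flip: of_real_mult)
  have "k i j = (\<Sum>l<Suc N. cnj (v l i) * v l j)" if ij: "i \<in> insert p J" "j \<in> insert p J" for i j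
  proof -
    have "(\<Sum>l<N. cnj (v l i) * v l j) = k' i j"
    proof (cases "i = p \<or> j = p")
      case True
      then show ?thesis using k'_zero ij by (auto simp: v_def)
    next
      case False
      then show ?thesis using u[of i j] ij by (auto simp: v_def)
    qed
    moreover have "cnj (v N i) * v N j = k i p * k p j / of_real d"
      using herm[of p i] ij by (simp add: v_def sq)
    ultimately show ?thesis by (simp add: k'_def)
  qed
  then show ?case by blast
qed

section \<open>Representation of completely positive families\<close>

lemma sum_fun_apply: "(\<Sum>i\<in>I. f i) x = (\<Sum>i\<in>I. f i x)"
  for f :: "'i \<Rightarrow> 'a \<Rightarrow> 'b::comm_monoid_add"
  by (induction I rule: infinite_finite_induct) auto

text \<open>\<open>Re F\<close> is extended from \<open>W\<close> to all matrices over
  \<open>J\<close>, with the identity matrix as order unit. The values of the extension at a real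
  basis determine a positive kernel \<open>\<rho>\<close>, and its Gram decomposition gives the
  vectors \<open>u\<close>.\<close>

lemma matrix_functional_representation:
  fixes F :: "('i \<times> 'i \<Rightarrow> complex) \<Rightarrow> complex"
  assumes fin: "finite J"
    and supp: "\<And>a p. a \<in> W \<Longrightarrow> p \<notin> J \<times> J \<Longrightarrow> a p = 0"
    and Wadd: "\<And>a b. a \<in> W \<Longrightarrow> b \<in> W \<Longrightarrow> a + b \<in> W"
    and Wscale: "\<And>c a. a \<in> W \<Longrightarrow> (\<lambda>p. c * a p) \<in> W"
    and Wone: "(\<lambda>p. if fst p = snd p \<and> fst p \<in> J then 1 else 0) \<in> W"
    and Fadd: "\<And>a b. a \<in> W \<Longrightarrow> b \<in> W \<Longrightarrow> F (a + b) = F a + F b"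
    and Fscale: "\<And>c a. a \<in> W \<Longrightarrow> F (\<lambda>p. c * a p) = c * F a"
    and pos: "\<And>a. a \<in> W \<Longrightarrow> (\<And>x. 0 \<le> Re (\<Sum>i\<in>J. \<Sum>j\<in>J. a (i, j) * x j * cnj (x i))) \<Longrightarrow> 0 \<le> Re (F a)"
  shows "\<exists>(N::nat) u. \<forall>a\<in>W. F a = (\<Sum>i\<in>J. \<Sum>j\<in>J. a (i, j) * (\<Sum>l<N. cnj (u l i) * u l j))"
proof -
  define scl :: "real \<Rightarrow> ('i \<times> 'i \<Rightarrow> complex) \<Rightarrow> ('i \<times> 'i \<Rightarrow> complex)"
    where "scl r a = (\<lambda>p. of_real r * a p)" for r a
  have vs: "vector_space scl"
    by unfold_locales (auto simp: scl_def fun_eq_iff algebra_simps)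
  interpret V: vector_space scl by (rule vs)
  define quad where "quad a x = (\<Sum>i\<in>J. \<Sum>j\<in>J. a (i, j) * x j * cnj (x i))" for a and x :: "'i \<Rightarrow> complex"
  \<comment> \<open>Only the real part of the form is tested, so \<open>P\<close> also contains all
    skew-hermitian matrices; the complex subspace \<open>W\<close> can then be treated without
    splitting its elements into hermitian parts.\<close>
  define P where "P = {a. \<forall>x. 0 \<le> Re (quad a x)}"
  define one where "one = (\<lambda>p :: 'i \<times> 'i. if fst p = snd p \<and> fst p \<in> J then 1 else 0 :: complex)"
  have quad_add: "quad (a + b) x = quad a x + quad b x" for a b x
    by (simp add: quad_def sum.distrib algebra_simps)
  have quad_scale: "quad (\<lambda>p. c * a p) x = c * quad a x" for c a x
    by (simp add: quad_def sum_distrib_left mult.assoc)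
  have one: "one \<in> W" unfolding one_def by (rule Wone)
  have zero: "0 \<in> W" using Wscale[OF one, of 0] by (simp add: zero_fun_def)
  have f: "positive_functional_on scl P W (\<lambda>a. Re (F a))"
    unfolding positive_functional_on_def
  proof (intro conjI ballI allI)
    show "V.subspace W"
      by (rule V.subspaceI) (auto simp: zero Wadd scl_def Wscale)
  next
    fix x assume "x \<in> W \<inter> P"
    then show "0 \<le> Re (F x)" by (intro pos) (auto simp: P_def quad_def)
  qed (auto simp: Fadd scl_def Fscale)
  have unit: "\<exists>c. scl c one + a \<in> P" for a
  proof
    \<comment> \<open>The sum of the moduli of all entries bounds the form of \<open>a\<close> at
      \<open>x\<close> by \<open>c * s\<close>, which is exactly what \<open>c\<close> times the
      identity matrix compensates.\<close>
    define c where "c = (\<Sum>i\<in>J. \<Sum>j\<in>J. cmod (a (i, j)))"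
    show "scl c one + a \<in> P"
      unfolding P_def
    proof (intro CollectI allI)
      fix x
      define s where "s = (\<Sum>i\<in>J. (cmod (x i))\<^sup>2)"
      have le_s: "(cmod (x i))\<^sup>2 \<le> s" if "i \<in> J" for i
        unfolding s_def using fin that by (intro member_le_sum) auto
      have "quad one x = (\<Sum>i\<in>J. \<Sum>j\<in>J. if j = i then x j * cnj (x i) else 0)"
        unfolding quad_def by (intro sum.cong) (auto simp: one_def)
      also have "\<dots> = of_real s" using fin by (simp add: s_def complex_norm_square del: of_real_power)
      finally have q1: "quad one x = of_real s" .
      have "cmod (quad a x) \<le> (\<Sum>i\<in>J. \<Sum>j\<in>J. cmod (a (i, j)) * s)"
        unfolding quad_def
      proof (intro sum_norm_le)
        fix i j assume ij: "i \<in> J" "j \<in> J"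
        have "2 * (cmod (x j) * cmod (x i)) \<le> (cmod (x j))\<^sup>2 + (cmod (x i))\<^sup>2"
          using sum_squares_bound[of "cmod (x j)" "cmod (x i)"] by simp
        also have "\<dots> \<le> 2 * s" using le_s[OF ij(1)] le_s[OF ij(2)] by simp
        finally show "cmod (a (i, j) * x j * cnj (x i)) \<le> cmod (a (i, j)) * s"
          by (simp add: norm_mult mult.assoc mult_left_mono)
      qed
      then have "cmod (quad a x) \<le> c * s" by (simp add: c_def sum_distrib_right)
      moreover have "- cmod (quad a x) \<le> Re (quad a x)"
        using abs_Re_le_cmod[of "quad a x"] by simp
      ultimately show "0 \<le> Re (quad (scl c one + a) x)"
        by (simp add: quad_add scl_def quad_scale q1)
    qed
  qed
  \<comment> \<open>Matrix units and, in \<open>E'\<close>, their multiples by \<open>\<i>\<close>: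
    together a real basis of the matrices over \<open>J\<close>.\<close>
  define E :: "'i \<times> 'i \<Rightarrow> 'i \<times> 'i \<Rightarrow> complex" where "E p = (\<lambda>q. if q = p then 1 else 0)" for p
  define E' :: "'i \<times> 'i \<Rightarrow> 'i \<times> 'i \<Rightarrow> complex" where "E' p = (\<lambda>q. if q = p then \<i> else 0)" for p
  have "finite (E ` (J \<times> J) \<union> E' ` (J \<times> J))" using fin by simp
  moreover have "a + b \<in> P" if "a \<in> P" "b \<in> P" for a b
    using that by (auto simp: P_def quad_add)
  moreover have "scl r a \<in> P" if "0 \<le> r" "a \<in> P" for r a
    using that by (auto simp: P_def scl_def quad_scale)
  ultimately obtain W' f' where f': "positive_functional_on scl P W' f'"
      and sub: "E ` (J \<times> J) \<union> E' ` (J \<times> J) \<union> W \<subseteq> W'" and ext: "\<forall>a\<in>W. f' a = Re (F a)"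
    using positive_functional_extension[OF vs f _ _ one unit, of "E ` (J \<times> J) \<union> E' ` (J \<times> J)"]
    by blast
  have W': "V.subspace W'" and f'add: "\<And>x y. x \<in> W' \<Longrightarrow> y \<in> W' \<Longrightarrow> f' (x + y) = f' x + f' y"
    and f'scale: "\<And>r x. x \<in> W' \<Longrightarrow> f' (scl r x) = r * f' x"
    and f'pos: "\<And>x. x \<in> W' \<Longrightarrow> x \<in> P \<Longrightarrow> 0 \<le> f' x"
    using f' by (auto simp: positive_functional_on_def)
  have f'sum: "f' (\<Sum>p\<in>I. b p) = (\<Sum>p\<in>I. f' (b p))"
    if "finite I" "\<And>p. p \<in> I \<Longrightarrow> b p \<in> W'" for I :: "('i \<times> 'i) set" and b
    using that
  proof (induction I rule: finite_induct)
    case empty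
    then show ?case using f'scale[OF V.subspace_0[OF W'], of 0] by (simp add: zero_fun_def)
  next
    case (insert p I)
    have "f' (b p + (\<Sum>p\<in>I. b p)) = f' (b p) + f' (\<Sum>p\<in>I. b p)"
      using insert.prems by (intro f'add V.subspace_sum[OF W']) auto
    then show ?case using insert by (simp only: sum.insert insert_iff simp_thms)
  qed
  \<comment> \<open>A complex functional is recovered from its real part by subtracting
    \<open>\<i>\<close> times the value of the real part at the \<open>\<i>\<close>-fold argument;
    here the argument is a matrix unit.\<close>
  define \<rho> where "\<rho> p = of_real (f' (E p)) - \<i> * of_real (f' (E' p))" for p
  have key: "a \<in> W' \<and> f' a = Re (\<Sum>i\<in>J. \<Sum>j\<in>J. a (i, j) * \<rho> (i, j))"
    if a: "\<And>p. p \<notin> J \<times> J \<Longrightarrow> a p = 0" for a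
  proof -
    have EW: "E p \<in> W'" "E' p \<in> W'" if "p \<in> J \<times> J" for p using sub that by auto
    define b where "b p = scl (Re (a p)) (E p) + scl (Im (a p)) (E' p)" for p
    have bW: "b p \<in> W'" if "p \<in> J \<times> J" for p
      unfolding b_def by (intro V.subspace_add[OF W'] V.subspace_scale[OF W'] EW that)
    have ab: "a = (\<Sum>p\<in>J \<times> J. b p)"
    proof
      fix q
      have "(\<Sum>p\<in>J \<times> J. b p) q = (\<Sum>p\<in>J \<times> J. if p = q then a q else 0)"
        unfolding sum_fun_apply
        by (intro sum.cong) (auto simp: b_def scl_def E_def E'_def complex_eq_iff)
      then show "a q = (\<Sum>p\<in>J \<times> J. b p) q" using a[of q] fin by simp
    qed
    have "f' (b p) = Re (a p * \<rho> p)" if "p \<in> J \<times> J" for p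
      using EW[OF that] by (simp add: b_def f'add f'scale V.subspace_scale[OF W'] \<rho>_def)
    then have "f' a = (\<Sum>p\<in>J \<times> J. Re (a p * \<rho> p))"
      using f'sum[of "J \<times> J" b] fin bW ab by simp
    also have "\<dots> = Re (\<Sum>i\<in>J. \<Sum>j\<in>J. a (i, j) * \<rho> (i, j))"
      by (simp add: sum.cartesian_product case_prod_unfold)
    finally show ?thesis using V.subspace_sum[OF W' bW] ab by simp
  qed
  have FW: "F a = (\<Sum>i\<in>J. \<Sum>j\<in>J. a (i, j) * \<rho> (i, j))" if a: "a \<in> W" for a
  proof -
    have "Re (F a) = Re (\<Sum>i\<in>J. \<Sum>j\<in>J. a (i, j) * \<rho> (i, j))"
      using key[of a, OF supp[OF a]] ext a by simp
    moreover have "Re (\<i> * F a) = Re (\<i> * (\<Sum>i\<in>J. \<Sum>j\<in>J. a (i, j) * \<rho> (i, j)))"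
      using key[of "\<lambda>p. \<i> * a p", OF supp[OF Wscale[OF a, of \<i>]]] ext Wscale[OF a, of \<i>] Fscale[OF a, of \<i>]
      by (simp add: sum_distrib_left mult.assoc)
    ultimately show ?thesis by (simp add: complex_eq_iff)
  qed
  have "(\<Sum>i\<in>J. \<Sum>j\<in>J. \<rho> (i, j) * x i * cnj (x j)) \<in> \<real>\<^sub>\<ge>\<^sub>0" for x
  proof -
    \<comment> \<open>The rank-one positive matrix of \<open>x\<close>. Its multiples by scalars
      with nonnegative real part stay in \<open>P\<close>, and the scalars 1, \<open>\<i>\<close>
      and \<open>-\<i>\<close> show that \<open>z\<close> is real and nonnegative.\<close>
    define b where "b p = (if p \<in> J \<times> J then x (fst p) * cnj (x (snd p)) else 0)" for p
    define z where "z = (\<Sum>i\<in>J. \<Sum>j\<in>J. b (i, j) * \<rho> (i, j))"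
    have quadb: "quad b y = of_real ((cmod (\<Sum>i\<in>J. x i * cnj (y i)))\<^sup>2)" for y
    proof -
      have "quad b y = (\<Sum>i\<in>J. \<Sum>j\<in>J. (x i * cnj (y i)) * cnj (x j * cnj (y j)))"
        unfolding quad_def by (intro sum.cong) (auto simp: b_def)
      also have "\<dots> = (\<Sum>i\<in>J. x i * cnj (y i)) * cnj (\<Sum>i\<in>J. x i * cnj (y i))"
        unfolding cnj_sum sum_product ..
      finally show ?thesis by (simp only: complex_norm_square)
    qed
    have "0 \<le> Re (c * z)" if c: "0 \<le> Re c" for c
    proof -
      have "(\<lambda>p. c * b p) \<in> P" using c by (simp add: P_def quad_scale quadb)
      moreover have *: "(\<lambda>p. c * b p) \<in> W' \<and>
          f' (\<lambda>p. c * b p) = Re (\<Sum>i\<in>J. \<Sum>j\<in>J. (c * b (i, j)) * \<rho> (i, j))"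
        by (rule key) (auto simp: b_def)
      ultimately have "0 \<le> Re (\<Sum>i\<in>J. \<Sum>j\<in>J. (c * b (i, j)) * \<rho> (i, j))"
        using f'pos[of "\<lambda>p. c * b p"] by (simp only: simp_thms)
      then show ?thesis by (simp only: z_def sum_distrib_left mult.assoc)
    qed
    from this[of 1] this[of \<i>] this[of "-\<i>"] have "z \<in> \<real>\<^sub>\<ge>\<^sub>0"
      by (simp add: complex_nonneg_Reals_iff)
    also have "z = (\<Sum>i\<in>J. \<Sum>j\<in>J. \<rho> (i, j) * x i * cnj (x j))"
      unfolding z_def by (intro sum.cong) (auto simp: b_def)
    finally show ?thesis .
  qed
  from psd_kernel_gram[OF fin, of "\<lambda>i j. \<rho> (i, j)", OF this] obtain N :: nat and u
    where "\<forall>i\<in>J. \<forall>j\<in>J. \<rho> (i, j) = (\<Sum>l<N. cnj (u l i) * u l j)" by blast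
  then have "\<forall>a\<in>W. F a = (\<Sum>i\<in>J. \<Sum>j\<in>J. a (i, j) * (\<Sum>l<N. cnj (u l i) * u l j))"
    using FW by simp
  then show ?thesis by blast
qed

lemma operator_systemD:
  assumes "operator_system S"
  shows "s \<in> S \<Longrightarrow> s \<in> bops" "s \<in> S \<Longrightarrow> t \<in> S \<Longrightarrow> s + t \<in> S" "s \<in> S \<Longrightarrow> c *\<^sub>C s \<in> S"
    "s \<in> S \<Longrightarrow> s\<^sup>\<dagger> \<in> S" "id_blinfun \<in> S" "0 \<in> S" "s \<in> S \<Longrightarrow> t \<in> S \<Longrightarrow> s - t \<in> S"
    "(\<And>i. i \<in> I \<Longrightarrow> f i \<in> S) \<Longrightarrow> (\<Sum>i\<in>I. f i) \<in> S"
  using assms unfolding operator_system_def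
  by (auto intro: complex_vector.subspace_add complex_vector.subspace_scale
      complex_vector.subspace_0 complex_vector.subspace_diff complex_vector.subspace_sum)

text \<open>Matrices over \<open>S\<close> become complex matrices with indices in
  \<open>J \<times> onb\<close>, and the family \<open>g\<close> becomes one functional
  \<open>F\<close> on them. The Gram vectors that represent \<open>F\<close> are the coordinates of
  the vectors \<open>h l j\<close>.\<close>

lemma vector_functional_representation:
  fixes S :: "('h::fin_dim_chilbert_space \<Rightarrow>\<^sub>L 'h) set"
    and g :: "'i \<Rightarrow> 'i \<Rightarrow> ('h \<Rightarrow>\<^sub>L 'h) \<Rightarrow> complex"
  assumes S: "operator_system S" and fin: "finite J"
    and gadd: "\<And>i j s t. i \<in> J \<Longrightarrow> j \<in> J \<Longrightarrow> s \<in> S \<Longrightarrow> t \<in> S \<Longrightarrow> g i j (s + t) = g i j s + g i j t"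
    and gscale: "\<And>i j s c. i \<in> J \<Longrightarrow> j \<in> J \<Longrightarrow> s \<in> S \<Longrightarrow> g i j (c *\<^sub>C s) = c * g i j s"
    and gstar: "\<And>i j s. i \<in> J \<Longrightarrow> j \<in> J \<Longrightarrow> s \<in> S \<Longrightarrow> g i j (s\<^sup>\<dagger>) = cnj (g j i s)"
    and pos: "\<And>A. (\<And>i j. i \<in> J \<Longrightarrow> j \<in> J \<Longrightarrow> A i j \<in> S) \<Longrightarrow> psd J A \<Longrightarrow>
      (\<Sum>i\<in>J. \<Sum>j\<in>J. g i j (A i j)) \<in> \<real>\<^sub>\<ge>\<^sub>0"
  shows "\<exists>(N::nat) h. \<forall>i\<in>J. \<forall>j\<in>J. \<forall>s\<in>S. g i j s = (\<Sum>l<N. cinner (blinfun_apply s (h l j)) (h l i))"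
proof -
  define J' where "J' = J \<times> (onb :: 'h set)"
  define op :: "(('i \<times> 'h) \<times> ('i \<times> 'h) \<Rightarrow> complex) \<Rightarrow> 'i \<Rightarrow> 'i \<Rightarrow> 'h \<Rightarrow>\<^sub>L 'h"
    where "op a i j = (\<Sum>e\<in>onb. \<Sum>d\<in>onb. a ((i, d), (j, e)) *\<^sub>C ketbra d e)" for a i j
  define W where "W = {a. (\<forall>p. p \<notin> J' \<times> J' \<longrightarrow> a p = 0) \<and> (\<forall>i\<in>J. \<forall>j\<in>J. op a i j \<in> S)}"
  define F where "F a = (\<Sum>i\<in>J. \<Sum>j\<in>J. g i j (op a i j))" for a
  have op_add: "op (a + b) i j = op a i j + op b i j" for a b i j
    by (simp add: op_def scaleC_add_left sum.distrib)
  have op_scale: "op (\<lambda>p. c * a p) i j = c *\<^sub>C op a i j" for c a i j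
    by (simp add: op_def scaleC_sum_right scaleC_scaleC)
  have WS: "op a i j \<in> S" if "a \<in> W" "i \<in> J" "j \<in> J" for a i j using that by (simp add: W_def)
  have op_bops: "op a i j \<in> bops" for a i j unfolding op_def by (intro bops_sum bops_scaleC ketbra_bops)
  have opI: "op a i j = s" if "s \<in> bops" "\<And>d e. d \<in> onb \<Longrightarrow> e \<in> onb \<Longrightarrow> a ((i, d), (j, e)) = cinner (s e) d"
    for a i j s
    unfolding op_def by (subst bops_expand[OF that(1)]) (simp add: that(2) cong: sum.cong)
  have op_quad: "(\<Sum>p\<in>J'. \<Sum>q\<in>J'. a (p, q) * x q * cnj (x p))
      = (\<Sum>i\<in>J. \<Sum>j\<in>J. cinner (op a i j (\<Sum>e\<in>onb. x (j, e) *\<^sub>C e)) (\<Sum>d\<in>onb. x (i, d) *\<^sub>C d))" for a x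
  proof -
    have X: "cinner (\<Sum>e\<in>onb. x (j, e) *\<^sub>C e) b = x (j, b)" if "b \<in> onb" for j and b :: 'h
      by (rule orthonormal_coefficient[OF onb(2) finite_onb that])
    have X': "cinner b (\<Sum>e\<in>onb. x (j, e) *\<^sub>C e) = cnj (x (j, b))" if "b \<in> onb" for j and b :: 'h
      using X[OF that, of j] by (metis cnj_cinner)
    have "cinner (op a i j (\<Sum>e\<in>onb. x (j, e) *\<^sub>C e)) (\<Sum>d\<in>onb. x (i, d) *\<^sub>C d)
        = (\<Sum>e\<in>onb. \<Sum>d\<in>onb. a ((i, d), (j, e)) * x (j, e) * cnj (x (i, d)))" for i j
      unfolding op_def blinfun_sum_apply cinner_sum_left[of _ onb]
      by (simp add: X X' cinner_scaleC_left mult.assoc cong: sum.cong)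
    also have "\<dots> i j = (\<Sum>d\<in>onb. \<Sum>e\<in>onb. a ((i, d), (j, e)) * x (j, e) * cnj (x (i, d)))" for i j
      by (rule sum.swap)
    finally have eq: "cinner (op a i j (\<Sum>e\<in>onb. x (j, e) *\<^sub>C e)) (\<Sum>d\<in>onb. x (i, d) *\<^sub>C d)
        = (\<Sum>d\<in>onb. \<Sum>e\<in>onb. a ((i, d), (j, e)) * x (j, e) * cnj (x (i, d)))" for i j .
    have "(\<Sum>p\<in>J'. \<Sum>q\<in>J'. a (p, q) * x q * cnj (x p))
        = (\<Sum>i\<in>J. \<Sum>d\<in>onb. \<Sum>j\<in>J. \<Sum>e\<in>onb. a ((i, d), (j, e)) * x (j, e) * cnj (x (i, d)))"
      by (simp add: J'_def sum.cartesian_product')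
    also have "\<dots> = (\<Sum>i\<in>J. \<Sum>j\<in>J. \<Sum>d\<in>onb. \<Sum>e\<in>onb. a ((i, d), (j, e)) * x (j, e) * cnj (x (i, d)))"
      by (intro sum.cong refl sum.swap)
    finally show ?thesis by (simp only: eq)
  qed
  have rep: "\<exists>(N::nat) u. \<forall>a\<in>W. F a = (\<Sum>p\<in>J'. \<Sum>q\<in>J'. a (p, q) * (\<Sum>l<N. cnj (u l p) * u l q))"
  proof (rule matrix_functional_representation)
    show "finite J'" using fin by (simp add: J'_def)
    show "a p = 0" if "a \<in> W" "p \<notin> J' \<times> J'" for a p using that unfolding W_def by blast
    show "a + b \<in> W" if "a \<in> W" "b \<in> W" for a b
      using that operator_systemD(2)[OF S] by (auto simp: W_def op_add)
    show "(\<lambda>p. c * a p) \<in> W" if "a \<in> W" for c a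
      using that operator_systemD(3)[OF S] by (auto simp: W_def op_scale)
    show "(\<lambda>p. if fst p = snd p \<and> fst p \<in> J' then 1 else 0) \<in> W"
    proof -
      have "op (\<lambda>p. if fst p = snd p \<and> fst p \<in> J' then 1 else 0) i j = (if i = j then id_blinfun else 0)"
        if "i \<in> J" "j \<in> J" for i j
        by (rule opI) (use that in \<open>auto simp: J'_def cinner_onb\<close>)
      then show ?thesis using operator_systemD(5,6)[OF S] by (auto simp: W_def)
    qed
    show "F (a + b) = F a + F b" if "a \<in> W" "b \<in> W" for a b
      using that by (simp add: F_def op_add gadd WS sum.distrib)
    show "F (\<lambda>p. c * a p) = c * F a" if "a \<in> W" for c a
      using that by (simp add: F_def op_scale gscale WS sum_distrib_left)
    show "0 \<le> Re (F a)"
      if a: "a \<in> W" and P: "\<And>x. 0 \<le> Re (\<Sum>p\<in>J'. \<Sum>q\<in>J'. a (p, q) * x q * cnj (x p))" for a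
    proof -
      \<comment> \<open>Twice the hermitian part. The form of \<open>a\<close> is only known to have
        nonnegative real part, while \<open>pos\<close> asks for a positive matrix; by
        \<open>gstar\<close> the value at \<open>B\<close> is twice the real part of
        \<open>F a\<close>.\<close>
      define B where "B i j = op a i j + (op a j i)\<^sup>\<dagger>" for i j
      have "psd J B"
        unfolding psd_def
      proof
        fix X :: "'i \<Rightarrow> 'h"
        define q where "q = (\<Sum>i\<in>J. \<Sum>j\<in>J. cinner (op a i j (X j)) (X i))"
        have "0 \<le> Re q"
          using P[of "\<lambda>(j, e). cinner (X j) e"] unfolding op_quad
          by (simp add: q_def onb(3)[symmetric])
        have "(\<Sum>i\<in>J. \<Sum>j\<in>J. cinner ((op a j i)\<^sup>\<dagger> (X j)) (X i)) = (\<Sum>i\<in>J. \<Sum>j\<in>J. cnj (cinner (op a j i (X i)) (X j)))"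
          by (simp add: cnj_cinner cinner_adj_right op_bops)
        also have "\<dots> = cnj q" unfolding q_def cnj_sum by (rule sum.swap)
        finally have "(\<Sum>i\<in>J. \<Sum>j\<in>J. cinner (B i j (X j)) (X i)) = q + cnj q"
          by (simp add: B_def blinfun.add_left cinner_add_left sum.distrib q_def)
        then show "(\<Sum>i\<in>J. \<Sum>j\<in>J. cinner (B i j (X j)) (X i)) \<in> \<real>\<^sub>\<ge>\<^sub>0"
          using \<open>0 \<le> Re q\<close> by (simp add: complex_nonneg_Reals_iff)
      qed
      moreover have "B i j \<in> S" if "i \<in> J" "j \<in> J" for i j
        using that a WS operator_systemD(2,4)[OF S] by (simp add: B_def)
      ultimately have "(\<Sum>i\<in>J. \<Sum>j\<in>J. g i j (B i j)) \<in> \<real>\<^sub>\<ge>\<^sub>0" by (intro pos)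
      moreover have "(\<Sum>i\<in>J. \<Sum>j\<in>J. g i j (B i j)) = F a + cnj (F a)"
      proof -
        have "(\<Sum>i\<in>J. \<Sum>j\<in>J. g i j (B i j)) = F a + (\<Sum>i\<in>J. \<Sum>j\<in>J. cnj (g j i (op a j i)))"
          using a WS operator_systemD(4)[OF S]
          by (simp add: B_def F_def gadd gstar sum.distrib)
        also have "(\<Sum>i\<in>J. \<Sum>j\<in>J. cnj (g j i (op a j i))) = cnj (F a)"
          unfolding F_def cnj_sum by (rule sum.swap)
        finally show ?thesis .
      qed
      ultimately show ?thesis by (simp add: complex_nonneg_Reals_iff)
    qed
  qed
  then obtain N :: nat and u where
    u: "\<And>a. a \<in> W \<Longrightarrow> F a = (\<Sum>p\<in>J'. \<Sum>q\<in>J'. a (p, q) * (\<Sum>l<N. cnj (u l p) * u l q))" by blast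
  define h where "h l j = (\<Sum>e\<in>onb. u l (j, e) *\<^sub>C (e :: 'h))" for l j
  have "g i0 j0 s = (\<Sum>l<N. cinner (s (h l j0)) (h l i0))" if ij: "i0 \<in> J" "j0 \<in> J" and s: "s \<in> S" for i0 j0 s
  proof -
    \<comment> \<open>The matrix with the single block \<open>s\<close> at position
      \<open>(i0, j0)\<close>, at which \<open>F\<close> picks out one functional of the
      family.\<close>
    define a where "a p = (if p \<in> J' \<times> J' \<and> fst (fst p) = i0 \<and> fst (snd p) = j0
      then cinner (s (snd (snd p))) (snd (fst p)) else 0)" for p
    have sb: "s \<in> bops" using operator_systemD(1)[OF S] s .
    have op: "op a i j = (if i = i0 \<and> j = j0 then s else 0)" if "i \<in> J" "j \<in> J" for i j
      by (rule opI) (use that sb in \<open>auto simp: a_def J'_def\<close>)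
    have aW: "a \<in> W" using op s operator_systemD(6)[OF S] by (auto simp: W_def a_def)
    have g0: "g i j 0 = 0" if "i \<in> J" "j \<in> J" for i j
      using gscale[OF that operator_systemD(6)[OF S], of 0] by simp
    have "F a = (\<Sum>i\<in>J. \<Sum>j\<in>J. if j = j0 then (if i = i0 then g i j s else 0) else 0)"
      unfolding F_def by (intro sum.cong) (auto simp: op g0)
    also have "\<dots> = g i0 j0 s" using ij fin by simp
    finally have "g i0 j0 s = (\<Sum>p\<in>J'. \<Sum>q\<in>J'. a (p, q) * (\<Sum>l<N. cnj (u l p) * u l q))"
      using u[OF aW] by simp
    also have "\<dots> = (\<Sum>p\<in>J'. \<Sum>q\<in>J'. \<Sum>l<N. a (p, q) * u l q * cnj (u l p))"
      by (simp add: sum_distrib_left mult_ac)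
    also have "\<dots> = (\<Sum>p\<in>J'. \<Sum>l<N. \<Sum>q\<in>J'. a (p, q) * u l q * cnj (u l p))"
      by (intro sum.cong refl sum.swap)
    also have "\<dots> = (\<Sum>l<N. \<Sum>p\<in>J'. \<Sum>q\<in>J'. a (p, q) * u l q * cnj (u l p))"
      by (rule sum.swap)
    also have "\<dots> = (\<Sum>l<N. \<Sum>i\<in>J. \<Sum>j\<in>J. cinner (op a i j (h l j)) (h l i))"
      unfolding op_quad h_def ..
    also have "\<dots> = (\<Sum>l<N. \<Sum>i\<in>J. \<Sum>j\<in>J. if j = j0 then (if i = i0 then cinner (s (h l j)) (h l i) else 0) else 0)"
      by (intro sum.cong) (auto simp: op)
    also have "\<dots> = (\<Sum>l<N. cinner (s (h l j0)) (h l i0))" using ij fin by simp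
    finally show ?thesis .
  qed
  then show ?thesis by blast
qed

text \<open>Choi's argument on an operator system: the matrix entries of all
  \<open>\<Omega> i j s\<close> form one family of functionals with indices in
  \<open>I \<times> onb\<close>, and the representing vectors \<open>h l (i, e)\<close> are the
  columns of \<open>R l i\<close>. The operators depend on one index only and \<open>N\<close> is
  common to all pairs, so families can be composed and summed over \<open>I\<close>.\<close>

lemma kraus_representation:
  fixes S :: "('h::fin_dim_chilbert_space \<Rightarrow>\<^sub>L 'h) set"
    and \<Omega> :: "'i \<Rightarrow> 'i \<Rightarrow> ('h \<Rightarrow>\<^sub>L 'h) \<Rightarrow> ('k::fin_dim_chilbert_space \<Rightarrow>\<^sub>L 'k)"
  assumes S: "operator_system S" and fin: "finite I"
    and bops: "\<And>i j s. i \<in> I \<Longrightarrow> j \<in> I \<Longrightarrow> s \<in> S \<Longrightarrow> \<Omega> i j s \<in> bops"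
    and add: "\<And>i j s t. i \<in> I \<Longrightarrow> j \<in> I \<Longrightarrow> s \<in> S \<Longrightarrow> t \<in> S \<Longrightarrow> \<Omega> i j (s + t) = \<Omega> i j s + \<Omega> i j t"
    and scale: "\<And>i j s c. i \<in> I \<Longrightarrow> j \<in> I \<Longrightarrow> s \<in> S \<Longrightarrow> \<Omega> i j (c *\<^sub>C s) = c *\<^sub>C \<Omega> i j s"
    and star: "\<And>i j s. i \<in> I \<Longrightarrow> j \<in> I \<Longrightarrow> s \<in> S \<Longrightarrow> \<Omega> i j (s\<^sup>\<dagger>) = (\<Omega> j i s)\<^sup>\<dagger>"
    and pos: "\<And>A :: 'i \<times> 'k \<Rightarrow> 'i \<times> 'k \<Rightarrow> 'h \<Rightarrow>\<^sub>L 'h.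
      (\<And>p q. p \<in> I \<times> onb \<Longrightarrow> q \<in> I \<times> onb \<Longrightarrow> A p q \<in> S) \<Longrightarrow> psd (I \<times> onb) A \<Longrightarrow>
      psd (I \<times> onb) (\<lambda>p q. \<Omega> (fst p) (fst q) (A p q))"
  shows "\<exists>(N::nat) R. (\<forall>l i. R l i \<in> bops) \<and>
    (\<forall>i\<in>I. \<forall>j\<in>I. \<forall>s\<in>S. \<Omega> i j s = (\<Sum>l<N. (R l i)\<^sup>\<dagger> o\<^sub>L s o\<^sub>L R l j))"
proof -
  define J where "J = I \<times> (onb :: 'k set)"
  have "\<exists>(N::nat) h. \<forall>p\<in>J. \<forall>q\<in>J. \<forall>s\<in>S. cinner (\<Omega> (fst p) (fst q) s (snd q)) (snd p)
      = (\<Sum>l<N. cinner (s (h l q)) (h l p))"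
  proof (rule vector_functional_representation[OF S])
    show "finite J" using fin by (simp add: J_def)
    fix p q assume pq: "p \<in> J" "q \<in> J"
    have I: "fst p \<in> I" "fst q \<in> I" using pq by (auto simp: J_def)
    show "cinner (\<Omega> (fst p) (fst q) (s + t) (snd q)) (snd p) =
        cinner (\<Omega> (fst p) (fst q) s (snd q)) (snd p) + cinner (\<Omega> (fst p) (fst q) t (snd q)) (snd p)"
      if "s \<in> S" "t \<in> S" for s t
      using I that by (simp add: add blinfun.add_left cinner_add_left)
    show "cinner (\<Omega> (fst p) (fst q) (c *\<^sub>C s) (snd q)) (snd p) =
        c * cinner (\<Omega> (fst p) (fst q) s (snd q)) (snd p)" if "s \<in> S" for s c
      using I that by (simp add: scale cinner_scaleC_left)
    show "cinner (\<Omega> (fst p) (fst q) (s\<^sup>\<dagger>) (snd q)) (snd p) =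
        cnj (cinner (\<Omega> (fst q) (fst p) s (snd p)) (snd q))" if "s \<in> S" for s
      using I that by (simp add: star cnj_cinner cinner_adj_right bops)
  next
    fix A assume "\<And>p q. p \<in> J \<Longrightarrow> q \<in> J \<Longrightarrow> A p q \<in> S" "psd J A"
    then have "psd J (\<lambda>p q. \<Omega> (fst p) (fst q) (A p q))"
      unfolding J_def by (rule pos)
    then show "(\<Sum>p\<in>J. \<Sum>q\<in>J. cinner (\<Omega> (fst p) (fst q) (A p q) (snd q)) (snd p)) \<in> \<real>\<^sub>\<ge>\<^sub>0"
      by (simp add: psd_def)
  qed
  then obtain N :: nat and h where h: "\<And>p q s. p \<in> J \<Longrightarrow> q \<in> J \<Longrightarrow> s \<in> S \<Longrightarrow>
      cinner (\<Omega> (fst p) (fst q) s (snd q)) (snd p) = (\<Sum>l<N. cinner (s (h l q)) (h l p))" by blast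
  have "\<exists>f\<in>bops. \<forall>e\<in>onb. blinfun_apply f e = h l (i, e)" for l i
    by (rule ex_bops_on_onb)
  then obtain R where R: "\<And>l i. R l i \<in> bops" "\<And>l i e. e \<in> onb \<Longrightarrow> R l i e = h l (i, e)"
    by metis
  have "\<Omega> i j s = (\<Sum>l<N. (R l i)\<^sup>\<dagger> o\<^sub>L s o\<^sub>L R l j)" if ij: "i \<in> I" "j \<in> I" and s: "s \<in> S" for i j s
  proof (rule bops_onb_eqI[OF bops[OF ij s]])
    show "(\<Sum>l<N. (R l i)\<^sup>\<dagger> o\<^sub>L s o\<^sub>L R l j) \<in> bops"
      using R(1) s operator_systemD(1)[OF S] by (intro bops_sum bops_compose cadjoint_bops) auto
    fix e :: 'k assume e: "e \<in> onb"
    show "\<Omega> i j s e = (\<Sum>l<N. (R l i)\<^sup>\<dagger> o\<^sub>L s o\<^sub>L R l j) e"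
    proof (rule onb_eqI)
      fix d :: 'k assume d: "d \<in> onb"
      have "cinner ((R l i)\<^sup>\<dagger> (s (R l j e))) d = cinner (s (h l (j, e))) (h l (i, d))" for l
        using R d e by (simp flip: cinner_adj_right)
      then show "cinner (\<Omega> i j s e) d = cinner ((\<Sum>l<N. (R l i)\<^sup>\<dagger> o\<^sub>L s o\<^sub>L R l j) e) d"
        using h[of "(i, d)" "(j, e)" s] ij s d e
        by (simp add: J_def blinfun_sum_apply cinner_sum_left)
    qed
  qed
  with R(1) show ?thesis by blast
qed

section \<open>The boundary theorem\<close>

text \<open>The properties of a unital completely positive map that the averaging argument uses, the
  last being the Kadison-Schwarz inequality. They pass to compositions and averages, so the Kraus
  operators of iterates need not be followed.\<close>

definition schwarz_map :: "(('a::chilbert_space \<Rightarrow>\<^sub>L 'a) \<Rightarrow> ('a \<Rightarrow>\<^sub>L 'a)) \<Rightarrow> bool"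
  where "schwarz_map \<theta> \<longleftrightarrow>
    (\<forall>x\<in>bops. \<theta> x \<in> bops \<and> \<theta> (x\<^sup>\<dagger>) = (\<theta> x)\<^sup>\<dagger>) \<and>
    (\<forall>x\<in>bops. \<forall>y\<in>bops. \<theta> (x + y) = \<theta> x + \<theta> y) \<and>
    (\<forall>c. \<forall>x\<in>bops. \<theta> (c *\<^sub>C x) = c *\<^sub>C \<theta> x) \<and> \<theta> id_blinfun = id_blinfun \<and>
    (\<forall>x\<in>bops. (\<forall>v. 0 \<le> Re (cinner (blinfun_apply x v) v)) \<longrightarrow>
      (\<forall>v. 0 \<le> Re (cinner (blinfun_apply (\<theta> x) v) v))) \<and>
    (\<forall>x\<in>bops. \<forall>v. (norm (blinfun_apply (\<theta> x) v))\<^sup>2 \<le>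
      Re (cinner (blinfun_apply (\<theta> (x\<^sup>\<dagger> o\<^sub>L x)) v) v))"

lemma schwarz_mapD:
  assumes "schwarz_map \<theta>"
  shows "x \<in> bops \<Longrightarrow> \<theta> x \<in> bops" "x \<in> bops \<Longrightarrow> \<theta> (x\<^sup>\<dagger>) = (\<theta> x)\<^sup>\<dagger>"
    "x \<in> bops \<Longrightarrow> y \<in> bops \<Longrightarrow> \<theta> (x + y) = \<theta> x + \<theta> y"
    "x \<in> bops \<Longrightarrow> \<theta> (c *\<^sub>C x) = c *\<^sub>C \<theta> x" "\<theta> id_blinfun = id_blinfun"
    "x \<in> bops \<Longrightarrow> (\<And>v. 0 \<le> Re (cinner (x v) v)) \<Longrightarrow> 0 \<le> Re (cinner (\<theta> x v) v)"
    "x \<in> bops \<Longrightarrow> (norm (\<theta> x v))\<^sup>2 \<le> Re (cinner (\<theta> (x\<^sup>\<dagger> o\<^sub>L x) v) v)"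
  using assms by (simp_all add: schwarz_map_def)

lemma schwarz_map_diff:
  assumes "schwarz_map \<theta>" "x \<in> bops" "y \<in> bops"
  shows "\<theta> (x - y) = \<theta> x - \<theta> y"
proof -
  have "\<theta> (x - y) = \<theta> (x + (-1) *\<^sub>C y)" by simp
  also have "\<dots> = \<theta> x + (-1) *\<^sub>C \<theta> y"
    using assms by (simp only: schwarz_mapD(3,4) bops_scaleC)
  finally show ?thesis by simp
qed

lemma schwarz_map_mono:
  assumes \<theta>: "schwarz_map \<theta>" and "x \<in> bops" "y \<in> bops"
    and le: "\<And>v. Re (cinner (x v) v) \<le> Re (cinner (y v) v)"
  shows "Re (cinner (\<theta> x v) v) \<le> Re (cinner (\<theta> y v) v)"
proof -
  have "0 \<le> Re (cinner (\<theta> (y - x) v) v)"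
    using assms by (intro schwarz_mapD(6)[OF \<theta>] bops_diff) (auto simp: blinfun.diff_left cinner_diff_left)
  then show ?thesis
    using assms by (simp add: schwarz_map_diff blinfun.diff_left cinner_diff_left)
qed

lemma cinner_square: "x \<in> bops \<Longrightarrow> cinner ((x\<^sup>\<dagger> o\<^sub>L x) v) v = of_real ((norm (x v))\<^sup>2)"
  by (simp add: cinner_adj_left[of "x\<^sup>\<dagger>"] cadjoint_bops cinner_self)

text \<open>By the Schwarz inequality and unitality, since
  \<open>x\<^sup>\<dagger> o\<^sub>L x\<close> is at most \<open>(norm x)\<^sup>2\<close> times the
  identity.\<close>

lemma schwarz_map_norm:
  assumes \<theta>: "schwarz_map \<theta>" and x: "x \<in> bops"
  shows "norm (\<theta> x) \<le> norm x"
proof (rule norm_blinfun_bound)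
  fix v
  have "(norm (\<theta> x v))\<^sup>2 \<le> Re (cinner (\<theta> (x\<^sup>\<dagger> o\<^sub>L x) v) v)"
    by (rule schwarz_mapD(7)[OF \<theta> x])
  also have "\<dots> \<le> Re (cinner (\<theta> (of_real ((norm x)\<^sup>2) *\<^sub>C id_blinfun) v) v)"
  proof (rule schwarz_map_mono[OF \<theta>])
    fix w
    have "(norm (x w))\<^sup>2 \<le> (norm x * norm w)\<^sup>2" by (intro power_mono norm_blinfun) auto
    then show "Re (cinner ((x\<^sup>\<dagger> o\<^sub>L x) w) w) \<le> Re (cinner ((of_real ((norm x)\<^sup>2) *\<^sub>C id_blinfun) w) w)"
      unfolding cinner_square[OF x]
      by (simp add: cinner_scaleC_left cinner_self power_mult_distrib flip: of_real_power of_real_mult)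
  qed (use x in auto)
  also have "\<dots> = (norm x * norm v)\<^sup>2"
    unfolding schwarz_mapD(4)[OF \<theta> bops_id] schwarz_mapD(5)[OF \<theta>]
    by (simp add: cinner_scaleC_left cinner_self power_mult_distrib flip: of_real_power of_real_mult)
  finally show "norm (\<theta> x v) \<le> norm x * norm v"
    by (rule power2_le_imp_le) simp
qed simp

lemma schwarz_map_id: "schwarz_map (\<lambda>x. x)"
  by (simp add: schwarz_map_def cinner_square del: blinfun_apply_blinfun_compose)

lemma schwarz_map_compose:
  fixes \<theta> \<eta> :: "('a::chilbert_space \<Rightarrow>\<^sub>L 'a) \<Rightarrow> ('a \<Rightarrow>\<^sub>L 'a)"
  assumes \<theta>: "schwarz_map \<theta>" and \<eta>: "schwarz_map \<eta>"
  shows "schwarz_map (\<lambda>x. \<theta> (\<eta> x))"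
  unfolding schwarz_map_def
proof (intro conjI ballI allI impI)
  fix x :: "'a \<Rightarrow>\<^sub>L 'a" and v assume x: "x \<in> bops"
  have "(norm (\<theta> (\<eta> x) v))\<^sup>2 \<le> Re (cinner (\<theta> ((\<eta> x)\<^sup>\<dagger> o\<^sub>L \<eta> x) v) v)"
    by (intro schwarz_mapD[OF \<theta>] schwarz_mapD[OF \<eta>] x)
  also have "\<dots> \<le> Re (cinner (\<theta> (\<eta> (x\<^sup>\<dagger> o\<^sub>L x)) v) v)"
  proof (rule schwarz_map_mono[OF \<theta>])
    fix w show "Re (cinner (((\<eta> x)\<^sup>\<dagger> o\<^sub>L \<eta> x) w) w) \<le> Re (cinner (\<eta> (x\<^sup>\<dagger> o\<^sub>L x) w) w)"
      unfolding cinner_square[OF schwarz_mapD(1)[OF \<eta> x]] using schwarz_mapD(7)[OF \<eta> x] by simp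
  qed (intro bops_compose cadjoint_bops schwarz_mapD(1)[OF \<eta>] x)+
  finally show "(norm (\<theta> (\<eta> x) v))\<^sup>2 \<le> Re (cinner (\<theta> (\<eta> (x\<^sup>\<dagger> o\<^sub>L x)) v) v)" .
qed (use schwarz_mapD[OF \<theta>] schwarz_mapD[OF \<eta>] in auto)

text \<open>The Schwarz inequality survives because the square of a mean is at most the mean of the
  squares.\<close>

lemma schwarz_map_average:
  fixes \<theta> :: "nat \<Rightarrow> ('a::chilbert_space \<Rightarrow>\<^sub>L 'a) \<Rightarrow> ('a \<Rightarrow>\<^sub>L 'a)"
  assumes \<theta>: "\<And>k. schwarz_map (\<theta> k)" and M: "M > (0::nat)"
  shows "schwarz_map (\<lambda>x. of_real (1 / M) *\<^sub>C (\<Sum>k<M. \<theta> k x))"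
proof -
  define c where "c = 1 / real M"
  have c: "c > 0" using M by (simp add: c_def)
  have cinner_avg: "Re (cinner ((of_real c *\<^sub>C (\<Sum>k<M. \<theta> k x)) v) v) = c * (\<Sum>k<M. Re (cinner (\<theta> k x v) v))"
    for x v
    by (simp add: cinner_scaleC_left blinfun_sum_apply cinner_sum_left)
  have "schwarz_map (\<lambda>x. of_real c *\<^sub>C (\<Sum>k<M. \<theta> k x))"
    unfolding schwarz_map_def
  proof (intro conjI ballI allI impI)
    fix x :: "'a \<Rightarrow>\<^sub>L 'a" assume x: "x \<in> bops"
    have \<theta>x: "\<theta> k x \<in> bops" for k by (rule schwarz_mapD(1)[OF \<theta> x])
    show "of_real c *\<^sub>C (\<Sum>k<M. \<theta> k x) \<in> bops" by (intro bops_scaleC bops_sum \<theta>x)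
    show "of_real c *\<^sub>C (\<Sum>k<M. \<theta> k (x\<^sup>\<dagger>)) = (of_real c *\<^sub>C (\<Sum>k<M. \<theta> k x))\<^sup>\<dagger>"
      using \<theta>x x by (simp add: cadjoint_scaleC bops_sum cadjoint_sum schwarz_mapD(2)[OF \<theta>])
    show "of_real c *\<^sub>C (\<Sum>k<M. \<theta> k (x + y)) = of_real c *\<^sub>C (\<Sum>k<M. \<theta> k x) + of_real c *\<^sub>C (\<Sum>k<M. \<theta> k y)"
      if "y \<in> bops" for y
      using x that by (simp add: schwarz_mapD(3)[OF \<theta>] sum.distrib scaleC_add_right)
    show "of_real c *\<^sub>C (\<Sum>k<M. \<theta> k (d *\<^sub>C x)) = d *\<^sub>C of_real c *\<^sub>C (\<Sum>k<M. \<theta> k x)" for d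
      using x by (simp add: schwarz_mapD(4)[OF \<theta>] scaleC_scaleC mult.commute flip: scaleC_sum_right)
    show "0 \<le> Re (cinner ((of_real c *\<^sub>C (\<Sum>k<M. \<theta> k x)) v) v)"
      if "\<forall>v. 0 \<le> Re (cinner (x v) v)" for v
      unfolding cinner_avg using that c x
      by (intro mult_nonneg_nonneg sum_nonneg schwarz_mapD(6)[OF \<theta>]) auto
    show "(norm ((of_real c *\<^sub>C (\<Sum>k<M. \<theta> k x)) v))\<^sup>2 \<le>
        Re (cinner ((of_real c *\<^sub>C (\<Sum>k<M. \<theta> k (x\<^sup>\<dagger> o\<^sub>L x))) v) v)" for v
    proof -
      have "norm ((of_real c *\<^sub>C (\<Sum>k<M. \<theta> k x)) v) \<le> c * (\<Sum>k<M. norm (\<theta> k x v))"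
        using c by (simp add: norm_scaleC blinfun_sum_apply norm_sum)
      then have "(norm ((of_real c *\<^sub>C (\<Sum>k<M. \<theta> k x)) v))\<^sup>2 \<le> (c * (\<Sum>k<M. norm (\<theta> k x v)))\<^sup>2"
        by (intro power_mono) auto
      also have "\<dots> = c * (c * (\<Sum>k<M. norm (\<theta> k x v))\<^sup>2)"
        by (simp add: power2_eq_square)
      also have "\<dots> \<le> c * (c * (real M * (\<Sum>k<M. (norm (\<theta> k x v))\<^sup>2)))"
        using sum_squared_le_sum_of_squares[of "\<lambda>k. norm (\<theta> k x v)" "{..<M}"] c
        by (intro mult_left_mono) (auto simp: mult.commute)
      also have "\<dots> = c * (\<Sum>k<M. (norm (\<theta> k x v))\<^sup>2)" using M by (simp add: c_def)
      also have "\<dots> \<le> c * (\<Sum>k<M. Re (cinner (\<theta> k (x\<^sup>\<dagger> o\<^sub>L x) v) v))"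
        using c by (intro mult_left_mono sum_mono schwarz_mapD(7)[OF \<theta> x]) auto
      finally show ?thesis unfolding cinner_avg .
    qed
  next
    have "(\<Sum>k<M. \<theta> k id_blinfun) = of_real (real M) *\<^sub>C id_blinfun"
      using schwarz_mapD(5)[OF \<theta>] by (simp add: sum_constant_scaleR scaleR_scaleC)
    then show "of_real c *\<^sub>C (\<Sum>k<M. \<theta> k id_blinfun) = id_blinfun"
      using M by (simp add: c_def scaleC_scaleC)
  qed
  then show ?thesis by (simp add: c_def)
qed

lemma schwarz_map_kraus:
  fixes C :: "'l \<Rightarrow> 'a::chilbert_space \<Rightarrow>\<^sub>L 'a"
  assumes C: "\<And>l. l \<in> I \<Longrightarrow> C l \<in> bops" and one: "(\<Sum>l\<in>I. (C l)\<^sup>\<dagger> o\<^sub>L C l) = id_blinfun"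
  shows "schwarz_map (\<lambda>x. \<Sum>l\<in>I. (C l)\<^sup>\<dagger> o\<^sub>L x o\<^sub>L C l)"
  unfolding schwarz_map_def
proof (intro conjI ballI allI impI)
  have quad: "cinner ((\<Sum>l\<in>I. (C l)\<^sup>\<dagger> o\<^sub>L x o\<^sub>L C l) v) w = (\<Sum>l\<in>I. cinner (x (C l v)) (C l w))" for x v w
    using C by (simp add: blinfun_sum_apply cinner_sum_left cinner_adj_right cong: sum.cong)
  fix x :: "'a \<Rightarrow>\<^sub>L 'a" assume x: "x \<in> bops"
  show "(\<Sum>l\<in>I. (C l)\<^sup>\<dagger> o\<^sub>L x o\<^sub>L C l) \<in> bops"
    using x C by (intro bops_sum bops_compose cadjoint_bops) auto
  have "(\<Sum>l\<in>I. (C l)\<^sup>\<dagger> o\<^sub>L x o\<^sub>L C l)\<^sup>\<dagger> = (\<Sum>l\<in>I. ((C l)\<^sup>\<dagger> o\<^sub>L x o\<^sub>L C l)\<^sup>\<dagger>)"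
    using x C by (intro cadjoint_sum bops_compose cadjoint_bops) auto
  also have "\<dots> = (\<Sum>l\<in>I. (C l)\<^sup>\<dagger> o\<^sub>L x\<^sup>\<dagger> o\<^sub>L C l)"
    using x C by (intro sum.cong refl) (simp add: cadjoint_compose bops_compose cadjoint_bops blinfun_compose_assoc)
  finally show "(\<Sum>l\<in>I. (C l)\<^sup>\<dagger> o\<^sub>L x\<^sup>\<dagger> o\<^sub>L C l) = (\<Sum>l\<in>I. (C l)\<^sup>\<dagger> o\<^sub>L x o\<^sub>L C l)\<^sup>\<dagger>" ..
  show "(\<Sum>l\<in>I. (C l)\<^sup>\<dagger> o\<^sub>L (x + y) o\<^sub>L C l) = (\<Sum>l\<in>I. (C l)\<^sup>\<dagger> o\<^sub>L x o\<^sub>L C l) + (\<Sum>l\<in>I. (C l)\<^sup>\<dagger> o\<^sub>L y o\<^sub>L C l)" for y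
    by (simp add: compose_simps sum.distrib)
  show "(\<Sum>l\<in>I. (C l)\<^sup>\<dagger> o\<^sub>L (c *\<^sub>C x) o\<^sub>L C l) = c *\<^sub>C (\<Sum>l\<in>I. (C l)\<^sup>\<dagger> o\<^sub>L x o\<^sub>L C l)" for c
    using C by (simp add: compose_scaleC_left compose_scaleC_right cadjoint_bops scaleC_sum_right cong: sum.cong)
  show "0 \<le> Re (cinner ((\<Sum>l\<in>I. (C l)\<^sup>\<dagger> o\<^sub>L x o\<^sub>L C l) v) v)" if "\<forall>v. 0 \<le> Re (cinner (x v) v)" for v
    using that by (simp add: quad sum_nonneg)
  fix v
  define y where "y = (\<Sum>l\<in>I. (C l)\<^sup>\<dagger> o\<^sub>L x o\<^sub>L C l) v"
  have n1: "(\<Sum>l\<in>I. (norm (C l y))\<^sup>2) = (norm y)\<^sup>2"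
  proof -
    have "(\<Sum>l\<in>I. cinner (C l y) (C l y)) = cinner ((\<Sum>l\<in>I. (C l)\<^sup>\<dagger> o\<^sub>L C l) y) y"
      using quad[of id_blinfun y y] by simp
    then show ?thesis by (simp add: one cinner_self flip: of_real_sum of_real_power)
  qed
  have cross: "(\<Sum>l\<in>I. Re (cinner (x (C l v)) (C l y))) = (norm y)\<^sup>2"
    using arg_cong[OF quad[of x v y], of Re] by (simp add: y_def[symmetric] cinner_self_Re)
  \<comment> \<open>With \<open>y\<close> the image of \<open>v\<close>, the cross terms and the
    last squares both sum to \<open>(norm y)\<^sup>2\<close>, so that this trivial inequality is the
    Schwarz inequality.\<close>
  have "0 \<le> (\<Sum>l\<in>I. (norm (x (C l v) - C l y))\<^sup>2)" by (intro sum_nonneg) auto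
  also have "\<dots> = (\<Sum>l\<in>I. (norm (x (C l v)))\<^sup>2 - 2 * Re (cinner (x (C l v)) (C l y)) + (norm (C l y))\<^sup>2)"
    by (simp add: power2_norm_eq_inner inner_diff inner_commute inner_eq_Re_cinner[symmetric] algebra_simps)
  also have "\<dots> = (\<Sum>l\<in>I. (norm (x (C l v)))\<^sup>2) - (norm y)\<^sup>2"
    by (simp add: sum.distrib sum_subtractf n1 cross flip: sum_distrib_left)
  also have "(\<Sum>l\<in>I. (norm (x (C l v)))\<^sup>2) = Re (cinner ((\<Sum>l\<in>I. (C l)\<^sup>\<dagger> o\<^sub>L (x\<^sup>\<dagger> o\<^sub>L x) o\<^sub>L C l) v) v)"
    unfolding quad cinner_square[OF x] by simp
  finally show "(norm ((\<Sum>l\<in>I. (C l)\<^sup>\<dagger> o\<^sub>L x o\<^sub>L C l) v))\<^sup>2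
      \<le> Re (cinner ((\<Sum>l\<in>I. (C l)\<^sup>\<dagger> o\<^sub>L (x\<^sup>\<dagger> o\<^sub>L x) o\<^sub>L C l) v) v)"
    by (simp add: y_def)
qed (use one in \<open>simp_all\<close>)

lemma bops_subset_cstar_subalgebra:
  assumes "cstar_generated T = bops" "cstar_subalgebra C" "T \<subseteq> C"
  shows "bops \<subseteq> C"
  using hull_minimal[of T C cstar_subalgebra] assms by (simp add: cstar_generated_def)

text \<open>The operators that commute with \<open>c\<close> together with their adjoints form a
  C*-algebra containing \<open>T\<close>; including the adjoints in the condition is what makes this
  set selfadjoint.\<close>

lemma commutes_with_generated:
  assumes gen: "cstar_generated T = bops" and T: "T \<subseteq> bops" and star: "\<And>t. t \<in> T \<Longrightarrow> t\<^sup>\<dagger> \<in> T"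
    and c: "c \<in> bops" and comm: "\<And>t. t \<in> T \<Longrightarrow> c o\<^sub>L t = t o\<^sub>L c" and x: "x \<in> bops"
  shows "c o\<^sub>L x = x o\<^sub>L c"
proof -
  define D where "D = {x \<in> bops. c o\<^sub>L x = x o\<^sub>L c \<and> c o\<^sub>L x\<^sup>\<dagger> = x\<^sup>\<dagger> o\<^sub>L c}"
  have "cstar_subalgebra D"
    unfolding cstar_subalgebra_def
  proof (intro conjI ballI)
    show "csubspace D"
      by (rule complex_vector.subspaceI)
        (auto simp: D_def cadjoint_add cadjoint_scaleC compose_simps compose_scaleC_left
          compose_scaleC_right[OF c])
    show "closed D"
      unfolding closed_sequential_limits
    proof (intro allI impI)
      fix X l assume X: "(\<forall>n. X n \<in> D) \<and> X \<longlonglongrightarrow> l"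
      have Xb: "X n \<in> bops" for n using X by (simp add: D_def)
      have l: "l \<in> bops" using closed_bops X Xb unfolding closed_sequential_limits by blast
      have "(\<lambda>n. c o\<^sub>L X n) \<longlonglongrightarrow> (c o\<^sub>L l)" "(\<lambda>n. X n o\<^sub>L c) \<longlonglongrightarrow> (l o\<^sub>L c)"
        using X by (auto intro!: tendsto_intros)
      then have 1: "c o\<^sub>L l = l o\<^sub>L c" using X LIMSEQ_unique by (auto simp: D_def)
      have "(\<lambda>n. (X n)\<^sup>\<dagger>) \<longlonglongrightarrow> l\<^sup>\<dagger>" using X Xb l by (intro tendsto_cadjoint) auto
      then have "(\<lambda>n. c o\<^sub>L (X n)\<^sup>\<dagger>) \<longlonglongrightarrow> (c o\<^sub>L l\<^sup>\<dagger>)" "(\<lambda>n. (X n)\<^sup>\<dagger> o\<^sub>L c) \<longlonglongrightarrow> (l\<^sup>\<dagger> o\<^sub>L c)"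
        by (auto intro!: tendsto_intros)
      then have 2: "c o\<^sub>L l\<^sup>\<dagger> = l\<^sup>\<dagger> o\<^sub>L c" using X LIMSEQ_unique by (auto simp: D_def)
      show "l \<in> D" using 1 2 l by (simp add: D_def)
    qed
    show "a o\<^sub>L b \<in> D" if "a \<in> D" "b \<in> D" for a b
    proof -
      have ab: "a \<in> bops" "b \<in> bops" using that by (auto simp: D_def)
      have comm2: "c o\<^sub>L (f o\<^sub>L g) = (f o\<^sub>L g) o\<^sub>L c"
        if "c o\<^sub>L f = f o\<^sub>L c" "c o\<^sub>L g = g o\<^sub>L c" for f g
      proof -
        have "c o\<^sub>L (f o\<^sub>L g) = (f o\<^sub>L c) o\<^sub>L g" by (simp only: that(1) flip: blinfun_compose_assoc)
        then show ?thesis by (simp only: that(2) blinfun_compose_assoc)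
      qed
      have "c o\<^sub>L (a o\<^sub>L b) = (a o\<^sub>L b) o\<^sub>L c" "c o\<^sub>L (b\<^sup>\<dagger> o\<^sub>L a\<^sup>\<dagger>) = (b\<^sup>\<dagger> o\<^sub>L a\<^sup>\<dagger>) o\<^sub>L c"
        using that by (auto simp: D_def intro!: comm2)
      then show ?thesis using ab by (simp add: D_def cadjoint_compose bops_compose)
    qed
  qed (auto simp: D_def)
  moreover have "T \<subseteq> D" using T star comm by (auto simp: D_def)
  ultimately have "bops \<subseteq> D" by (rule bops_subset_cstar_subalgebra[OF gen])
  then show ?thesis using x by (auto simp: D_def)
qed

text \<open>Commuting with \<open>ketbra w e\<close> for a fixed unit vector \<open>e\<close> forces
  \<open>c w\<close> to be the multiple \<open>cinner (c e) e\<close> of \<open>w\<close>. On the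
  zero space any scalar serves.\<close>

lemma scalar_if_commutes:
  fixes c :: "'a::fin_dim_chilbert_space \<Rightarrow>\<^sub>L 'a"
  assumes c: "c \<in> bops" and comm: "\<And>x. x \<in> bops \<Longrightarrow> c o\<^sub>L x = x o\<^sub>L c"
  shows "\<exists>z. c = z *\<^sub>C id_blinfun"
proof (cases "onb = ({} :: 'a set)")
  case True
  then have "x = y" for x y :: 'a by (intro onb_eqI) simp
  then show ?thesis by (intro exI[of _ 0] blinfun_eqI) metis
next
  case False
  then obtain e :: 'a where e: "e \<in> onb" by blast
  define z where "z = cinner (c e) e"
  have "c w = z *\<^sub>C w" for w
  proof -
    have "(c o\<^sub>L ketbra w e) e = (ketbra w e o\<^sub>L c) e" by (simp only: comm[OF ketbra_bops])
    then show ?thesis using e by (simp add: cinner_onb z_def)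
  qed
  then show ?thesis by (intro exI[of _ z] blinfun_eqI) simp
qed

lemma norm_scaleC_blinfun_le: "norm (c *\<^sub>C f) \<le> cmod c * norm (f :: 'a::chilbert_space \<Rightarrow>\<^sub>L 'b::chilbert_space)"
  by (rule norm_blinfun_bound)
    (simp_all add: norm_scaleC mult.assoc mult_left_mono norm_blinfun)

lemma tendsto_scaleC_blinfun_zero:
  fixes f :: "'a::chilbert_space \<Rightarrow>\<^sub>L 'b::chilbert_space"
  assumes "c \<longlonglongrightarrow> 0"
  shows "(\<lambda>n. c n *\<^sub>C f) \<longlonglongrightarrow> 0"
proof (rule Lim_null_comparison)
  show "\<forall>\<^sub>F n in sequentially. norm (c n *\<^sub>C f) \<le> cmod (c n) * norm f"
    by (simp add: norm_scaleC_blinfun_le)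
  show "(\<lambda>n. cmod (c n) * norm f) \<longlonglongrightarrow> 0"
    using tendsto_mult_right[OF tendsto_norm_zero[OF assms], of "norm f"] by simp
qed

lemma cinner_polarization:
  assumes "f \<in> bops"
  shows "4 * cinner (f v) w = cinner (f (v + w)) (v + w) - cinner (f (v - w)) (v - w)
    + \<i> * cinner (f (v + \<i> *\<^sub>C w)) (v + \<i> *\<^sub>C w) - \<i> * cinner (f (v - \<i> *\<^sub>C w)) (v - \<i> *\<^sub>C w)"
  using assms
  by (simp add: blinfun.add_right blinfun.diff_right bopsD cinner_add_left cinner_add_right
      cinner_diff_left cinner_diff_right cinner_scaleC_left cinner_scaleC_right algebra_simps)

text \<open>Polarization passes from quadratic forms to all matrix entries, and in finite dimension
  these control the norm.\<close>

lemma tendsto_zero_weak: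
  fixes X :: "nat \<Rightarrow> 'a::fin_dim_chilbert_space \<Rightarrow>\<^sub>L 'a"
  assumes X: "\<And>n. X n \<in> bops" and lim: "\<And>v. (\<lambda>n. cinner (X n v) v) \<longlonglongrightarrow> 0"
  shows "X \<longlonglongrightarrow> 0"
proof -
  have "(\<lambda>n. 4 * cinner (X n v) w) \<longlonglongrightarrow> 0 - 0 + \<i> * 0 - \<i> * 0" for v w
    unfolding cinner_polarization[OF X] by (intro tendsto_intros lim)
  then have "(\<lambda>n. (1/4) * (4 * cinner (X n v) w)) \<longlonglongrightarrow> (1/4) * (0 - 0 + \<i> * 0 - \<i> * 0)" for v w
    by (intro tendsto_intros)
  then have w: "(\<lambda>n. cinner (X n v) w) \<longlonglongrightarrow> 0" for v w by simp
  have "(\<lambda>n. \<Sum>e\<in>onb. \<Sum>d\<in>onb. cinner (X n e) d *\<^sub>C ketbra d e) \<longlonglongrightarrow> (\<Sum>e\<in>(onb :: 'a set). \<Sum>d\<in>(onb :: 'a set). (0 :: 'a \<Rightarrow>\<^sub>L 'a))"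
    by (intro tendsto_sum tendsto_scaleC_blinfun_zero w)
  then show ?thesis using bops_expand[OF X] by simp
qed

text \<open>The averages \<open>a\<close> of the iterates of a Kraus map with fixed points \<open>T\<close> satisfy the Schwarz
  inequality; comparing \<open>a M \<circ> a N\<close> with \<open>a M\<close> shows that the operators whose averages tend to
  zero form an ideal, which must vanish because it misses the identity.\<close>

theorem boundary_theorem:
  fixes T :: "('a::fin_dim_chilbert_space \<Rightarrow>\<^sub>L 'a) set" and C :: "'l \<Rightarrow> 'a \<Rightarrow>\<^sub>L 'a"
  assumes T: "operator_system T" and gen: "cstar_generated T = bops"
    and C: "\<And>l. l \<in> I \<Longrightarrow> C l \<in> bops"
    and fixed: "\<And>t. t \<in> T \<Longrightarrow> (\<Sum>l\<in>I. (C l)\<^sup>\<dagger> o\<^sub>L t o\<^sub>L C l) = t"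
    and fin: "finite I"
  shows "\<exists>c. \<forall>l\<in>I. C l = c l *\<^sub>C id_blinfun"
proof -
  note TD = operator_systemD[OF T]
  define \<kappa> where "\<kappa> x = (\<Sum>l\<in>I. (C l)\<^sup>\<dagger> o\<^sub>L x o\<^sub>L C l)" for x
  have one: "(\<Sum>l\<in>I. (C l)\<^sup>\<dagger> o\<^sub>L C l) = id_blinfun" using fixed[OF TD(5)] by simp
  have \<kappa>: "schwarz_map \<kappa>" unfolding \<kappa>_def[abs_def] by (rule schwarz_map_kraus[OF C one])
  have pow: "schwarz_map (\<kappa> ^^ k)" for k
  proof (induction k)
    case 0 then show ?case using schwarz_map_id by (simp add: id_def)
  next
    case (Suc k) then show ?case using schwarz_map_compose[OF \<kappa>, of "\<kappa> ^^ k"] by (simp add: comp_def)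
  qed

  \<comment> \<open>Averages of the iterates and their asymptotic invariance\<close>
  define a where "a M x = of_real (1 / real (Suc M)) *\<^sub>C (\<Sum>k<Suc M. (\<kappa> ^^ k) x)" for M x
  have a: "schwarz_map (a M)" for M
    unfolding a_def[abs_def] by (rule schwarz_map_average[OF pow]) simp
  note aD = schwarz_mapD[OF a] and a_diff = schwarz_map_diff[OF a]
  have a_sum: "a M (\<Sum>k\<in>K. x k) = (\<Sum>k\<in>K. a M (x k))" if "\<And>k. k \<in> K \<Longrightarrow> x k \<in> bops" for M K and x :: "nat \<Rightarrow> _"
    using that
  proof (induction K rule: infinite_finite_induct)
    case (insert k K)
    then show ?case by (simp add: aD(3) bops_sum)
  qed (use aD(4)[of 0 _ 0] in simp_all)
  have fix_pow: "(\<kappa> ^^ k) t = t" if "t \<in> T" for k t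
    using that fixed by (induction k) (simp_all add: \<kappa>_def)
  have a_fix: "a M t = t" if t: "t \<in> T" for M t
  proof -
    have "(\<Sum>k<Suc M. (\<kappa> ^^ k) t) = of_real (real (Suc M)) *\<^sub>C t"
      by (simp only: fix_pow[OF t] sum_constant_scaleR card_lessThan scaleR_scaleC)
    then show ?thesis by (simp add: a_def scaleC_scaleC del: of_nat_Suc)
  qed
  \<comment> \<open>The sum telescopes to a difference of two operators of norm at most
    \<open>norm x\<close>, divided by \<open>Suc M\<close>.\<close>
  have a_step: "(\<lambda>M. a M (\<kappa> x) - a M x) \<longlonglongrightarrow> 0" if x: "x \<in> bops" for x
  proof (rule Lim_null_comparison)
    have "norm (a M (\<kappa> x) - a M x) \<le> 1 / real (Suc M) * (2 * norm x)" for M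
    proof -
      have "a M (\<kappa> x) - a M x = of_real (1 / real (Suc M)) *\<^sub>C (\<Sum>k<Suc M. (\<kappa> ^^ Suc k) x - (\<kappa> ^^ k) x)"
        unfolding a_def sum_subtractf scaleC_diff_right by (simp only: funpow_Suc_right comp_apply)
      also have "\<dots> = of_real (1 / real (Suc M)) *\<^sub>C ((\<kappa> ^^ Suc M) x - x)"
        by (simp only: sum_lessThan_telescope[of "\<lambda>k. (\<kappa> ^^ k) x"] funpow_0)
      also have "norm \<dots> \<le> 1 / real (Suc M) * norm ((\<kappa> ^^ Suc M) x - x)"
        using norm_scaleC_blinfun_le[of "of_real (1 / real (Suc M))" "(\<kappa> ^^ Suc M) x - x"]
        by (simp del: of_nat_Suc funpow.simps add: norm_divide)
      also have "\<dots> \<le> 1 / real (Suc M) * (2 * norm x)"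
      proof (rule mult_left_mono)
        show "norm ((\<kappa> ^^ Suc M) x - x) \<le> 2 * norm x"
          using norm_triangle_ineq4[of "(\<kappa> ^^ Suc M) x" x] schwarz_map_norm[OF pow x, of "Suc M"]
          by linarith
      qed simp
      finally show ?thesis .
    qed
    then show "\<forall>\<^sub>F M in sequentially. norm (a M (\<kappa> x) - a M x) \<le> 1 / real (Suc M) * (2 * norm x)"
      by simp
    show "(\<lambda>M. 1 / real (Suc M) * (2 * norm x)) \<longlonglongrightarrow> 0"
      using tendsto_mult_right[OF LIMSEQ_inverse_real_of_nat, of "2 * norm x"]
      by (simp add: inverse_eq_divide)
  qed
  have a_pow: "(\<lambda>M. a M ((\<kappa> ^^ k) x) - a M x) \<longlonglongrightarrow> 0" if x: "x \<in> bops" for x k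
  proof (induction k)
    case (Suc k)
    have "(\<lambda>M. (a M (\<kappa> ((\<kappa> ^^ k) x)) - a M ((\<kappa> ^^ k) x)) + (a M ((\<kappa> ^^ k) x) - a M x)) \<longlonglongrightarrow> 0 + 0"
      by (intro tendsto_add Suc a_step schwarz_mapD(1)[OF pow] x)
    then show ?case by simp
  qed simp
  \<comment> \<open>\<open>a N x\<close> is a mean of iterates of \<open>x\<close>, each of which
    has asymptotically the same averages as \<open>x\<close>.\<close>
  have a_a: "(\<lambda>M. a M (a N x) - a M x) \<longlonglongrightarrow> 0" if x: "x \<in> bops" for x N
  proof -
    have eq: "a M (a N x) - a M x = (\<Sum>k<Suc N. (1 / real (Suc N)) *\<^sub>R (a M ((\<kappa> ^^ k) x) - a M x))" for M
    proof -
      have "a M (a N x) = of_real (1 / real (Suc N)) *\<^sub>C (\<Sum>k<Suc N. a M ((\<kappa> ^^ k) x))"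
        unfolding a_def[of N] using schwarz_mapD(1)[OF pow x]
        by (simp only: aD(4) bops_sum a_sum)
      moreover have "(\<Sum>k<Suc N. (1 / real (Suc N)) *\<^sub>R a M x) = a M x"
        by (simp only: sum_constant_scaleR card_lessThan scaleR_scaleR) simp
      ultimately show ?thesis
        by (simp only: scaleR_scaleC scaleC_diff_right sum_subtractf scaleC_sum_right)
    qed
    have "(\<lambda>M. \<Sum>k<Suc N. (1 / real (Suc N)) *\<^sub>R (a M ((\<kappa> ^^ k) x) - a M x)) \<longlonglongrightarrow> (\<Sum>k<Suc N. (1 / real (Suc N)) *\<^sub>R 0)"
      by (intro tendsto_intros a_pow x)
    then show ?thesis unfolding eq by simp
  qed

  \<comment> \<open>The space of operators whose averages tend to zero\<close>
  define J where "J = {y \<in> bops. (\<lambda>M. a M y) \<longlonglongrightarrow> 0}"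
  have Jb: "y \<in> bops" if "y \<in> J" for y using that by (simp add: J_def)
  have Jadd: "y + z \<in> J" if "y \<in> J" "z \<in> J" for y z
    using that tendsto_add[of "\<lambda>M. a M y" 0 sequentially "\<lambda>M. a M z" 0]
    by (auto simp: J_def aD(3))
  have Jscale: "c *\<^sub>C y \<in> J" if y: "y \<in> J" for c y
  proof -
    have "(\<lambda>M. c *\<^sub>C a M y) \<longlonglongrightarrow> 0"
    proof (rule Lim_null_comparison)
      show "\<forall>\<^sub>F M in sequentially. norm (c *\<^sub>C a M y) \<le> cmod c * norm (a M y)"
        by (simp add: norm_scaleC_blinfun_le)
      show "(\<lambda>M. cmod c * norm (a M y)) \<longlonglongrightarrow> 0"
        using y by (auto simp: J_def intro!: tendsto_mult_right_zero tendsto_norm_zero)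
    qed
    then show ?thesis using y by (auto simp: J_def aD(4))
  qed
  \<comment> \<open>The Schwarz inequality for \<open>a N\<close> is used at a perturbation of the
    fixed element \<open>s\<close> by \<open>\<delta>\<close> times \<open>x\<close>, and
    \<open>a M\<close> is applied to it. As \<open>a N x\<close> is small and \<open>a M\<close>
    hardly sees \<open>a N\<close>, the terms in \<open>s\<close> cancel, and the form of
    \<open>t o\<^sub>L x\<close> is bounded below up to an error of order \<open>\<delta>\<close>.
    The adjoint in \<open>s\<close> makes \<open>t o\<^sub>L x\<close> the cross term.\<close>
  have JT: "t o\<^sub>L y \<in> J" if t: "t \<in> T" and y: "y \<in> J" for t y
  proof -
    define s where "s = t\<^sup>\<dagger>"
    have s: "s \<in> T" "s\<^sup>\<dagger> = t" "s \<in> bops" and tb: "t \<in> bops" and yb: "y \<in> bops"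
      using t y TD(1,4) by (auto simp: s_def J_def)
    define q where "q M v x = Re (cinner (a M x v) v)" for M v x
    have q_add: "q M v (x + x') = q M v x + q M v x'" if "x \<in> bops" "x' \<in> bops" for M v x x'
      using that by (simp add: q_def aD(3) blinfun.add_left cinner_add_left)
    have q_diff: "q M v (x - x') = q M v x - q M v x'" if "x \<in> bops" "x' \<in> bops" for M v x x'
      using that by (simp add: q_def a_diff blinfun.diff_left cinner_diff_left)
    have q_scale: "q M v (of_real r *\<^sub>C x) = r * q M v x" if "x \<in> bops" for M v r x
      using that by (simp add: q_def aD(4) cinner_scaleC_left)
    have q_star: "q M v (x\<^sup>\<dagger>) = q M v x" if "x \<in> bops" for M v x
    proof -
      have "cinner (a M (x\<^sup>\<dagger>) v) v = cnj (cinner (a M x v) v)"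
        using that aD(1)[of x M] by (simp add: aD(2) cnj_cinner cinner_adj_right)
      then show ?thesis by (simp add: q_def)
    qed
    have q_bound: "\<bar>q M v x\<bar> \<le> norm x * (norm v)\<^sup>2" if x: "x \<in> bops" for M v x
    proof -
      have "\<bar>q M v x\<bar> \<le> norm (a M x v) * norm v"
        unfolding q_def using abs_Re_le_cmod cinner_Cauchy_Schwarz order_trans by blast
      also have "\<dots> \<le> (norm (a M x) * norm v) * norm v"
        by (intro mult_right_mono norm_blinfun) auto
      also have "\<dots> \<le> (norm x * norm v) * norm v"
        by (intro mult_right_mono schwarz_map_norm[OF a x]) auto
      finally show ?thesis by (simp add: power2_eq_square mult.assoc)
    qed
    have expand: "q M v ((s + of_real \<delta> *\<^sub>C x)\<^sup>\<dagger> o\<^sub>L (s + of_real \<delta> *\<^sub>C x))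
        = q M v (s\<^sup>\<dagger> o\<^sub>L s) + 2 * \<delta> * q M v (t o\<^sub>L x) + \<delta>\<^sup>2 * q M v (x\<^sup>\<dagger> o\<^sub>L x)"
      if x: "x \<in> bops" for M v \<delta> x
    proof -
      have "(s + of_real \<delta> *\<^sub>C x)\<^sup>\<dagger> o\<^sub>L (s + of_real \<delta> *\<^sub>C x)
          = (s\<^sup>\<dagger> o\<^sub>L s) + of_real \<delta> *\<^sub>C (t o\<^sub>L x) + of_real \<delta> *\<^sub>C (t o\<^sub>L x)\<^sup>\<dagger> + of_real (\<delta>\<^sup>2) *\<^sub>C (x\<^sup>\<dagger> o\<^sub>L x)"
        using s x tb
        by (simp add: cadjoint_add cadjoint_scaleC bops_scaleC compose_simps compose_scaleC_left
            compose_scaleC_right cadjoint_bops cadjoint_compose scaleC_scaleC power2_eq_square)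
          (simp add: s_def)
      then show ?thesis
        using s x tb by (simp add: q_add q_scale q_star bops_add bops_scaleC bops_compose cadjoint_bops
            del: of_real_power)
    qed
    \<comment> \<open>The three errors come from the cross term with \<open>a N x\<close>, from the
      second-order term in \<open>\<delta>\<close>, and from replacing \<open>a N z\<close> by
      \<open>z\<close> under \<open>a M\<close>; division by \<open>2 * \<delta>\<close> isolates
      the form of \<open>t o\<^sub>L x\<close>.\<close>
    have lower: "- (norm t * norm (a N x) * (norm v)\<^sup>2) - \<delta> / 2 * ((norm x)\<^sup>2 * (norm v)\<^sup>2)
        - \<bar>q M v (a N z - z)\<bar> / (2 * \<delta>) \<le> q M v (t o\<^sub>L x)"
      if x: "x \<in> bops" and \<delta>: "\<delta> > 0" and z: "z = (s + of_real \<delta> *\<^sub>C x)\<^sup>\<dagger> o\<^sub>L (s + of_real \<delta> *\<^sub>C x)"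
      for M N v \<delta> x z
    proof -
      let ?w = "s + of_real \<delta> *\<^sub>C x"
      have w: "?w \<in> bops" and zb: "z \<in> bops" and ax: "a N x \<in> bops"
        using s x by (auto simp: z intro!: aD(1))
      have aw: "a N ?w = s + of_real \<delta> *\<^sub>C a N x"
        using s x by (simp add: aD(3,4) bops_scaleC a_fix)
      have "q M v ((a N ?w)\<^sup>\<dagger> o\<^sub>L a N ?w) \<le> q M v (a N z)"
        unfolding q_def
      proof (rule schwarz_map_mono[OF a])
        show "Re (cinner (((a N ?w)\<^sup>\<dagger> o\<^sub>L a N ?w) u) u) \<le> Re (cinner (a N z u) u)" for u
          unfolding cinner_square[OF aD(1)[OF w]] z using aD(7)[OF w] by simp
      qed (use w zb in \<open>auto intro!: aD(1)\<close>)
      then have "q M v (s\<^sup>\<dagger> o\<^sub>L s) + 2 * \<delta> * q M v (t o\<^sub>L a N x) + \<delta>\<^sup>2 * q M v ((a N x)\<^sup>\<dagger> o\<^sub>L a N x) \<le> q M v (a N z)"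
        unfolding aw expand[OF ax] .
      also have "q M v (a N z) = q M v (a N z - z) + (q M v (s\<^sup>\<dagger> o\<^sub>L s) + 2 * \<delta> * q M v (t o\<^sub>L x) + \<delta>\<^sup>2 * q M v (x\<^sup>\<dagger> o\<^sub>L x))"
        unfolding expand[OF x, symmetric] z[symmetric] using zb by (simp add: q_diff aD(1))
      finally have 1: "2 * \<delta> * q M v (t o\<^sub>L a N x) + \<delta>\<^sup>2 * q M v ((a N x)\<^sup>\<dagger> o\<^sub>L a N x)
          \<le> \<bar>q M v (a N z - z)\<bar> + 2 * \<delta> * q M v (t o\<^sub>L x) + \<delta>\<^sup>2 * q M v (x\<^sup>\<dagger> o\<^sub>L x)"
        by linarith
      have 2: "0 \<le> q M v ((a N x)\<^sup>\<dagger> o\<^sub>L a N x)"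
        unfolding q_def using ax
        by (intro aD(6)) (auto simp: cinner_square simp del: blinfun_apply_blinfun_compose)
      have 3: "- (norm t * norm (a N x) * (norm v)\<^sup>2) \<le> q M v (t o\<^sub>L a N x)"
      proof -
        have "norm (t o\<^sub>L a N x) * (norm v)\<^sup>2 \<le> norm t * norm (a N x) * (norm v)\<^sup>2"
          by (intro mult_right_mono norm_blinfun_compose) auto
        then show ?thesis using q_bound[OF bops_compose[OF tb ax], of M v] by linarith
      qed
      have 4: "q M v (x\<^sup>\<dagger> o\<^sub>L x) \<le> (norm x)\<^sup>2 * (norm v)\<^sup>2"
      proof -
        have "norm (x\<^sup>\<dagger> o\<^sub>L x) \<le> norm (x\<^sup>\<dagger>) * norm x" by (rule norm_blinfun_compose)
        also have "\<dots> \<le> norm x * norm x" by (intro mult_right_mono norm_cadjoint_le x) auto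
        finally have "norm (x\<^sup>\<dagger> o\<^sub>L x) * (norm v)\<^sup>2 \<le> (norm x)\<^sup>2 * (norm v)\<^sup>2"
          by (intro mult_right_mono) (auto simp: power2_eq_square)
        then show ?thesis using q_bound[OF bops_compose[OF cadjoint_bops[OF x] x], of M v] by linarith
      qed
      have "2 * \<delta> * (- (norm t * norm (a N x) * (norm v)\<^sup>2)) \<le> 2 * \<delta> * q M v (t o\<^sub>L a N x)"
        using 3 \<delta> by (intro mult_left_mono) auto
      also have "\<dots> \<le> \<bar>q M v (a N z - z)\<bar> + 2 * \<delta> * q M v (t o\<^sub>L x) + \<delta>\<^sup>2 * ((norm x)\<^sup>2 * (norm v)\<^sup>2)"
        using 1 2 mult_left_mono[OF 4 zero_le_power2[of \<delta>]] mult_nonneg_nonneg[OF zero_le_power2[of \<delta>] 2] by linarith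
      finally show ?thesis using \<delta> by (simp add: field_simps power2_eq_square)
    qed
    have lim: "\<forall>\<^sub>F M in sequentially. - \<epsilon> \<le> q M v (t o\<^sub>L x)"
      if x: "x \<in> J" and \<epsilon>: "\<epsilon> > 0" for x v \<epsilon>
    proof -
      have xb: "x \<in> bops" and x0: "(\<lambda>M. a M x) \<longlonglongrightarrow> 0" using x by (auto simp: J_def)
      \<comment> \<open>Each error is kept within \<open>\<epsilon> / 4\<close>.
        \<open>\<delta>\<close> is fixed first, then \<open>N\<close>, and \<open>M\<close> comes
        last because \<open>z\<close> depends on \<open>\<delta>\<close> and the limit
        \<open>a_a\<close> is for a fixed \<open>N\<close>. The summand 1 keeps \<open>A\<close>
        positive if \<open>x\<close> or \<open>v\<close> is zero.\<close>
      define A where "A = (norm x)\<^sup>2 * (norm v)\<^sup>2 + 1"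
      have A: "A > 0" by (simp add: A_def add_nonneg_pos)
      define \<delta> where "\<delta> = \<epsilon> / (2 * A)"
      have \<delta>: "\<delta> > 0" using A \<epsilon> by (simp add: \<delta>_def)
      have "\<delta> / 2 * ((norm x)\<^sup>2 * (norm v)\<^sup>2) \<le> \<delta> / 2 * A"
        using \<delta> by (intro mult_left_mono) (auto simp: A_def)
      also have "\<dots> = \<epsilon> / 4" using A by (simp add: \<delta>_def)
      finally have b1: "\<delta> / 2 * ((norm x)\<^sup>2 * (norm v)\<^sup>2) \<le> \<epsilon> / 4" .
      have "(\<lambda>N. norm t * norm (a N x) * (norm v)\<^sup>2) \<longlonglongrightarrow> norm t * 0 * (norm v)\<^sup>2"
        by (intro tendsto_intros tendsto_norm_zero x0)
      then have "\<forall>\<^sub>F N in sequentially. norm t * norm (a N x) * (norm v)\<^sup>2 < \<epsilon> / 4"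
        using \<epsilon> by (intro order_tendstoD(2)) auto
      then obtain N where b2: "norm t * norm (a N x) * (norm v)\<^sup>2 < \<epsilon> / 4"
        by (auto dest: eventually_happens)
      define z where "z = (s + of_real \<delta> *\<^sub>C x)\<^sup>\<dagger> o\<^sub>L (s + of_real \<delta> *\<^sub>C x)"
      have zb: "z \<in> bops" using s xb by (auto simp: z_def)
      have "(\<lambda>M. (a M (a N z) - a M z) v) \<longlonglongrightarrow> (0 :: 'a \<Rightarrow>\<^sub>L 'a) v"
        by (intro tendsto_intros a_a zb)
      then have "(\<lambda>M. norm ((a M (a N z) - a M z) v) * norm v / (2 * \<delta>)) \<longlonglongrightarrow> 0 * norm v / (2 * \<delta>)"
        using \<delta> by (intro tendsto_intros tendsto_norm_zero) auto
      then have "\<forall>\<^sub>F M in sequentially. norm ((a M (a N z) - a M z) v) * norm v / (2 * \<delta>) < \<epsilon> / 4"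
        using \<epsilon> by (intro order_tendstoD(2)) auto
      then show ?thesis
      proof (rule eventually_mono)
        fix M assume b3: "norm ((a M (a N z) - a M z) v) * norm v / (2 * \<delta>) < \<epsilon> / 4"
        have "\<bar>q M v (a N z - z)\<bar> \<le> norm ((a M (a N z) - a M z) v) * norm v"
          unfolding q_def a_diff[OF aD(1)[OF zb] zb]
          using abs_Re_le_cmod cinner_Cauchy_Schwarz order_trans by blast
        then have "\<bar>q M v (a N z - z)\<bar> / (2 * \<delta>) \<le> norm ((a M (a N z) - a M z) v) * norm v / (2 * \<delta>)"
          using \<delta> by (intro divide_right_mono) auto
        then show "- \<epsilon> \<le> q M v (t o\<^sub>L x)"
          using lower[OF xb \<delta> z_def, of N v M] b1 b2 b3 \<epsilon> by linarith
      qed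
    qed
    have qc: "q M v (t o\<^sub>L (c *\<^sub>C y)) = Re (c * cinner (a M (t o\<^sub>L y) v) v)" for M v c
      using tb yb by (simp add: q_def compose_scaleC_right aD(4) bops_compose cinner_scaleC_left)
    have "(\<lambda>M. cinner (a M (t o\<^sub>L y) v) v) \<longlonglongrightarrow> 0" for v
    proof (rule tendstoI)
      fix e :: real assume "e > 0"
      then have e: "e / 4 > 0" by simp
      \<comment> \<open>One-sided bounds for four multiples of \<open>y\<close> become two-sided
        bounds for the real and the imaginary part of the form.\<close>
      have "\<forall>\<^sub>F M in sequentially. \<forall>c\<in>{1, -1, \<i>, -\<i>}. - (e / 4) \<le> q M v (t o\<^sub>L (c *\<^sub>C y))"
        by (intro eventually_ball_finite ballI lim[OF Jscale[OF y] e]) simp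
      then show "\<forall>\<^sub>F M in sequentially. dist (cinner (a M (t o\<^sub>L y) v) v) 0 < e"
      proof (rule eventually_mono)
        fix M assume "\<forall>c\<in>{1, -1, \<i>, -\<i>}. - (e / 4) \<le> q M v (t o\<^sub>L (c *\<^sub>C y))"
        then have "\<bar>Re (cinner (a M (t o\<^sub>L y) v) v)\<bar> \<le> e / 4" "\<bar>Im (cinner (a M (t o\<^sub>L y) v) v)\<bar> \<le> e / 4"
          unfolding qc by auto
        then show "dist (cinner (a M (t o\<^sub>L y) v) v) 0 < e"
          using cmod_le[of "cinner (a M (t o\<^sub>L y) v) v"] \<open>e > 0\<close> by (simp add: dist_norm)
      qed
    qed
    then have "(\<lambda>M. a M (t o\<^sub>L y)) \<longlonglongrightarrow> 0"
      using tb yb by (intro tendsto_zero_weak aD(1) bops_compose)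
    then show ?thesis using tb yb by (auto simp: J_def)
  qed

  \<comment> \<open>Adjoints, limits, and multiplication by arbitrary operators\<close>
  have Jstar: "y\<^sup>\<dagger> \<in> J" if y: "y \<in> J" for y
  proof -
    have "(\<lambda>M. a M (y\<^sup>\<dagger>)) \<longlonglongrightarrow> 0"
    proof (rule Lim_null_comparison)
      show "\<forall>\<^sub>F M in sequentially. norm (a M (y\<^sup>\<dagger>)) \<le> norm (a M y)"
        using Jb[OF y] by (simp add: aD(1,2) norm_cadjoint_le)
      show "(\<lambda>M. norm (a M y)) \<longlonglongrightarrow> 0"
        using y by (auto simp: J_def intro!: tendsto_norm_zero)
    qed
    then show ?thesis using Jb[OF y] by (auto simp: J_def)
  qed
  have Jclosed: "l \<in> J" if X: "\<And>n. X n \<in> J" and lim: "X \<longlonglongrightarrow> l" for X l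
  proof -
    have l: "l \<in> bops" using closed_bops X lim Jb unfolding closed_sequential_limits by blast
    have "(\<lambda>M. a M l) \<longlonglongrightarrow> 0"
    proof (rule tendstoI)
      fix e :: real assume e: "e > 0"
      obtain n where n: "dist (X n) l < e / 2"
        using lim e by (meson half_gt_zero lim_sequentially order_refl)
      have "\<forall>\<^sub>F M in sequentially. dist (a M (X n)) 0 < e / 2"
        using X[of n] e by (intro tendstoD) (auto simp: J_def)
      then show "\<forall>\<^sub>F M in sequentially. dist (a M l) 0 < e"
      proof (rule eventually_mono)
        fix M assume M: "dist (a M (X n)) 0 < e / 2"
        have "dist (a M l) (a M (X n)) \<le> dist l (X n)"
          unfolding dist_norm a_diff[OF l Jb[OF X], symmetric]
          using l Jb[OF X] by (intro schwarz_map_norm[OF a] bops_diff)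
        then show "dist (a M l) 0 < e"
          using M n dist_triangle[of "a M l" 0 "a M (X n)"] by (simp add: dist_commute)
      qed
    qed
    then show ?thesis using l by (simp add: J_def)
  qed
  have ideal: "x o\<^sub>L y \<in> J" if x: "x \<in> bops" and y: "y \<in> J" for x y
  proof -
    \<comment> \<open>The operators that, like their adjoints, multiply \<open>J\<close> into itself
      from the left: a C*-algebra that contains \<open>T\<close> and hence everything.
      Multiplication from the right is available through \<open>Jstar\<close>.\<close>
    define D where "D = {x \<in> bops. \<forall>y\<in>J. x o\<^sub>L y \<in> J \<and> x\<^sup>\<dagger> o\<^sub>L y \<in> J}"
    have "cstar_subalgebra D"
      unfolding cstar_subalgebra_def
    proof (intro conjI ballI)
      have "0 \<in> J" by (simp add: J_def aD(4)[of 0 _ 0, simplified])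
      then show "csubspace D"
        by (intro complex_vector.subspaceI)
          (auto simp: D_def cadjoint_add cadjoint_scaleC compose_simps compose_scaleC_left intro!: Jadd Jscale)
      show "closed D"
        unfolding closed_sequential_limits
      proof (intro allI impI)
        fix X l assume X: "(\<forall>n. X n \<in> D) \<and> X \<longlonglongrightarrow> l"
        have Xb: "X n \<in> bops" for n using X by (simp add: D_def)
        have l: "l \<in> bops" using closed_bops X Xb unfolding closed_sequential_limits by blast
        have "(\<lambda>n. (X n)\<^sup>\<dagger>) \<longlonglongrightarrow> l\<^sup>\<dagger>" using X Xb l by (intro tendsto_cadjoint) auto
        then have lims: "(\<lambda>n. X n o\<^sub>L y) \<longlonglongrightarrow> (l o\<^sub>L y)" "(\<lambda>n. (X n)\<^sup>\<dagger> o\<^sub>L y) \<longlonglongrightarrow> (l\<^sup>\<dagger> o\<^sub>L y)" for y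
          using X by (auto intro!: tendsto_intros)
        have "l o\<^sub>L y \<in> J" "l\<^sup>\<dagger> o\<^sub>L y \<in> J" if y: "y \<in> J" for y
          by (rule Jclosed[OF _ lims(1)], use X y in \<open>simp add: D_def\<close>)
            (rule Jclosed[OF _ lims(2)], use X y in \<open>simp add: D_def\<close>)
        then show "l \<in> D" using l by (simp add: D_def)
      qed
    qed (auto simp: D_def blinfun_compose_assoc cadjoint_compose)
    moreover have "T \<subseteq> D" using TD(1,4) JT by (auto simp: D_def)
    ultimately show ?thesis using bops_subset_cstar_subalgebra[OF gen, of D] x y by (auto simp: D_def)
  qed

  \<comment> \<open>Vanishing of the ideal\<close>
  have J0: "y = 0" if y: "y \<in> J" for y
  proof (rule ccontr)
    assume "y \<noteq> 0"
    then obtain e :: 'a where e: "e \<in> onb" "y e \<noteq> 0"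
      using bops_onb_eqI[OF Jb[OF y] bops_zero] by auto
    then obtain d :: 'a where d: "d \<in> onb" "cinner (y e) d \<noteq> 0"
      using onb_eqI[of "y e" 0] by auto
    \<comment> \<open>A nonzero matrix entry of \<open>y\<close>. Rank-one factors on both sides,
      the right one reached through adjoints, turn \<open>y\<close> into a nonzero multiple of
      \<open>ketbra w w\<close>; these operators sum to the identity, whose averages do not tend to
      zero.\<close>
    define \<gamma> where "\<gamma> = cinner (y e) d"
    have "ketbra w w \<in> J" for w
    proof -
      have "ketbra w d o\<^sub>L y \<in> J" by (rule ideal[OF ketbra_bops y])
      then have "ketbra w e o\<^sub>L (ketbra w d o\<^sub>L y)\<^sup>\<dagger> \<in> J"
        by (rule ideal[OF ketbra_bops Jstar])
      moreover have "(ketbra w d o\<^sub>L y)\<^sup>\<dagger> = ketbra ((y\<^sup>\<dagger>) d) w"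
        using Jb[OF y] by (intro cadjoint_eqI)
          (simp add: cinner_scaleC_left cinner_scaleC_right cinner_adj_left[symmetric] cnj_cinner)
      moreover have "ketbra w e o\<^sub>L ketbra ((y\<^sup>\<dagger>) d) w = cnj \<gamma> *\<^sub>C ketbra w w"
      proof (rule blinfun_eqI)
        fix v
        have "cinner ((y\<^sup>\<dagger>) d) e = cnj \<gamma>"
          using Jb[OF y] by (simp add: \<gamma>_def cnj_cinner cinner_adj_right)
        then show "(ketbra w e o\<^sub>L ketbra ((y\<^sup>\<dagger>) d) w) v = (cnj \<gamma> *\<^sub>C ketbra w w) v"
          by (simp add: cinner_scaleC_left scaleC_scaleC mult.commute)
      qed
      ultimately have "cnj \<gamma> *\<^sub>C ketbra w w \<in> J" by simp
      then have "inverse (cnj \<gamma>) *\<^sub>C cnj \<gamma> *\<^sub>C ketbra w w \<in> J" by (rule Jscale)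
      then show ?thesis using d by (simp add: scaleC_scaleC \<gamma>_def)
    qed
    have "0 \<in> J" using Jscale[OF y, of 0] by simp
    then have "(\<Sum>w\<in>A. ketbra w w) \<in> J" for A :: "'a set"
      using \<open>\<And>w. ketbra w w \<in> J\<close> by (induction A rule: infinite_finite_induct) (auto intro: Jadd)
    moreover have "(\<Sum>w\<in>onb. ketbra w w) = (id_blinfun :: 'a \<Rightarrow>\<^sub>L 'a)"
      by (rule blinfun_eqI) (simp add: blinfun_sum_apply onb(3)[symmetric])
    ultimately have "(id_blinfun :: 'a \<Rightarrow>\<^sub>L 'a) \<in> J" by metis
    then have "(\<lambda>M :: nat. id_blinfun :: 'a \<Rightarrow>\<^sub>L 'a) \<longlonglongrightarrow> 0" by (simp add: J_def aD(5))
    then have "(id_blinfun :: 'a \<Rightarrow>\<^sub>L 'a) = 0" using LIMSEQ_unique tendsto_const by blast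
    then have "id_blinfun e = (0 :: 'a \<Rightarrow>\<^sub>L 'a) e" by simp
    then show False using e by simp
  qed

  \<comment> \<open>Kraus operators of the identity map\<close>
  have \<kappa>_id: "\<kappa> x = x" if x: "x \<in> bops" for x
  proof -
    have "\<kappa> x - x \<in> J"
      using a_step[OF x] x schwarz_mapD(1)[OF \<kappa> x] by (auto simp: J_def a_diff)
    then show ?thesis using J0 by fastforce
  qed
  have comm: "C l o\<^sub>L x = x o\<^sub>L C l" if l: "l \<in> I" and x: "x \<in> bops" for l x
  proof (rule blinfun_eqI)
    fix v
    have quad: "cinner (\<kappa> z u) w = (\<Sum>l\<in>I. cinner (z (C l u)) (C l w))" for z u w
      using C by (simp add: \<kappa>_def blinfun_sum_apply cinner_sum_left cinner_adj_right cong: sum.cong)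
    have n1: "(\<Sum>l\<in>I. (norm (C l (x v)))\<^sup>2) = (norm (x v))\<^sup>2"
      using arg_cong[OF quad[of id_blinfun "x v" "x v"], of Re] \<kappa>_id[OF bops_id] by (simp add: cinner_self_Re)
    have "(\<Sum>l\<in>I. Re (cinner ((x\<^sup>\<dagger> o\<^sub>L x) (C l v)) (C l v))) = Re (cinner ((x\<^sup>\<dagger> o\<^sub>L x) v) v)"
      using arg_cong[OF quad[of "x\<^sup>\<dagger> o\<^sub>L x" v v], of Re] \<kappa>_id[of "x\<^sup>\<dagger> o\<^sub>L x"] x
      by (simp add: bops_compose cadjoint_bops)
    then have n2: "(\<Sum>l\<in>I. (norm (x (C l v)))\<^sup>2) = (norm (x v))\<^sup>2"
      unfolding cinner_square[OF x] by simp
    have "Re (cinner (\<kappa> x v) (x v)) = (norm (x v))\<^sup>2"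
      by (simp only: \<kappa>_id[OF x] cinner_self_Re)
    then have n3: "(\<Sum>l\<in>I. Re (cinner (x (C l v)) (C l (x v)))) = (norm (x v))\<^sup>2"
      unfolding quad by simp
    \<comment> \<open>The sums of the three terms are read off from \<open>\<kappa>\<close> at
      \<open>x\<^sup>\<dagger> o\<^sub>L x\<close>, at \<open>x\<close> and at the identity. All
      three are fixed by \<open>\<kappa>\<close>, so the sums cancel and every summand is
      zero.\<close>
    have "(\<Sum>l\<in>I. (norm (x (C l v) - C l (x v)))\<^sup>2) =
        (\<Sum>l\<in>I. (norm (x (C l v)))\<^sup>2 - 2 * Re (cinner (x (C l v)) (C l (x v))) + (norm (C l (x v)))\<^sup>2)"
      by (simp add: power2_norm_eq_inner inner_diff inner_commute inner_eq_Re_cinner[symmetric] algebra_simps)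
    also have "\<dots> = 0"
      by (simp add: sum.distrib sum_subtractf n1 n2 n3 flip: sum_distrib_left)
    finally have "(norm (x (C l v) - C l (x v)))\<^sup>2 = 0"
      using fin l by (subst (asm) sum_nonneg_eq_0_iff) auto
    then show "(C l o\<^sub>L x) v = (x o\<^sub>L C l) v" by simp
  qed
  have "\<exists>z. C l = z *\<^sub>C id_blinfun" if "l \<in> I" for l
    using that C comm by (intro scalar_if_commutes)
  then show ?thesis by metis
qed

section \<open>Unital complete order embeddings\<close>

lemma selfadjoint_if_real:
  assumes f: "f \<in> bops" and re: "\<And>v. Im (cinner (blinfun_apply f v) v) = 0"
  shows "f\<^sup>\<dagger> = f"
proof -
  define g where "g = f - f\<^sup>\<dagger>"
  have g: "g \<in> bops" using f by (auto simp: g_def)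
  have g0: "cinner (g v) v = 0" for v
  proof -
    have "cinner ((f\<^sup>\<dagger>) v) v = cnj (cinner (f v) v)" using f by (simp add: cnj_cinner cinner_adj_right)
    then show ?thesis using re[of v]
      by (simp add: g_def blinfun.diff_left cinner_diff_left complex_eq_iff)
  qed
  have "cinner (g v) w = 0" for v w
    using cinner_polarization[OF g, of v w] by (simp add: g0)
  then have "g v = 0" for v using cinner_self_zero by blast
  then have "g = 0" by (intro blinfun_eqI) simp
  then show ?thesis by (simp add: g_def)
qed

lemma psd_singleton: "psd {i} A \<longleftrightarrow> (\<forall>v. cinner (blinfun_apply (A i i) v) v \<in> \<real>\<^sub>\<ge>\<^sub>0)"
proof -
  have "(\<forall>x. cinner (A i i (x i)) (x i) \<in> \<real>\<^sub>\<ge>\<^sub>0) \<longleftrightarrow> (\<forall>v. cinner (A i i v) v \<in> \<real>\<^sub>\<ge>\<^sub>0)"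
  proof (intro iffI allI)
    fix v assume "\<forall>x. cinner (A i i (x i)) (x i) \<in> \<real>\<^sub>\<ge>\<^sub>0"
    from spec[OF this, of "\<lambda>_. v"] show "cinner (A i i v) v \<in> \<real>\<^sub>\<ge>\<^sub>0" .
  qed blast
  then show ?thesis by (simp add: psd_def)
qed

lemma psd_congruence:
  assumes "psd J A" "\<And>p. p \<in> J \<Longrightarrow> m p \<in> bops"
  shows "psd J (\<lambda>p q. (m p)\<^sup>\<dagger> o\<^sub>L A p q o\<^sub>L m q)"
  unfolding psd_def
proof
  fix x
  have "(\<Sum>p\<in>J. \<Sum>q\<in>J. cinner (((m p)\<^sup>\<dagger> o\<^sub>L A p q o\<^sub>L m q) (x q)) (x p))
      = (\<Sum>p\<in>J. \<Sum>q\<in>J. cinner (A p q (m q (x q))) (m p (x p)))"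
    using assms(2) by (intro sum.cong refl) (simp add: cinner_adj_right)
  then show "(\<Sum>p\<in>J. \<Sum>q\<in>J. cinner (((m p)\<^sup>\<dagger> o\<^sub>L A p q o\<^sub>L m q) (x q)) (x p)) \<in> \<real>\<^sub>\<ge>\<^sub>0"
    using assms(1)[unfolded psd_def, rule_format, of "\<lambda>p. m p (x p)"] by simp
qed

text \<open>An order embedding is not assumed to respect adjoints. For hermitian \<open>h\<close>
  adding \<open>norm h\<close> times the identity gives a positive operator, so
  \<open>\<phi> h\<close> has a real form and is selfadjoint; \<open>s\<close> is a combination of
  the hermitian elements \<open>h\<close> and \<open>k\<close>.\<close>

lemma completely_positive_star:
  fixes \<phi> :: "('a::chilbert_space \<Rightarrow>\<^sub>L 'a) \<Rightarrow> ('b::chilbert_space \<Rightarrow>\<^sub>L 'b)"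
  assumes S: "S \<subseteq> bops" "id_blinfun \<in> S" "\<And>s t. s \<in> S \<Longrightarrow> t \<in> S \<Longrightarrow> s + t \<in> S"
      "\<And>c s. s \<in> S \<Longrightarrow> c *\<^sub>C s \<in> S" "\<And>s. s \<in> S \<Longrightarrow> s\<^sup>\<dagger> \<in> S"
    and bops: "\<And>s. s \<in> S \<Longrightarrow> \<phi> s \<in> bops"
    and add: "\<And>s t. s \<in> S \<Longrightarrow> t \<in> S \<Longrightarrow> \<phi> (s + t) = \<phi> s + \<phi> t"
    and scale: "\<And>c s. s \<in> S \<Longrightarrow> \<phi> (c *\<^sub>C s) = c *\<^sub>C \<phi> s"
    and cp: "completely_positive_on S \<phi>" and s: "s \<in> S"
  shows "\<phi> (s\<^sup>\<dagger>) = (\<phi> s)\<^sup>\<dagger>"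
proof -
  have pos: "cinner (\<phi> x v) v \<in> \<real>\<^sub>\<ge>\<^sub>0" if "x \<in> S" "\<And>v. cinner (x v) v \<in> \<real>\<^sub>\<ge>\<^sub>0" for x v
    using completely_positive_on_psd[OF cp, of "{()}" "\<lambda>_ _. x"] that by (simp add: psd_singleton)
  have selfadj: "(\<phi> h)\<^sup>\<dagger> = \<phi> h" if h: "h \<in> S" "h\<^sup>\<dagger> = h" for h
  proof (rule selfadjoint_if_real[OF bops[OF h(1)]])
    fix v
    have hb: "h \<in> bops" using h S by blast
    define r where "r = of_real (norm h) *\<^sub>C (id_blinfun :: 'a \<Rightarrow>\<^sub>L 'a)"
    have r: "r \<in> S" using S by (simp add: r_def)
    have "cinner ((r + h) w) w \<in> \<real>\<^sub>\<ge>\<^sub>0" for w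
    proof -
      have "cinner (h w) w = cnj (cinner (h w) w)"
        using hb h(2) by (simp add: cnj_cinner cinner_adj_right)
      then have im: "Im (cinner (h w) w) = 0" by (simp add: complex_eq_iff)
      have "cmod (cinner (h w) w) \<le> norm (h w) * norm w" by (rule cinner_Cauchy_Schwarz)
      also have "\<dots> \<le> norm h * norm w * norm w" by (intro mult_right_mono norm_blinfun) auto
      finally have "- (norm h * (norm w)\<^sup>2) \<le> Re (cinner (h w) w)"
        using abs_Re_le_cmod[of "cinner (h w) w"] by (simp add: power2_eq_square mult.assoc)
      then show ?thesis using im
        by (simp add: r_def blinfun.add_left cinner_add_left cinner_scaleC_left cinner_self
            complex_nonneg_Reals_iff flip: of_real_power)
    qed
    then have "cinner (\<phi> (r + h) v) v \<in> \<real>\<^sub>\<ge>\<^sub>0" using r h S by (intro pos) auto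
    moreover have "cinner (\<phi> id_blinfun v) v \<in> \<real>\<^sub>\<ge>\<^sub>0" using S by (intro pos) auto
    ultimately show "Im (cinner (\<phi> h v) v) = 0"
      using h(1) r S(2)
      by (simp add: add blinfun.add_left cinner_add_left complex_nonneg_Reals_iff)
        (simp add: r_def scale cinner_scaleC_left)
  qed
  define h where "h = s + s\<^sup>\<dagger>"
  define k where "k = \<i> *\<^sub>C (s + (-1) *\<^sub>C s\<^sup>\<dagger>)"
  have sb: "s \<in> bops" using s S by blast
  have hk: "h \<in> S" "k \<in> S" using s S unfolding h_def k_def by blast+
  have hs: "h\<^sup>\<dagger> = h" "k\<^sup>\<dagger> = k"
    using sb by (simp_all add: h_def k_def cadjoint_add cadjoint_diff cadjoint_scaleC bops_scaleC cadjoint_bops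
        bops_diff bops_uminus add.commute scaleC_diff_right)
  have s1: "s = (1/2) *\<^sub>C (h + (-\<i>) *\<^sub>C k)" and s2: "s\<^sup>\<dagger> = (1/2) *\<^sub>C (h + \<i> *\<^sub>C k)"
    by (simp_all add: h_def k_def scaleC_scaleC scaleC_add_right scaleC_diff_right flip: scaleC_add_left)
  have \<phi>_lin: "\<phi> ((1/2) *\<^sub>C (h + c *\<^sub>C k)) = (1/2) *\<^sub>C (\<phi> h + c *\<^sub>C \<phi> k)" for c
    using hk S by (simp only: scale add)
  have "\<phi> s = (1/2) *\<^sub>C (\<phi> h + (-\<i>) *\<^sub>C \<phi> k)" "\<phi> (s\<^sup>\<dagger>) = (1/2) *\<^sub>C (\<phi> h + \<i> *\<^sub>C \<phi> k)"
    using arg_cong[OF s1, of \<phi>] arg_cong[OF s2, of \<phi>] by (simp_all only: \<phi>_lin)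
  then show ?thesis
    using hk selfadj[OF hk(1) hs(1)] selfadj[OF hk(2) hs(2)] bops
    by (simp add: cadjoint_add cadjoint_diff cadjoint_scaleC bops_scaleC bops_add bops_diff bops_uminus)
qed

text \<open>Products are formed on the embedding space and pulled back by \<open>inv_map\<close>
  when they lie in the image of \<open>S\<close>. The pull-back is linear and respects adjoints and
  positivity of matrices, but it is not multiplicative in general.\<close>

locale order_embedding =
  fixes S :: "('a::chilbert_space \<Rightarrow>\<^sub>L 'a) set"
    and \<phi> :: "('a \<Rightarrow>\<^sub>L 'a) \<Rightarrow> ('b::chilbert_space \<Rightarrow>\<^sub>L 'b)"
  assumes op_sys: "operator_system S" and embedding: "unital_complete_order_embedding S \<phi>"
begin

lemmas S_simps = operator_systemD[OF op_sys]

definition inv_map where "inv_map = inv_into S \<phi>"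

lemma map_add: "s \<in> S \<Longrightarrow> t \<in> S \<Longrightarrow> \<phi> (s + t) = \<phi> s + \<phi> t"
  and map_scale: "s \<in> S \<Longrightarrow> \<phi> (c *\<^sub>C s) = c *\<^sub>C \<phi> s"
  and map_id: "\<phi> id_blinfun = id_blinfun"
  and map_bops: "s \<in> S \<Longrightarrow> \<phi> s \<in> bops"
  and map_inj: "inj_on \<phi> S"
  and map_cp: "completely_positive_on S \<phi>"
  and inv_cp: "completely_positive_on (\<phi> ` S) inv_map"
  using embedding unfolding unital_complete_order_embedding_def inv_map_def by auto

lemma inv_map [simp]: "s \<in> S \<Longrightarrow> inv_map (\<phi> s) = s"
  by (simp add: inv_map_def map_inj)

lemma inv_mem: "x \<in> \<phi> ` S \<Longrightarrow> inv_map x \<in> S"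
  and map_inv [simp]: "x \<in> \<phi> ` S \<Longrightarrow> \<phi> (inv_map x) = x"
  by (auto simp: inv_map_def inv_into_into f_inv_into_f)

lemma map_zero: "\<phi> 0 = 0"
  using map_scale[OF S_simps(6), of 0] by simp

lemma map_star: "s \<in> S \<Longrightarrow> \<phi> (s\<^sup>\<dagger>) = (\<phi> s)\<^sup>\<dagger>"
  by (rule completely_positive_star[where S = S])
    (auto simp: S_simps map_add map_scale map_bops map_cp)

lemma image_add: "x \<in> \<phi> ` S \<Longrightarrow> y \<in> \<phi> ` S \<Longrightarrow> x + y \<in> \<phi> ` S"
  using S_simps(2) map_add by (auto simp: image_iff) metis

lemma image_star: "x \<in> \<phi> ` S \<Longrightarrow> x\<^sup>\<dagger> \<in> \<phi> ` S"
  using S_simps(4) map_star by (auto simp: image_iff) metis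

lemma image_zero: "0 \<in> \<phi> ` S"
  using S_simps(6) map_zero by (metis image_eqI)

lemma image_sum: "(\<And>i. i \<in> I \<Longrightarrow> f i \<in> \<phi> ` S) \<Longrightarrow> (\<Sum>i\<in>I. f i) \<in> \<phi> ` S"
  by (induction I rule: infinite_finite_induct) (auto simp: image_zero intro: image_add)

lemma inv_add: "x \<in> \<phi> ` S \<Longrightarrow> y \<in> \<phi> ` S \<Longrightarrow> inv_map (x + y) = inv_map x + inv_map y"
  using S_simps(2) by (auto simp flip: map_add)

lemma inv_scale: "x \<in> \<phi> ` S \<Longrightarrow> inv_map (c *\<^sub>C x) = c *\<^sub>C inv_map x"
  using S_simps(3) by (auto simp flip: map_scale)

lemma inv_star: "x \<in> \<phi> ` S \<Longrightarrow> inv_map (x\<^sup>\<dagger>) = (inv_map x)\<^sup>\<dagger>"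
  using S_simps(4) by (auto simp flip: map_star)

lemma inv_id: "inv_map id_blinfun = id_blinfun"
  using inv_map[OF S_simps(5)] by (simp add: map_id)

lemma inv_zero: "inv_map 0 = 0"
  using inv_map[OF S_simps(6)] by (simp add: map_zero)

lemma inv_sum: "(\<And>i. i \<in> I \<Longrightarrow> f i \<in> \<phi> ` S) \<Longrightarrow> inv_map (\<Sum>i\<in>I. f i) = (\<Sum>i\<in>I. inv_map (f i))"
  by (induction I rule: infinite_finite_induct) (auto simp: inv_zero inv_add image_sum)

lemma inv_bops: "x \<in> \<phi> ` S \<Longrightarrow> inv_map x \<in> bops"
  using inv_mem S_simps(1) by blast

end

text \<open>The first embedding, the congruence by the operators \<open>m i\<close>, and the inverse
  of the second embedding each preserve positivity of matrices. The composite runs between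
  finite-dimensional spaces even if the embedding spaces are infinite-dimensional, so it has a Kraus
  representation.\<close>

lemma kraus_between:
  fixes S :: "('h::fin_dim_chilbert_space \<Rightarrow>\<^sub>L 'h) set" and T :: "('k::fin_dim_chilbert_space \<Rightarrow>\<^sub>L 'k) set"
    and \<phi> :: "('h \<Rightarrow>\<^sub>L 'h) \<Rightarrow> ('c::chilbert_space \<Rightarrow>\<^sub>L 'c)"
    and \<psi> :: "('k \<Rightarrow>\<^sub>L 'k) \<Rightarrow> ('d::chilbert_space \<Rightarrow>\<^sub>L 'd)" and m :: "'i \<Rightarrow> ('d \<Rightarrow>\<^sub>L 'c)"
  assumes S: "order_embedding S \<phi>" and T: "order_embedding T \<psi>" and "finite I"
    and m: "\<And>i. i \<in> I \<Longrightarrow> m i \<in> bops"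
    and mem: "\<And>i j s. i \<in> I \<Longrightarrow> j \<in> I \<Longrightarrow> s \<in> S \<Longrightarrow> (m i)\<^sup>\<dagger> o\<^sub>L \<phi> s o\<^sub>L m j \<in> \<psi> ` T"
  shows "\<exists>(N::nat) R. (\<forall>l i. R l i \<in> bops) \<and> (\<forall>i\<in>I. \<forall>j\<in>I. \<forall>s\<in>S.
    order_embedding.inv_map T \<psi> ((m i)\<^sup>\<dagger> o\<^sub>L \<phi> s o\<^sub>L m j) = (\<Sum>l<N. (R l i)\<^sup>\<dagger> o\<^sub>L s o\<^sub>L R l j))"
proof -
  interpret S: order_embedding S \<phi> by fact
  interpret T: order_embedding T \<psi> by fact
  show ?thesis
  proof (rule kraus_representation[OF S.op_sys \<open>finite I\<close>, of "\<lambda>i j s. T.inv_map ((m i)\<^sup>\<dagger> o\<^sub>L \<phi> s o\<^sub>L m j)"])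
    fix i j s assume ij: "i \<in> I" "j \<in> I" and s: "s \<in> S"
    show "T.inv_map ((m i)\<^sup>\<dagger> o\<^sub>L \<phi> s o\<^sub>L m j) \<in> bops" using mem[OF ij s] by (rule T.inv_bops)
    show "T.inv_map ((m i)\<^sup>\<dagger> o\<^sub>L \<phi> (s + t) o\<^sub>L m j)
        = T.inv_map ((m i)\<^sup>\<dagger> o\<^sub>L \<phi> s o\<^sub>L m j) + T.inv_map ((m i)\<^sup>\<dagger> o\<^sub>L \<phi> t o\<^sub>L m j)" if "t \<in> S" for t
      using s that by (simp add: S.map_add compose_simps T.inv_add mem ij)
    show "T.inv_map ((m i)\<^sup>\<dagger> o\<^sub>L \<phi> (c *\<^sub>C s) o\<^sub>L m j) = c *\<^sub>C T.inv_map ((m i)\<^sup>\<dagger> o\<^sub>L \<phi> s o\<^sub>L m j)" for c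
      using s ij by (simp add: S.map_scale compose_scaleC_left compose_scaleC_right m cadjoint_bops T.inv_scale mem)
    have "(m i)\<^sup>\<dagger> o\<^sub>L \<phi> (s\<^sup>\<dagger>) o\<^sub>L m j = ((m j)\<^sup>\<dagger> o\<^sub>L \<phi> s o\<^sub>L m i)\<^sup>\<dagger>"
      using s ij by (simp add: S.map_star cadjoint_compose bops_compose m cadjoint_bops S.map_bops blinfun_compose_assoc)
    then show "T.inv_map ((m i)\<^sup>\<dagger> o\<^sub>L \<phi> (s\<^sup>\<dagger>) o\<^sub>L m j) = (T.inv_map ((m j)\<^sup>\<dagger> o\<^sub>L \<phi> s o\<^sub>L m i))\<^sup>\<dagger>"
      using mem[OF ij(2,1) s] by (simp add: T.inv_star)
  next
    fix A :: "'i \<times> 'k \<Rightarrow> 'i \<times> 'k \<Rightarrow> 'h \<Rightarrow>\<^sub>L 'h"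
    assume A: "\<And>p q. p \<in> I \<times> onb \<Longrightarrow> q \<in> I \<times> onb \<Longrightarrow> A p q \<in> S" and psd: "psd (I \<times> onb) A"
    have fin: "finite (I \<times> (onb :: 'k set))" using \<open>finite I\<close> by simp
    have "psd (I \<times> onb) (\<lambda>p q. (m (fst p))\<^sup>\<dagger> o\<^sub>L \<phi> (A p q) o\<^sub>L m (fst q))"
      by (intro psd_congruence completely_positive_on_psd[OF S.map_cp fin A psd]) (use m in auto)
    then show "psd (I \<times> onb) (\<lambda>p q. T.inv_map ((m (fst p))\<^sup>\<dagger> o\<^sub>L \<phi> (A p q) o\<^sub>L m (fst q)))"
      by (rule completely_positive_on_psd[OF T.inv_cp fin, rotated]) (use mem A in auto)
  qed
qed

text \<open>A Kraus family of the compressions by \<open>1\<close> and \<open>e\<close> is scalar at \<open>1\<close> by the boundary theorem.\<close>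

lemma inv_map_mult_right:
  fixes T :: "('k::fin_dim_chilbert_space \<Rightarrow>\<^sub>L 'k) set"
    and \<psi> :: "('k \<Rightarrow>\<^sub>L 'k) \<Rightarrow> ('d::chilbert_space \<Rightarrow>\<^sub>L 'd)"
  assumes T: "order_embedding T \<psi>" and gen: "cstar_generated T = bops"
    and e: "e \<in> bops" and mem1: "\<And>t. t \<in> T \<Longrightarrow> \<psi> t o\<^sub>L e \<in> \<psi> ` T"
    and mem2: "\<And>t. t \<in> T \<Longrightarrow> e\<^sup>\<dagger> o\<^sub>L \<psi> t o\<^sub>L e \<in> \<psi> ` T" and t: "t \<in> T"
  shows "order_embedding.inv_map T \<psi> (\<psi> t o\<^sub>L e) = t o\<^sub>L order_embedding.inv_map T \<psi> e"
proof -
  interpret T: order_embedding T \<psi> by fact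
  \<comment> \<open>The diagonal entry at \<open>False\<close> is the identity map of
    \<open>T\<close>, so the boundary theorem applies to its Kraus operators; the entry from
    \<open>False\<close> to \<open>True\<close> is multiplication by \<open>e\<close>.\<close>
  define m where "m i = (if i then e else id_blinfun)" for i
  have mem3: "e\<^sup>\<dagger> o\<^sub>L \<psi> t \<in> \<psi> ` T" if "t \<in> T" for t
  proof -
    have "(\<psi> (t\<^sup>\<dagger>) o\<^sub>L e)\<^sup>\<dagger> \<in> \<psi> ` T" using that by (intro T.image_star mem1 T.S_simps)
    then show ?thesis using that e by (simp add: cadjoint_compose cadjoint_bops T.map_bops T.S_simps T.map_star)
  qed
  have "\<exists>(N::nat) R. (\<forall>l i. R l i \<in> bops) \<and> (\<forall>i\<in>UNIV. \<forall>j\<in>UNIV. \<forall>t\<in>T.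
    T.inv_map ((m i)\<^sup>\<dagger> o\<^sub>L \<psi> t o\<^sub>L m j) = (\<Sum>l<N. (R l i)\<^sup>\<dagger> o\<^sub>L t o\<^sub>L R l j))"
    by (rule kraus_between[OF T T]) (use e mem1 mem2 mem3 in \<open>auto simp: m_def\<close>)
  then obtain N :: nat and R where R: "\<And>l i. R l i \<in> bops" and
    rep: "\<And>i j t. t \<in> T \<Longrightarrow> T.inv_map ((m i)\<^sup>\<dagger> o\<^sub>L \<psi> t o\<^sub>L m j) = (\<Sum>l<N. (R l i)\<^sup>\<dagger> o\<^sub>L t o\<^sub>L R l j)"
    by blast
  have "\<exists>c. \<forall>l\<in>{..<N}. R l False = c l *\<^sub>C id_blinfun"
  proof (rule boundary_theorem[OF T.op_sys gen R])
    fix t assume "t \<in> T"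
    then show "(\<Sum>l<N. (R l False)\<^sup>\<dagger> o\<^sub>L t o\<^sub>L R l False) = t"
      using rep[of t False False] by (simp add: m_def)
  qed simp
  then obtain c where c: "\<And>l. l < N \<Longrightarrow> R l False = c l *\<^sub>C id_blinfun" by auto
  \<comment> \<open>\<open>X\<close> does not depend on \<open>t\<close>, so evaluation at the
    identity shows that it is the pull-back of \<open>e\<close>.\<close>
  define X where "X = (\<Sum>l<N. cnj (c l) *\<^sub>C R l True)"
  have X: "T.inv_map (\<psi> t o\<^sub>L e) = t o\<^sub>L X" if t: "t \<in> T" for t
  proof -
    have "T.inv_map (\<psi> t o\<^sub>L e) = (\<Sum>l<N. (R l False)\<^sup>\<dagger> o\<^sub>L t o\<^sub>L R l True)"
      using rep[OF t, of False True] by (simp add: m_def)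
    also have "\<dots> = (\<Sum>l<N. t o\<^sub>L (cnj (c l) *\<^sub>C R l True))"
      using T.S_simps(1)[OF t]
      by (intro sum.cong) (simp_all add: c cadjoint_scaleC compose_scaleC_left compose_scaleC_right)
    finally show ?thesis by (simp add: X_def compose_simps)
  qed
  have "T.inv_map e = X" using X[OF T.S_simps(5)] by (simp add: T.map_id)
  then show ?thesis using X[OF t] by simp
qed

section \<open>Operator systems linked by a ternary ring of operators\<close>

text \<open>\<open>F\<close> is a finite part of the ternary ring and not closed under triple
  products, so its compatibility with both systems is assumed outright. The roles of
  \<open>S\<close> and \<open>T\<close> differ, since \<open>gen\<close> concerns \<open>T\<close>;
  exchanging them and replacing \<open>F\<close> by its adjoints gives the other direction.
  Compositions are bracketed to the right as a normal form.\<close>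

locale linked_embeddings =
  S: order_embedding S \<phi> + T: order_embedding T \<psi>
  for S :: "('h::fin_dim_chilbert_space \<Rightarrow>\<^sub>L 'h) set" and \<phi> :: "('h \<Rightarrow>\<^sub>L 'h) \<Rightarrow> ('c::chilbert_space \<Rightarrow>\<^sub>L 'c)"
    and T :: "('k::fin_dim_chilbert_space \<Rightarrow>\<^sub>L 'k) set" and \<psi> :: "('k \<Rightarrow>\<^sub>L 'k) \<Rightarrow> ('d::chilbert_space \<Rightarrow>\<^sub>L 'd)" +
  fixes F :: "('c \<Rightarrow>\<^sub>L 'd) set" and a b a' b' :: "nat \<Rightarrow> 'c \<Rightarrow>\<^sub>L 'd" and N N' :: nat
  assumes finite_F: "finite F" and F_bops: "m \<in> F \<Longrightarrow> m \<in> bops"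
    and F_S: "m \<in> F \<Longrightarrow> n \<in> F \<Longrightarrow> t \<in> T \<Longrightarrow> m\<^sup>\<dagger> o\<^sub>L (\<psi> t o\<^sub>L n) \<in> \<phi> ` S"
    and F_T: "m \<in> F \<Longrightarrow> n \<in> F \<Longrightarrow> s \<in> S \<Longrightarrow> m o\<^sub>L (\<phi> s o\<^sub>L n\<^sup>\<dagger>) \<in> \<psi> ` T"
    and ab: "r < N \<Longrightarrow> a r \<in> F" "r < N \<Longrightarrow> b r \<in> F"
    and ab': "r < N' \<Longrightarrow> a' r \<in> F" "r < N' \<Longrightarrow> b' r \<in> F"
    and sum_ab: "(\<Sum>r<N. a r o\<^sub>L (b r)\<^sup>\<dagger>) = id_blinfun"
    and sum_ab': "(\<Sum>r<N'. (a' r)\<^sup>\<dagger> o\<^sub>L b' r) = id_blinfun"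
    and gen: "cstar_generated T = bops"
begin

abbreviation "\<sigma> \<equiv> S.inv_map"
abbreviation "\<tau> \<equiv> T.inv_map"

lemma F_T1: "m \<in> F \<Longrightarrow> n \<in> F \<Longrightarrow> m o\<^sub>L n\<^sup>\<dagger> \<in> \<psi> ` T"
  using F_T[OF _ _ S.S_simps(5)] by (simp add: S.map_id)

text \<open>The inner product with \<open>m\<close> and \<open>m'\<close> lies in the image of
  \<open>S\<close>, and the outer pair carries it back to the image of \<open>T\<close>.\<close>

lemma F_T2:
  assumes "m \<in> F" "n \<in> F" "m' \<in> F" "n' \<in> F" "t \<in> T"
  shows "n o\<^sub>L (m\<^sup>\<dagger> o\<^sub>L (\<psi> t o\<^sub>L (m' o\<^sub>L n'\<^sup>\<dagger>))) \<in> \<psi> ` T"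
  using F_T[of n n' "\<sigma> (m\<^sup>\<dagger> o\<^sub>L (\<psi> t o\<^sub>L m'))"] F_S[of m m' t] assms
  by (simp add: S.inv_mem blinfun_compose_assoc)

lemma sum_ab_compose: "(\<Sum>r<N. a r o\<^sub>L ((b r)\<^sup>\<dagger> o\<^sub>L x)) = x"
proof -
  have "(\<Sum>r<N. a r o\<^sub>L (b r)\<^sup>\<dagger>) o\<^sub>L x = x" by (simp add: sum_ab)
  then show ?thesis by (simp add: compose_simps blinfun_compose_assoc)
qed

lemma sum_ba: "(\<Sum>r<N. b r o\<^sub>L (a r)\<^sup>\<dagger>) = id_blinfun"
proof -
  have "(\<Sum>r<N. a r o\<^sub>L (b r)\<^sup>\<dagger>)\<^sup>\<dagger> = (\<Sum>r<N. (a r o\<^sub>L (b r)\<^sup>\<dagger>)\<^sup>\<dagger>)"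
    using ab F_bops by (intro cadjoint_sum) (auto intro!: bops_compose cadjoint_bops)
  also have "\<dots> = (\<Sum>r<N. b r o\<^sub>L (a r)\<^sup>\<dagger>)"
    using ab F_bops by (intro sum.cong refl) (simp add: cadjoint_compose cadjoint_bops)
  finally show ?thesis by (simp add: sum_ab)
qed

lemma sum_ba_compose: "(\<Sum>r<N. b r o\<^sub>L ((a r)\<^sup>\<dagger> o\<^sub>L x)) = x"
proof -
  have "(\<Sum>r<N. b r o\<^sub>L (a r)\<^sup>\<dagger>) o\<^sub>L x = x" by (simp add: sum_ba)
  then show ?thesis by (simp add: compose_simps blinfun_compose_assoc)
qed

text \<open>The identity, factored by the families \<open>a\<close> and \<open>b\<close>, is
  inserted on the left and turns the product into a sum of the two-sided products of
  \<open>F_T2\<close>.\<close>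

lemma F_T3:
  assumes "m \<in> F" "n \<in> F" "t \<in> T"
  shows "\<psi> t o\<^sub>L (m o\<^sub>L n\<^sup>\<dagger>) \<in> \<psi> ` T"
proof -
  have "(\<Sum>r<N. a r o\<^sub>L ((b r)\<^sup>\<dagger> o\<^sub>L (\<psi> t o\<^sub>L (m o\<^sub>L n\<^sup>\<dagger>)))) \<in> \<psi> ` T"
    using assms ab by (intro T.image_sum F_T2) auto
  then show ?thesis by (simp only: sum_ab_compose)
qed

text \<open>\<open>\<tau>\<close> is only known to be an order isomorphism. It is multiplicative on
  these products because they stay in the image of \<open>T\<close>, where the boundary theorem
  takes effect.\<close>

lemma \<tau>_right:
  assumes "m \<in> F" "n \<in> F" "t \<in> T"
  shows "\<tau> (\<psi> t o\<^sub>L (m o\<^sub>L n\<^sup>\<dagger>)) = t o\<^sub>L \<tau> (m o\<^sub>L n\<^sup>\<dagger>)"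
proof (rule inv_map_mult_right[OF T.order_embedding_axioms gen])
  show "m o\<^sub>L n\<^sup>\<dagger> \<in> bops" using assms F_bops by auto
  show "\<psi> t o\<^sub>L (m o\<^sub>L n\<^sup>\<dagger>) \<in> \<psi> ` T" if "t \<in> T" for t using F_T3 assms that by simp
  show "(m o\<^sub>L n\<^sup>\<dagger>)\<^sup>\<dagger> o\<^sub>L \<psi> t o\<^sub>L (m o\<^sub>L n\<^sup>\<dagger>) \<in> \<psi> ` T" if "t \<in> T" for t
    using F_T2[of m n m n t] assms that F_bops
    by (simp add: cadjoint_compose cadjoint_bops blinfun_compose_assoc)
qed (rule assms)

lemma \<tau>_star:
  assumes "m \<in> F" "n \<in> F"
  shows "(\<tau> (m o\<^sub>L n\<^sup>\<dagger>))\<^sup>\<dagger> = \<tau> (n o\<^sub>L m\<^sup>\<dagger>)"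
  using T.inv_star[OF F_T1[OF assms]] assms F_bops by (simp add: cadjoint_compose cadjoint_bops)

lemma \<tau>_left:
  assumes "m \<in> F" "n \<in> F" "t \<in> T"
  shows "\<tau> (m o\<^sub>L (n\<^sup>\<dagger> o\<^sub>L \<psi> t)) = \<tau> (m o\<^sub>L n\<^sup>\<dagger>) o\<^sub>L t"
proof -
  have t: "t\<^sup>\<dagger> \<in> T" "t \<in> bops" "\<psi> t \<in> bops" using assms T.S_simps T.map_bops by auto
  have "\<psi> (t\<^sup>\<dagger>) o\<^sub>L (n o\<^sub>L m\<^sup>\<dagger>) = (m o\<^sub>L (n\<^sup>\<dagger> o\<^sub>L \<psi> t))\<^sup>\<dagger>"
    using assms F_bops t
    by (simp add: T.map_star cadjoint_compose cadjoint_bops bops_compose blinfun_compose_assoc)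
  then have "m o\<^sub>L (n\<^sup>\<dagger> o\<^sub>L \<psi> t) = (\<psi> (t\<^sup>\<dagger>) o\<^sub>L (n o\<^sub>L m\<^sup>\<dagger>))\<^sup>\<dagger>"
    using assms F_bops t by (simp add: bops_compose cadjoint_bops)
  then have "\<tau> (m o\<^sub>L (n\<^sup>\<dagger> o\<^sub>L \<psi> t)) = (t\<^sup>\<dagger> o\<^sub>L \<tau> (n o\<^sub>L m\<^sup>\<dagger>))\<^sup>\<dagger>"
    using F_T3[OF assms(2,1) t(1)] \<tau>_right[OF assms(2,1) t(1)] by (simp add: T.inv_star)
  also have "\<dots> = \<tau> (m o\<^sub>L n\<^sup>\<dagger>) o\<^sub>L t"
    using t T.inv_bops[OF F_T1[OF assms(2,1)]] \<tau>_star[OF assms(2,1)]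
    by (simp add: cadjoint_compose cadjoint_bops)
  finally show ?thesis .
qed

text \<open>The right factor is absorbed into \<open>T\<close> first; the left rule then applies
  with \<open>t o\<^sub>L \<tau> (m' o\<^sub>L n'\<^sup>\<dagger>)\<close> in place of
  \<open>t\<close>.\<close>

lemma \<tau>_both:
  assumes "m \<in> F" "n \<in> F" "m' \<in> F" "n' \<in> F" "t \<in> T"
  shows "\<tau> (m o\<^sub>L (n\<^sup>\<dagger> o\<^sub>L (\<psi> t o\<^sub>L (m' o\<^sub>L n'\<^sup>\<dagger>)))) = \<tau> (m o\<^sub>L n\<^sup>\<dagger>) o\<^sub>L (t o\<^sub>L \<tau> (m' o\<^sub>L n'\<^sup>\<dagger>))"
proof -
  have "\<psi> (t o\<^sub>L \<tau> (m' o\<^sub>L n'\<^sup>\<dagger>)) = \<psi> t o\<^sub>L (m' o\<^sub>L n'\<^sup>\<dagger>)"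
    using T.map_inv[OF F_T3[OF assms(3,4,5)]] by (simp add: \<tau>_right assms)
  then show ?thesis
    using \<tau>_left[OF assms(1,2) T.inv_mem[OF F_T3[OF assms(3,4,5)]]] by (simp add: \<tau>_right assms)
qed

text \<open>The two Kraus families are applied in succession. Equality in the Cauchy-Schwarz
  inequality determines the composed operators up to scalars, and fixing one Kraus index on the side
  of \<open>R\<close> leaves a single pair of operators for each \<open>m\<close> and
  \<open>n\<close>.\<close>

lemma intertwiners:
  assumes nontrivial: "(id_blinfun :: 'k \<Rightarrow>\<^sub>L 'k) \<noteq> 0"
  shows "\<exists>Q R \<gamma>. (\<forall>m. Q m \<in> bops) \<and> (\<forall>n. R n \<in> bops) \<and> \<gamma> \<noteq> 0 \<and>
    (\<forall>m\<in>F. \<forall>n\<in>F. Q m o\<^sub>L R n = \<gamma> *\<^sub>C \<tau> (m o\<^sub>L n\<^sup>\<dagger>)) \<and>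
    (\<forall>m\<in>F. \<forall>m'\<in>F. \<forall>n\<in>F. \<forall>t\<in>T. \<sigma> (m\<^sup>\<dagger> o\<^sub>L (\<psi> t o\<^sub>L m')) o\<^sub>L R n = (Q m)\<^sup>\<dagger> o\<^sub>L (t o\<^sub>L \<tau> (m' o\<^sub>L n\<^sup>\<dagger>)))"
proof -
  have "\<exists>(N::nat) R. (\<forall>l m. R l m \<in> bops) \<and> (\<forall>m\<in>F. \<forall>n\<in>F. \<forall>s\<in>S.
      \<tau> ((m\<^sup>\<dagger>)\<^sup>\<dagger> o\<^sub>L \<phi> s o\<^sub>L n\<^sup>\<dagger>) = (\<Sum>l<N. (R l m)\<^sup>\<dagger> o\<^sub>L s o\<^sub>L R l n))"
    by (rule kraus_between[OF S.order_embedding_axioms T.order_embedding_axioms finite_F])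
      (use F_bops F_T in \<open>auto simp: blinfun_compose_assoc\<close>)
  then obtain N2 :: nat and R where Rb: "\<And>l m. R l m \<in> bops" and
    R0: "\<And>m n s. m \<in> F \<Longrightarrow> n \<in> F \<Longrightarrow> s \<in> S \<Longrightarrow>
      \<tau> ((m\<^sup>\<dagger>)\<^sup>\<dagger> o\<^sub>L \<phi> s o\<^sub>L n\<^sup>\<dagger>) = (\<Sum>l<N2. (R l m)\<^sup>\<dagger> o\<^sub>L s o\<^sub>L R l n)"
    by blast
  have R: "\<tau> (m o\<^sub>L (\<phi> s o\<^sub>L n\<^sup>\<dagger>)) = (\<Sum>l<N2. (R l m)\<^sup>\<dagger> o\<^sub>L (s o\<^sub>L R l n))"
    if "m \<in> F" "n \<in> F" "s \<in> S" for m n s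
    using R0[OF that] F_bops[OF that(1)] by (simp add: blinfun_compose_assoc)
  have "\<exists>(N::nat) Q. (\<forall>k m. Q k m \<in> bops) \<and> (\<forall>m\<in>F. \<forall>n\<in>F. \<forall>t\<in>T.
      \<sigma> (m\<^sup>\<dagger> o\<^sub>L \<psi> t o\<^sub>L n) = (\<Sum>k<N. (Q k m)\<^sup>\<dagger> o\<^sub>L t o\<^sub>L Q k n))"
    by (rule kraus_between[OF T.order_embedding_axioms S.order_embedding_axioms finite_F])
      (use F_bops F_S in \<open>auto simp: blinfun_compose_assoc\<close>)
  then obtain N1 :: nat and Q where Qb: "\<And>k m. Q k m \<in> bops" and
    Q: "\<And>m n t. m \<in> F \<Longrightarrow> n \<in> F \<Longrightarrow> t \<in> T \<Longrightarrow> \<sigma> (m\<^sup>\<dagger> o\<^sub>L (\<psi> t o\<^sub>L n)) = (\<Sum>k<N1. (Q k m)\<^sup>\<dagger> o\<^sub>L (t o\<^sub>L Q k n))"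
    unfolding blinfun_compose_assoc by blast
  define P where "P = {..<N1} \<times> {..<N2}"
  define X where "X p m n = Q (fst p) m o\<^sub>L R (snd p) n" for p m n
  have Xb: "X p m n \<in> bops" for p m n using Qb Rb by (auto simp: X_def)
  \<comment> \<open>The inner family yields \<open>\<sigma>\<close> of an element in the image of
    \<open>S\<close>, and the outer family applies \<open>\<phi>\<close> to it again, so only the
    original element remains under \<open>\<tau>\<close>.\<close>
  have key: "(\<Sum>p\<in>P. (X p m n)\<^sup>\<dagger> o\<^sub>L (t o\<^sub>L X p m' n')) = \<tau> (n o\<^sub>L (m\<^sup>\<dagger> o\<^sub>L (\<psi> t o\<^sub>L (m' o\<^sub>L n'\<^sup>\<dagger>))))"
    if "m \<in> F" "n \<in> F" "m' \<in> F" "n' \<in> F" "t \<in> T" for m n m' n' t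
  proof -
    have "(\<Sum>p\<in>P. (X p m n)\<^sup>\<dagger> o\<^sub>L (t o\<^sub>L X p m' n'))
        = (\<Sum>k<N1. \<Sum>l<N2. (R l n)\<^sup>\<dagger> o\<^sub>L (((Q k m)\<^sup>\<dagger> o\<^sub>L (t o\<^sub>L Q k m')) o\<^sub>L R l n'))"
      unfolding P_def X_def sum.cartesian_product'
      by (simp add: cadjoint_compose Qb Rb blinfun_compose_assoc)
    also have "\<dots> = (\<Sum>l<N2. \<Sum>k<N1. (R l n)\<^sup>\<dagger> o\<^sub>L (((Q k m)\<^sup>\<dagger> o\<^sub>L (t o\<^sub>L Q k m')) o\<^sub>L R l n'))"
      by (rule sum.swap)
    also have "\<dots> = (\<Sum>l<N2. (R l n)\<^sup>\<dagger> o\<^sub>L (\<sigma> (m\<^sup>\<dagger> o\<^sub>L (\<psi> t o\<^sub>L m')) o\<^sub>L R l n'))"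
      using that by (simp add: Q compose_simps)
    also have "\<dots> = \<tau> (n o\<^sub>L (m\<^sup>\<dagger> o\<^sub>L (\<psi> t o\<^sub>L (m' o\<^sub>L n'\<^sup>\<dagger>))))"
      using that F_S[of m m' t] by (simp add: R[symmetric] S.inv_mem blinfun_compose_assoc)
    finally show ?thesis .
  qed
  \<comment> \<open>Summed over the factorisation of the identity, the composed operators become
    Kraus operators of a map that fixes \<open>T\<close>; so each \<open>C p\<close> is a
    scalar.\<close>
  define C where "C p = (\<Sum>r<N. X p (a r) (b r))" for p
  have Cb: "C p \<in> bops" for p unfolding C_def by (intro bops_sum Xb)
  have C_adj: "(C p)\<^sup>\<dagger> = (\<Sum>r<N. (X p (a r) (b r))\<^sup>\<dagger>)" for p
    unfolding C_def by (rule cadjoint_sum) (rule Xb)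
  have cross: "(\<Sum>p\<in>P. (C p)\<^sup>\<dagger> o\<^sub>L (t o\<^sub>L X p m n)) = \<tau> (\<psi> t o\<^sub>L (m o\<^sub>L n\<^sup>\<dagger>))"
    if mn: "m \<in> F" "n \<in> F" and t: "t \<in> T" for m n t
  proof -
    have "(\<Sum>p\<in>P. (C p)\<^sup>\<dagger> o\<^sub>L (t o\<^sub>L X p m n)) = (\<Sum>p\<in>P. \<Sum>r<N. (X p (a r) (b r))\<^sup>\<dagger> o\<^sub>L (t o\<^sub>L X p m n))"
      by (simp add: C_adj compose_simps)
    also have "\<dots> = (\<Sum>r<N. \<Sum>p\<in>P. (X p (a r) (b r))\<^sup>\<dagger> o\<^sub>L (t o\<^sub>L X p m n))" by (rule sum.swap)
    also have "\<dots> = (\<Sum>r<N. \<tau> (b r o\<^sub>L ((a r)\<^sup>\<dagger> o\<^sub>L (\<psi> t o\<^sub>L (m o\<^sub>L n\<^sup>\<dagger>)))))"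
      using ab mn t by (intro sum.cong refl key) auto
    also have "\<dots> = \<tau> (\<Sum>r<N. b r o\<^sub>L ((a r)\<^sup>\<dagger> o\<^sub>L (\<psi> t o\<^sub>L (m o\<^sub>L n\<^sup>\<dagger>))))"
      using ab mn t by (intro T.inv_sum[symmetric] F_T2) auto
    finally show ?thesis by (simp only: sum_ba_compose)
  qed
  have fixed: "(\<Sum>p\<in>P. (C p)\<^sup>\<dagger> o\<^sub>L t o\<^sub>L C p) = t" if t: "t \<in> T" for t
  proof -
    have "(\<Sum>p\<in>P. (C p)\<^sup>\<dagger> o\<^sub>L t o\<^sub>L C p) = (\<Sum>p\<in>P. \<Sum>r<N. (C p)\<^sup>\<dagger> o\<^sub>L (t o\<^sub>L X p (a r) (b r)))"
      unfolding blinfun_compose_assoc by (subst (2) C_def) (simp add: compose_simps)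
    also have "\<dots> = (\<Sum>r<N. \<Sum>p\<in>P. (C p)\<^sup>\<dagger> o\<^sub>L (t o\<^sub>L X p (a r) (b r)))" by (rule sum.swap)
    also have "\<dots> = (\<Sum>r<N. \<tau> (\<psi> t o\<^sub>L (a r o\<^sub>L (b r)\<^sup>\<dagger>)))"
      using ab t by (intro sum.cong refl cross) auto
    also have "\<dots> = \<tau> (\<Sum>r<N. \<psi> t o\<^sub>L (a r o\<^sub>L (b r)\<^sup>\<dagger>))"
      using ab t by (intro T.inv_sum[symmetric] F_T3) auto
    also have "(\<Sum>r<N. \<psi> t o\<^sub>L (a r o\<^sub>L (b r)\<^sup>\<dagger>)) = \<psi> t"
      by (simp add: sum_ab flip: compose_simps)
    finally show ?thesis using t by simp
  qed
  have finP: "finite P" by (simp add: P_def)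
  obtain c where c: "\<And>p. p \<in> P \<Longrightarrow> C p = c p *\<^sub>C id_blinfun"
    using boundary_theorem[OF T.op_sys gen Cb fixed finP] by blast
  have norm_c: "(\<Sum>p\<in>P. cnj (c p) * c p) *\<^sub>C v = v" for v :: 'k
  proof -
    have "(\<Sum>p\<in>P. cnj (c p) * c p) *\<^sub>C v = (\<Sum>p\<in>P. (C p)\<^sup>\<dagger> o\<^sub>L id_blinfun o\<^sub>L C p) v"
      by (simp add: c cadjoint_scaleC blinfun_sum_apply scaleC_sum_left scaleC_scaleC)
    then show ?thesis using fixed[OF T.S_simps(5)] by simp
  qed
  \<comment> \<open>With \<open>D\<close> for the pulled-back product, three sums over
    \<open>p\<close> equal \<open>(norm (D v))\<^sup>2\<close>: the squares of
    \<open>X p m n v\<close>, the real inner products with \<open>c p *\<^sub>C D v\<close>, and the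
    squares of \<open>c p *\<^sub>C D v\<close>. Hence the squared distances sum to zero.\<close>
  have QR: "X p m n = c p *\<^sub>C \<tau> (m o\<^sub>L n\<^sup>\<dagger>)" if p: "p \<in> P" and mn: "m \<in> F" "n \<in> F" for p m n
  proof (rule blinfun_eqI)
    fix v
    define D where "D = \<tau> (m o\<^sub>L n\<^sup>\<dagger>)"
    have Db: "D \<in> bops" unfolding D_def using mn by (intro T.inv_bops F_T1)
    have "(\<Sum>p\<in>P. (X p m n)\<^sup>\<dagger> o\<^sub>L (id_blinfun o\<^sub>L X p m n)) = D\<^sup>\<dagger> o\<^sub>L D"
      unfolding key[OF mn mn T.S_simps(5)] \<tau>_both[OF mn(2,1) mn T.S_simps(5)]
      by (simp add: D_def \<tau>_star mn)
    then have "cinner ((\<Sum>p\<in>P. (X p m n)\<^sup>\<dagger> o\<^sub>L X p m n) v) v = cinner ((D\<^sup>\<dagger> o\<^sub>L D) v) v"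
      by simp
    then have "(\<Sum>p\<in>P. cinner (((X p m n)\<^sup>\<dagger> o\<^sub>L X p m n) v) v) = of_real ((norm (D v))\<^sup>2)"
      unfolding cinner_square[OF Db] blinfun_sum_apply cinner_sum_left .
    then have n1: "(\<Sum>p\<in>P. (norm (X p m n v))\<^sup>2) = (norm (D v))\<^sup>2"
      unfolding cinner_square[OF Xb] by (simp only: of_real_sum[symmetric] of_real_eq_iff)
    have "(\<Sum>p\<in>P. (C p)\<^sup>\<dagger> o\<^sub>L X p m n) = D"
      using cross[OF mn T.S_simps(5)] by (simp add: T.map_id D_def)
    then have "D v = (\<Sum>p\<in>P. (C p)\<^sup>\<dagger> o\<^sub>L X p m n) v" by simp
    also have "\<dots> = (\<Sum>p\<in>P. cnj (c p) *\<^sub>C X p m n v)"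
      by (simp add: c cadjoint_scaleC blinfun_sum_apply)
    finally have "cinner (D v) (D v) = (\<Sum>p\<in>P. cinner (X p m n v) (c p *\<^sub>C D v))"
      by (simp add: cinner_sum_left cinner_scaleC_left cinner_scaleC_right)
    from arg_cong[OF this, of Re] have n2: "(\<Sum>p\<in>P. Re (cinner (X p m n v) (c p *\<^sub>C D v))) = (norm (D v))\<^sup>2"
      by (simp add: cinner_self_Re)
    have "cinner (D v) (D v) = (\<Sum>p\<in>P. cinner (c p *\<^sub>C D v) (c p *\<^sub>C D v))"
      by (subst norm_c[of "D v", symmetric])
        (simp add: cinner_scaleC_left cinner_scaleC_right sum_distrib_left sum_distrib_right mult_ac)
    from arg_cong[OF this, of Re] have n3: "(\<Sum>p\<in>P. (norm (c p *\<^sub>C D v))\<^sup>2) = (norm (D v))\<^sup>2"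
      by (simp add: cinner_self_Re)
    have "(\<Sum>p\<in>P. (norm (X p m n v - c p *\<^sub>C D v))\<^sup>2)
        = (\<Sum>p\<in>P. (norm (X p m n v))\<^sup>2 - 2 * Re (cinner (X p m n v) (c p *\<^sub>C D v)) + (norm (c p *\<^sub>C D v))\<^sup>2)"
      by (simp add: power2_norm_eq_inner inner_diff inner_commute inner_eq_Re_cinner[symmetric] algebra_simps)
    also have "\<dots> = 0"
      by (simp add: sum.distrib sum_subtractf n1 n2 n3 flip: sum_distrib_left)
    finally have "(norm (X p m n v - c p *\<^sub>C D v))\<^sup>2 = 0"
      using finP p by (subst (asm) sum_nonneg_eq_0_iff) auto
    then show "X p m n v = (c p *\<^sub>C \<tau> (m o\<^sub>L n\<^sup>\<dagger>)) v" by (simp add: D_def)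
  qed
  have "\<exists>p\<in>P. c p \<noteq> 0"
  proof (rule ccontr)
    assume "\<not> (\<exists>p\<in>P. c p \<noteq> 0)"
    then have "v = 0" for v :: 'k using norm_c[of v] by simp
    then have "(id_blinfun :: 'k \<Rightarrow>\<^sub>L 'k) = 0" by (intro blinfun_eqI) simp
    then show False using nontrivial by simp
  qed
  then obtain k0 l where k0: "k0 < N1" and l: "l < N2" and ck: "c (k0, l) \<noteq> 0" by (auto simp: P_def)
  \<comment> \<open>\<open>R\<close> keeps one index \<open>l\<close> with a nonzero coefficient,
    while the operators \<open>Q k\<close> are combined with conjugate coefficients; the scalars
    then add up to a sum of squares.\<close>
  define \<gamma> where "\<gamma> = (\<Sum>k<N1. cnj (c (k, l)) * c (k, l))"
  have "\<gamma> = of_real (\<Sum>k<N1. (cmod (c (k, l)))\<^sup>2)"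
    unfolding \<gamma>_def of_real_sum by (intro sum.cong refl) (simp only: complex_norm_square mult.commute)
  moreover have "(\<Sum>k<N1. (cmod (c (k, l)))\<^sup>2) > 0"
    by (rule sum_pos2[of _ k0]) (use k0 ck in auto)
  ultimately have \<gamma>: "\<gamma> \<noteq> 0" by (metis of_real_eq_0_iff less_irrefl)
  define Q' where "Q' m = (\<Sum>k<N1. cnj (c (k, l)) *\<^sub>C Q k m)" for m
  have Q'b: "Q' m \<in> bops" for m using Qb by (auto simp: Q'_def)
  have Q'_adj: "(Q' m)\<^sup>\<dagger> = (\<Sum>k<N1. c (k, l) *\<^sub>C (Q k m)\<^sup>\<dagger>)" for m
    unfolding Q'_def using Qb by (subst cadjoint_sum) (auto simp: cadjoint_scaleC)
  have QR': "Q k m o\<^sub>L R l n = c (k, l) *\<^sub>C \<tau> (m o\<^sub>L n\<^sup>\<dagger>)" if "k < N1" "m \<in> F" "n \<in> F" for k m n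
    using QR[of "(k, l)" m n] that l by (simp add: P_def X_def)
  have 1: "Q' m o\<^sub>L R l n = \<gamma> *\<^sub>C \<tau> (m o\<^sub>L n\<^sup>\<dagger>)" if "m \<in> F" "n \<in> F" for m n
    using that by (simp add: Q'_def \<gamma>_def compose_simps compose_scaleC_left QR' scaleC_scaleC scaleC_sum_left)
  \<comment> \<open>The conjugate weights in \<open>Q'\<close> become the weights
    \<open>c (k, l)\<close> in its adjoint, and these are the scalars that \<open>QR'\<close>
    produces.\<close>
  have 2: "\<sigma> (m\<^sup>\<dagger> o\<^sub>L (\<psi> t o\<^sub>L m')) o\<^sub>L R l n = (Q' m)\<^sup>\<dagger> o\<^sub>L (t o\<^sub>L \<tau> (m' o\<^sub>L n\<^sup>\<dagger>))"
    if mn: "m \<in> F" "m' \<in> F" "n \<in> F" and t: "t \<in> T" for m m' n t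
  proof -
    have tb: "t \<in> bops" by (rule T.S_simps(1)[OF t])
    have "\<sigma> (m\<^sup>\<dagger> o\<^sub>L (\<psi> t o\<^sub>L m')) o\<^sub>L R l n = (\<Sum>k<N1. (Q k m)\<^sup>\<dagger> o\<^sub>L (t o\<^sub>L (Q k m' o\<^sub>L R l n)))"
      using mn t by (simp add: Q compose_simps blinfun_compose_assoc)
    also have "\<dots> = (\<Sum>k<N1. (c (k, l) *\<^sub>C (Q k m)\<^sup>\<dagger>) o\<^sub>L (t o\<^sub>L \<tau> (m' o\<^sub>L n\<^sup>\<dagger>)))"
      using mn tb Qb by (intro sum.cong refl)
        (simp add: QR' compose_scaleC_left compose_scaleC_right cadjoint_bops)
    finally show ?thesis by (simp add: Q'_adj compose_simps)
  qed
  show ?thesis using Q'b Rb \<gamma> 1 2 by (intro exI[of _ Q'] exI[of _ "R l"] exI[of _ \<gamma>]) simp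
qed

end

text \<open>The index type \<open>bool \<times> nat\<close> serves the matrices \<open>dilation c A\<close> below.\<close>

definition detects_positivity :: "('a::chilbert_space \<Rightarrow>\<^sub>L 'a) set \<Rightarrow> ('a \<Rightarrow>\<^sub>L 'a) \<Rightarrow> bool"
  where "detects_positivity S p \<longleftrightarrow>
    (\<forall>(J :: (bool \<times> nat) set) A. finite J \<longrightarrow> (\<forall>i\<in>J. \<forall>j\<in>J. A i j \<in> S) \<longrightarrow>
      (\<forall>x. (\<forall>i. blinfun_apply p (x i) = x i) \<longrightarrow>
        (\<Sum>i\<in>J. \<Sum>j\<in>J. cinner (blinfun_apply (A i j) (x j)) (x i)) \<in> \<real>\<^sub>\<ge>\<^sub>0) \<longrightarrow> psd J A)"

context linked_embeddings
begin

text \<open>The scalars that belong to \<open>q\<close> and to its complement add up to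
  \<open>\<gamma>\<close>, so they cannot both vanish. A nonzero scalar allows positivity on the
  range of the projection to be transferred to matrices over \<open>T\<close> and from there to the
  whole of \<open>S\<close>.\<close>

lemma projection_detects_positivity:
  assumes nontrivial: "(id_blinfun :: 'k \<Rightarrow>\<^sub>L 'k) \<noteq> 0"
    and q: "q \<in> bops" "q\<^sup>\<dagger> = q" "q o\<^sub>L q = q" and q_comm: "\<And>s. s \<in> S \<Longrightarrow> q o\<^sub>L s = s o\<^sub>L q"
  shows "detects_positivity S q \<or> detects_positivity S (id_blinfun - q)"
proof -
  obtain Q R \<gamma> where Qb: "\<And>m. Q m \<in> bops" and Rb: "\<And>n. R n \<in> bops" and \<gamma>: "\<gamma> \<noteq> 0"
    and QR: "\<And>m n. m \<in> F \<Longrightarrow> n \<in> F \<Longrightarrow> Q m o\<^sub>L R n = \<gamma> *\<^sub>C \<tau> (m o\<^sub>L n\<^sup>\<dagger>)"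
    and \<sigma>R: "\<And>m m' n t. m \<in> F \<Longrightarrow> m' \<in> F \<Longrightarrow> n \<in> F \<Longrightarrow> t \<in> T \<Longrightarrow>
      \<sigma> (m\<^sup>\<dagger> o\<^sub>L (\<psi> t o\<^sub>L m')) o\<^sub>L R n = (Q m)\<^sup>\<dagger> o\<^sub>L (t o\<^sub>L \<tau> (m' o\<^sub>L n\<^sup>\<dagger>))"
    using intertwiners[OF nontrivial] by metis
  have R\<sigma>: "(R n')\<^sup>\<dagger> o\<^sub>L \<sigma> (m\<^sup>\<dagger> o\<^sub>L (\<psi> t o\<^sub>L m')) = \<tau> (n' o\<^sub>L m\<^sup>\<dagger>) o\<^sub>L (t o\<^sub>L Q m')"
    if mn: "m \<in> F" "m' \<in> F" "n' \<in> F" and t: "t \<in> T" for m m' n' t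
  proof -
    have tb: "t \<in> bops" "t\<^sup>\<dagger> \<in> T" "\<psi> t \<in> bops" using t T.S_simps T.map_bops by auto
    have \<sigma>b: "\<sigma> (m'\<^sup>\<dagger> o\<^sub>L (\<psi> (t\<^sup>\<dagger>) o\<^sub>L m)) \<in> bops" by (intro S.inv_bops F_S mn tb)
    have \<tau>b: "\<tau> (m o\<^sub>L n'\<^sup>\<dagger>) \<in> bops" by (intro T.inv_bops F_T1 mn)
    have adj: "(\<sigma> (m'\<^sup>\<dagger> o\<^sub>L (\<psi> (t\<^sup>\<dagger>) o\<^sub>L m)))\<^sup>\<dagger> = \<sigma> (m\<^sup>\<dagger> o\<^sub>L (\<psi> t o\<^sub>L m'))"
      using S.inv_star[OF F_S[OF mn(2,1) tb(2)]] mn F_bops tb t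
      by (simp add: cadjoint_compose cadjoint_bops bops_compose T.map_star blinfun_compose_assoc)
    have "(\<sigma> (m'\<^sup>\<dagger> o\<^sub>L (\<psi> (t\<^sup>\<dagger>) o\<^sub>L m)) o\<^sub>L R n')\<^sup>\<dagger> = ((Q m')\<^sup>\<dagger> o\<^sub>L (t\<^sup>\<dagger> o\<^sub>L \<tau> (m o\<^sub>L n'\<^sup>\<dagger>)))\<^sup>\<dagger>"
      using mn tb by (simp only: \<sigma>R)
    then show ?thesis
      using \<sigma>b \<tau>b Qb Rb tb
      by (simp add: cadjoint_compose cadjoint_bops bops_compose adj \<tau>_star mn blinfun_compose_assoc)
  qed
  \<comment> \<open>The relation \<open>\<sigma>R\<close> and its adjoint form, joined through an
    element of \<open>S\<close> that \<open>p\<close> passes, give \<open>E1\<close>. Summing over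
    the factorisation of the identity strips the outer factors and leaves an operator
    \<open>Z\<close> that commutes with \<open>T\<close>, hence with everything.\<close>
  have scalar: "\<exists>z. \<forall>m\<in>F. \<forall>n\<in>F. Q m o\<^sub>L (p o\<^sub>L R n) = z *\<^sub>C \<tau> (m o\<^sub>L n\<^sup>\<dagger>)"
    if p: "p \<in> bops" "p\<^sup>\<dagger> = p" and p_comm: "\<And>s. s \<in> S \<Longrightarrow> p o\<^sub>L s = s o\<^sub>L p" for p
  proof -
    define Y where "Y m n = Q m o\<^sub>L (p o\<^sub>L R n)" for m n
    have Yb: "Y m n \<in> bops" for m n using Qb Rb p by (auto simp: Y_def)
    have Y_adj: "(Y m n)\<^sup>\<dagger> = (R n)\<^sup>\<dagger> o\<^sub>L (p o\<^sub>L (Q m)\<^sup>\<dagger>)" for m n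
      using Qb Rb p by (simp add: Y_def cadjoint_compose bops_compose blinfun_compose_assoc)
    have E1: "\<tau> (n' o\<^sub>L m\<^sup>\<dagger>) o\<^sub>L (t o\<^sub>L Y m' n) = (Y m n')\<^sup>\<dagger> o\<^sub>L (t o\<^sub>L \<tau> (m' o\<^sub>L n\<^sup>\<dagger>))"
      if mn: "m \<in> F" "m' \<in> F" "n \<in> F" "n' \<in> F" and t: "t \<in> T" for m m' n n' t
    proof -
      define s where "s = \<sigma> (m\<^sup>\<dagger> o\<^sub>L (\<psi> t o\<^sub>L m'))"
      have s: "s \<in> S" unfolding s_def by (intro S.inv_mem F_S mn t)
      have "\<tau> (n' o\<^sub>L m\<^sup>\<dagger>) o\<^sub>L (t o\<^sub>L Y m' n) = ((R n')\<^sup>\<dagger> o\<^sub>L s) o\<^sub>L (p o\<^sub>L R n)"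
        unfolding s_def R\<sigma>[OF mn(1,2,4) t] by (simp add: Y_def blinfun_compose_assoc)
      also have "\<dots> = (R n')\<^sup>\<dagger> o\<^sub>L ((s o\<^sub>L p) o\<^sub>L R n)" by (simp only: blinfun_compose_assoc)
      also have "\<dots> = (R n')\<^sup>\<dagger> o\<^sub>L (p o\<^sub>L (s o\<^sub>L R n))" by (simp only: p_comm[OF s, symmetric] blinfun_compose_assoc)
      also have "s o\<^sub>L R n = (Q m)\<^sup>\<dagger> o\<^sub>L (t o\<^sub>L \<tau> (m' o\<^sub>L n\<^sup>\<dagger>))" unfolding s_def by (rule \<sigma>R[OF mn(1-3) t])
      finally show ?thesis by (simp add: Y_adj blinfun_compose_assoc)
    qed
    define Z where "Z = (\<Sum>r<N. (Y (b r) (a r))\<^sup>\<dagger>)"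
    have Zb: "Z \<in> bops" unfolding Z_def by (intro bops_sum cadjoint_bops Yb)
    have \<tau>_ab: "(\<Sum>r<N. \<tau> (a r o\<^sub>L (b r)\<^sup>\<dagger>)) = id_blinfun"
      using T.inv_sum[of "{..<N}" "\<lambda>r. a r o\<^sub>L (b r)\<^sup>\<dagger>"] ab F_T1 by (simp add: sum_ab T.inv_id)
    have E2: "t o\<^sub>L Y m n = Z o\<^sub>L (t o\<^sub>L \<tau> (m o\<^sub>L n\<^sup>\<dagger>))" if "m \<in> F" "n \<in> F" "t \<in> T" for m n t
    proof -
      have "(\<Sum>r<N. \<tau> (a r o\<^sub>L (b r)\<^sup>\<dagger>) o\<^sub>L (t o\<^sub>L Y m n)) = (\<Sum>r<N. (Y (b r) (a r))\<^sup>\<dagger> o\<^sub>L (t o\<^sub>L \<tau> (m o\<^sub>L n\<^sup>\<dagger>)))"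
        using that ab by (intro sum.cong refl E1) auto
      then show ?thesis by (simp add: \<tau>_ab Z_def flip: compose_simps(5))
    qed
    define W where "W = (\<Sum>r<N. Y (a r) (b r))"
    have E3: "t o\<^sub>L W = Z o\<^sub>L t" if "t \<in> T" for t
    proof -
      have "t o\<^sub>L W = (\<Sum>r<N. t o\<^sub>L Y (a r) (b r))" by (simp add: W_def compose_simps)
      also have "\<dots> = (\<Sum>r<N. Z o\<^sub>L (t o\<^sub>L \<tau> (a r o\<^sub>L (b r)\<^sup>\<dagger>)))"
        using that ab by (intro sum.cong refl E2) auto
      also have "\<dots> = Z o\<^sub>L (t o\<^sub>L (\<Sum>r<N. \<tau> (a r o\<^sub>L (b r)\<^sup>\<dagger>)))" by (simp only: compose_simps)
      finally show ?thesis by (simp add: \<tau>_ab)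
    qed
    have "W = Z" using E3[OF T.S_simps(5)] by simp
    then have Z_comm: "Z o\<^sub>L t = t o\<^sub>L Z" if "t \<in> T" for t using E3[OF that] by simp
    have "Z o\<^sub>L x = x o\<^sub>L Z" if "x \<in> bops" for x
    proof (rule commutes_with_generated[OF gen _ _ Zb Z_comm that])
      show "T \<subseteq> bops" using T.S_simps(1) by blast
    qed (rule T.S_simps(4))
    then obtain z where z: "Z = z *\<^sub>C id_blinfun" using scalar_if_commutes[OF Zb] by blast
    have "Y m n = z *\<^sub>C \<tau> (m o\<^sub>L n\<^sup>\<dagger>)" if "m \<in> F" "n \<in> F" for m n
      using E2[OF that T.S_simps(5)] by (simp add: z compose_scaleC_left)
    then show ?thesis unfolding Y_def by blast
  qed
  have compress: "(R n')\<^sup>\<dagger> o\<^sub>L (p o\<^sub>L (s o\<^sub>L R n)) = z *\<^sub>C \<tau> (n' o\<^sub>L (\<phi> s o\<^sub>L n\<^sup>\<dagger>))"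
    if p: "p \<in> bops" and p_comm: "\<And>s. s \<in> S \<Longrightarrow> p o\<^sub>L s = s o\<^sub>L p"
      and z: "\<And>m n. m \<in> F \<Longrightarrow> n \<in> F \<Longrightarrow> Q m o\<^sub>L (p o\<^sub>L R n) = z *\<^sub>C \<tau> (m o\<^sub>L n\<^sup>\<dagger>)"
      and n: "n \<in> F" "n' \<in> F" and s: "s \<in> S" for p z n n' s
  proof -
    have basic: "(R n')\<^sup>\<dagger> o\<^sub>L (p o\<^sub>L (\<sigma> (m\<^sup>\<dagger> o\<^sub>L (\<psi> t o\<^sub>L m')) o\<^sub>L R n))
        = z *\<^sub>C \<tau> (n' o\<^sub>L (m\<^sup>\<dagger> o\<^sub>L (\<psi> t o\<^sub>L (m' o\<^sub>L n\<^sup>\<dagger>))))"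
      if m: "m \<in> F" "m' \<in> F" and t: "t \<in> T" for m m' t
    proof -
      define u where "u = \<sigma> (m\<^sup>\<dagger> o\<^sub>L (\<psi> t o\<^sub>L m'))"
      have u: "u \<in> S" unfolding u_def by (intro S.inv_mem F_S m t)
      have \<tau>b: "\<tau> (n' o\<^sub>L m\<^sup>\<dagger>) \<in> bops" by (intro T.inv_bops F_T1 m n)
      have "(R n')\<^sup>\<dagger> o\<^sub>L (p o\<^sub>L (u o\<^sub>L R n)) = ((R n')\<^sup>\<dagger> o\<^sub>L u) o\<^sub>L (p o\<^sub>L R n)"
        using p_comm[OF u] by (metis blinfun_compose_assoc)
      also have "\<dots> = \<tau> (n' o\<^sub>L m\<^sup>\<dagger>) o\<^sub>L (t o\<^sub>L (z *\<^sub>C \<tau> (m' o\<^sub>L n\<^sup>\<dagger>)))"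
        unfolding u_def R\<sigma>[OF m n(2) t] using z[OF m(2) n(1)] by (simp add: blinfun_compose_assoc)
      finally show ?thesis
        using \<tau>b T.S_simps(1)[OF t] by (simp add: \<tau>_both m n t compose_scaleC_right u_def)
    qed
    \<comment> \<open>For general \<open>s\<close> the identity, factored by \<open>a'\<close> and
      \<open>b'\<close>, is inserted on both sides of \<open>\<phi> s\<close>; this exhibits
      \<open>s\<close> as a sum of elements to which \<open>basic\<close> applies.\<close>
    define t where "t r r' = \<tau> (b' r o\<^sub>L (\<phi> s o\<^sub>L (a' r')\<^sup>\<dagger>))" for r r'
    have t: "t r r' \<in> T" "\<psi> (t r r') = b' r o\<^sub>L (\<phi> s o\<^sub>L (a' r')\<^sup>\<dagger>)" if "r < N'" "r' < N'" for r r'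
      using F_T[OF ab'(2)[OF that(1)] ab'(1)[OF that(2)] s] by (auto simp: t_def T.inv_mem)
    define u where "u r r' = (a' r)\<^sup>\<dagger> o\<^sub>L (\<psi> (t r r') o\<^sub>L b' r')" for r r'
    have uS: "u r r' \<in> \<phi> ` S" if "r < N'" "r' < N'" for r r'
      unfolding u_def using that ab' t by (intro F_S) auto
    have "(\<Sum>r<N'. \<Sum>r'<N'. u r r') = (\<Sum>r<N'. \<Sum>r'<N'. ((a' r)\<^sup>\<dagger> o\<^sub>L b' r) o\<^sub>L (\<phi> s o\<^sub>L ((a' r')\<^sup>\<dagger> o\<^sub>L b' r')))"
      by (intro sum.cong refl) (simp add: u_def t blinfun_compose_assoc)
    also have "\<dots> = (\<Sum>r<N'. (a' r)\<^sup>\<dagger> o\<^sub>L b' r) o\<^sub>L (\<phi> s o\<^sub>L (\<Sum>r'<N'. (a' r')\<^sup>\<dagger> o\<^sub>L b' r'))"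
      by (simp only: compose_simps) (rule sum.swap)
    finally have \<phi>s: "\<phi> s = (\<Sum>r<N'. \<Sum>r'<N'. u r r')" by (simp add: sum_ab')
    have "s = \<sigma> (\<Sum>r<N'. \<Sum>r'<N'. u r r')" using s by (simp flip: \<phi>s)
    also have "\<dots> = (\<Sum>r<N'. \<sigma> (\<Sum>r'<N'. u r r'))" by (rule S.inv_sum) (auto intro!: S.image_sum uS)
    also have "\<dots> = (\<Sum>r<N'. \<Sum>r'<N'. \<sigma> (u r r'))" by (intro sum.cong refl S.inv_sum) (auto intro!: uS)
    finally have s_eq: "s = (\<Sum>r<N'. \<Sum>r'<N'. \<sigma> (u r r'))" .
    have v: "n' o\<^sub>L (u r r' o\<^sub>L n\<^sup>\<dagger>) \<in> \<psi> ` T" if "r < N'" "r' < N'" for r r'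
      using F_T[OF n(2,1) S.inv_mem[OF uS[OF that]]] uS[OF that] by simp
    have "(R n')\<^sup>\<dagger> o\<^sub>L (p o\<^sub>L (s o\<^sub>L R n)) = (\<Sum>r<N'. \<Sum>r'<N'. (R n')\<^sup>\<dagger> o\<^sub>L (p o\<^sub>L (\<sigma> (u r r') o\<^sub>L R n)))"
      by (subst s_eq) (simp only: compose_simps)
    also have "\<dots> = (\<Sum>r<N'. \<Sum>r'<N'. z *\<^sub>C \<tau> (n' o\<^sub>L (u r r' o\<^sub>L n\<^sup>\<dagger>)))"
    proof (intro sum.cong refl)
      fix r r' assume "r \<in> {..<N'}" "r' \<in> {..<N'}"
      then show "(R n')\<^sup>\<dagger> o\<^sub>L (p o\<^sub>L (\<sigma> (u r r') o\<^sub>L R n)) = z *\<^sub>C \<tau> (n' o\<^sub>L (u r r' o\<^sub>L n\<^sup>\<dagger>))"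
        unfolding u_def using basic[of "a' r" "b' r'" "t r r'"] ab' t by (simp add: blinfun_compose_assoc)
    qed
    also have "\<dots> = z *\<^sub>C (\<Sum>r<N'. \<Sum>r'<N'. \<tau> (n' o\<^sub>L (u r r' o\<^sub>L n\<^sup>\<dagger>)))"
      by (simp only: scaleC_sum_right)
    also have "(\<Sum>r<N'. \<Sum>r'<N'. \<tau> (n' o\<^sub>L (u r r' o\<^sub>L n\<^sup>\<dagger>))) = (\<Sum>r<N'. \<tau> (\<Sum>r'<N'. n' o\<^sub>L (u r r' o\<^sub>L n\<^sup>\<dagger>)))"
      by (intro sum.cong refl T.inv_sum[symmetric]) (auto intro!: v)
    also have "\<dots> = \<tau> (\<Sum>r<N'. \<Sum>r'<N'. n' o\<^sub>L (u r r' o\<^sub>L n\<^sup>\<dagger>))"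
      by (rule T.inv_sum[symmetric]) (auto intro!: T.image_sum v)
    also have "(\<Sum>r<N'. \<Sum>r'<N'. n' o\<^sub>L (u r r' o\<^sub>L n\<^sup>\<dagger>)) = n' o\<^sub>L (\<phi> s o\<^sub>L n\<^sup>\<dagger>)"
      by (simp only: \<phi>s compose_simps)
    finally show ?thesis .
  qed
  have detects: "detects_positivity S p"
    if p: "p \<in> bops" "p\<^sup>\<dagger> = p" "p o\<^sub>L p = p" and p_comm: "\<And>s. s \<in> S \<Longrightarrow> p o\<^sub>L s = s o\<^sub>L p"
      and z: "\<And>m n. m \<in> F \<Longrightarrow> n \<in> F \<Longrightarrow> Q m o\<^sub>L (p o\<^sub>L R n) = z *\<^sub>C \<tau> (m o\<^sub>L n\<^sup>\<dagger>)" and z0: "z \<noteq> 0" for p z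
  proof -
    have pp: "p (p x) = p x" for x using p(3) by (metis blinfun_apply_blinfun_compose)
    have pR: "cinner ((R n')\<^sup>\<dagger> (p (s (R n v)))) w = cinner (s (p (R n v))) (p (R n' w))" if s: "s \<in> S" for s n n' v w
    proof -
      have comm: "p (s x) = s (p x)" for x using p_comm[OF s] by (metis blinfun_apply_blinfun_compose)
      have "cinner ((R n')\<^sup>\<dagger> (p (s (R n v)))) w = cinner (p (p (s (R n v)))) (R n' w)"
        by (simp add: cinner_adj_right Rb pp)
      also have "\<dots> = cinner (p (s (R n v))) (p (R n' w))"
        using cinner_adj_left[OF p(1), of "p (s (R n v))" "R n' w"] by (simp add: p(2))
      finally show ?thesis by (simp add: comm)
    qed
    have form: "cinner (s (p (R n v))) (p (R n' w)) = z * cinner (\<tau> (n' o\<^sub>L (\<phi> s o\<^sub>L n\<^sup>\<dagger>)) v) w"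
      if "s \<in> S" "n \<in> F" "n' \<in> F" for s n n' v w
    proof -
      have "cinner (s (p (R n v))) (p (R n' w)) = cinner (((R n')\<^sup>\<dagger> o\<^sub>L (p o\<^sub>L (s o\<^sub>L R n))) v) w"
        using pR[OF that(1)] by simp
      then show ?thesis
        by (simp only: compress[OF p(1) p_comm z that(2,3,1)] blinfun_apply_scaleC cinner_scaleC_left)
    qed
    \<comment> \<open>If all these vectors vanished, every
      \<open>\<tau> (m o\<^sub>L n\<^sup>\<dagger>)\<close> would vanish, although some of them sum
      to the identity. A nonzero vector is needed to see that \<open>z\<close> is positive and not
      merely nonzero.\<close>
    have "\<exists>n\<in>F. \<exists>v. p (R n v) \<noteq> 0"
    proof (rule ccontr)
      assume "\<not> (\<exists>n\<in>F. \<exists>v. p (R n v) \<noteq> 0)"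
      then have "p o\<^sub>L R n = 0" if "n \<in> F" for n using that by (intro blinfun_eqI) simp
      then have "z *\<^sub>C \<tau> (m o\<^sub>L n\<^sup>\<dagger>) = 0" if "m \<in> F" "n \<in> F" for m n using z[OF that] that by simp
      then have "\<tau> (m o\<^sub>L n\<^sup>\<dagger>) = 0" if "m \<in> F" "n \<in> F" for m n using that z0 by simp
      then have "(\<Sum>r<N. \<tau> (a r o\<^sub>L (b r)\<^sup>\<dagger>)) = 0" using ab by simp
      moreover have "(\<Sum>r<N. \<tau> (a r o\<^sub>L (b r)\<^sup>\<dagger>)) = id_blinfun"
        using T.inv_sum[of "{..<N}" "\<lambda>r. a r o\<^sub>L (b r)\<^sup>\<dagger>"] ab F_T1 by (simp add: sum_ab T.inv_id)
      ultimately show False using nontrivial by simp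
    qed
    then obtain n v where n: "n \<in> F" and v: "p (R n v) \<noteq> 0" by blast
    have "psd {()} (\<lambda>_ _. n o\<^sub>L n\<^sup>\<dagger>)"
      unfolding psd_singleton
    proof
      fix w
      have "cinner ((n o\<^sub>L n\<^sup>\<dagger>) w) w = cinner ((n\<^sup>\<dagger>) w) ((n\<^sup>\<dagger>) w)"
        by (simp add: cinner_adj_left F_bops[OF n])
      then show "cinner ((n o\<^sub>L n\<^sup>\<dagger>) w) w \<in> \<real>\<^sub>\<ge>\<^sub>0" by (simp only: cinner_self_nonneg)
    qed
    then have "psd {()} (\<lambda>_ _. \<tau> (n o\<^sub>L n\<^sup>\<dagger>))"
      using F_T1[OF n n] by (intro completely_positive_on_psd[OF T.inv_cp]) auto
    then have g: "cinner (\<tau> (n o\<^sub>L n\<^sup>\<dagger>) v) v \<in> \<real>\<^sub>\<ge>\<^sub>0" by (simp add: psd_singleton)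
    define g where "g = Re (cinner (\<tau> (n o\<^sub>L n\<^sup>\<dagger>) v) v)"
    have gr: "cinner (\<tau> (n o\<^sub>L n\<^sup>\<dagger>) v) v = of_real g" "g \<ge> 0"
      using g by (auto simp: g_def complex_eq_iff complex_nonneg_Reals_iff)
    have "of_real ((norm (p (R n v)))\<^sup>2) = z * of_real g"
      using form[OF S.S_simps(5) n n, of v v] by (simp add: S.map_id gr cinner_self)
    moreover have "g \<noteq> 0" using calculation v by auto
    ultimately have z_eq: "z = of_real ((norm (p (R n v)))\<^sup>2 / g)" by (simp add: field_simps)
    define y where "y = (norm (p (R n v)))\<^sup>2 / g"
    have y: "y > 0" using v gr(2) \<open>g \<noteq> 0\<close> by (simp add: y_def)
    show ?thesis
      unfolding detects_positivity_def
    proof (intro allI impI)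
      fix J :: "(bool \<times> nat) set" and A
      assume fin: "finite J" and A: "\<forall>i\<in>J. \<forall>j\<in>J. A i j \<in> S"
        and pos: "\<forall>x. (\<forall>i. p (x i) = x i) \<longrightarrow> (\<Sum>i\<in>J. \<Sum>j\<in>J. cinner (A i j (x j)) (x i)) \<in> \<real>\<^sub>\<ge>\<^sub>0"
      \<comment> \<open>The additional index runs over the family \<open>a'\<close>; by
        \<open>dec\<close> the adjoints of its members reach every vector of the embedding space, so
        positivity of \<open>B\<close> implies that of the matrix of the
        \<open>\<phi> (A i j)\<close>.\<close>
      define K where "K = J \<times> {..<N'}"
      define B where "B k l = a' (snd k) o\<^sub>L (\<phi> (A (fst k) (fst l)) o\<^sub>L (a' (snd l))\<^sup>\<dagger>)" for k l
      have BT: "B k l \<in> \<psi> ` T" if "k \<in> K" "l \<in> K" for k l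
        using that A ab' by (auto simp: K_def B_def intro!: F_T)
      have "psd K (\<lambda>k l. \<tau> (B k l))"
        unfolding psd_def
      proof
        fix w :: "(bool \<times> nat) \<times> nat \<Rightarrow> 'k"
        \<comment> \<open>A tuple in the range of \<open>p\<close>, chosen so that the form of
          \<open>A\<close> at it is \<open>z\<close> times the form of the matrix of the
          \<open>\<tau> (B k l)\<close> at \<open>w\<close>.\<close>
        define x where "x i = (\<Sum>r<N'. p (R (a' r) (w (i, r))))" for i
        have "p (x i) = x i" for i by (simp add: x_def blinfun.sum_right pp)
        then have "(\<Sum>i\<in>J. \<Sum>j\<in>J. cinner (A i j (x j)) (x i)) \<in> \<real>\<^sub>\<ge>\<^sub>0" using pos by blast
        also have "(\<Sum>i\<in>J. \<Sum>j\<in>J. cinner (A i j (x j)) (x i))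
            = (\<Sum>i\<in>J. \<Sum>j\<in>J. \<Sum>r<N'. \<Sum>r'<N'. cinner (A i j (p (R (a' r') (w (j, r'))))) (p (R (a' r) (w (i, r)))))"
          by (simp only: x_def blinfun.sum_right cinner_sum_left cinner_sum_right)
        also have "\<dots> = (\<Sum>i\<in>J. \<Sum>j\<in>J. \<Sum>r<N'. \<Sum>r'<N'. z * cinner (\<tau> (B (i, r) (j, r')) (w (j, r'))) (w (i, r)))"
          using A ab' by (intro sum.cong refl) (simp add: form B_def)
        also have "\<dots> = (\<Sum>i\<in>J. \<Sum>r<N'. \<Sum>j\<in>J. \<Sum>r'<N'. z * cinner (\<tau> (B (i, r) (j, r')) (w (j, r'))) (w (i, r)))"
          by (intro sum.cong refl sum.swap)
        also have "\<dots> = z * (\<Sum>k\<in>K. \<Sum>l\<in>K. cinner (\<tau> (B k l) (w l)) (w k))"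
          by (simp only: K_def sum.cartesian_product' sum_distrib_left)
        finally have "of_real y * (\<Sum>k\<in>K. \<Sum>l\<in>K. cinner (\<tau> (B k l) (w l)) (w k)) \<in> \<real>\<^sub>\<ge>\<^sub>0"
          by (simp only: z_eq y_def)
        then show "(\<Sum>k\<in>K. \<Sum>l\<in>K. cinner (\<tau> (B k l) (w l)) (w k)) \<in> \<real>\<^sub>\<ge>\<^sub>0"
          using y by (simp add: complex_nonneg_Reals_iff zero_le_mult_iff)
      qed
      then have "psd K (\<lambda>k l. \<psi> (\<tau> (B k l)))"
        using BT fin by (intro completely_positive_on_psd[OF T.map_cp]) (auto simp: K_def T.inv_mem)
      then have B: "psd K B" by (rule psd_cong) (simp add: BT)
      have "psd J (\<lambda>i j. \<phi> (A i j))"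
        unfolding psd_def
      proof
        fix x :: "bool \<times> nat \<Rightarrow> 'c"
        have dec: "\<xi> = (\<Sum>r<N'. ((a' r)\<^sup>\<dagger>) (b' r \<xi>))" for \<xi> :: 'c
        proof -
          have "(\<Sum>r<N'. (a' r)\<^sup>\<dagger> o\<^sub>L b' r) \<xi> = \<xi>" by (simp add: sum_ab')
          then show ?thesis by (simp add: blinfun_sum_apply)
        qed
        have "cinner (\<phi> (A i j) (x j)) (x i)
            = (\<Sum>r<N'. \<Sum>r'<N'. cinner (B (i, r) (j, r') (b' r' (x j))) (b' r (x i)))" for i j
        proof -
          have "cinner (\<phi> (A i j) (x j)) (x i)
              = (\<Sum>r<N'. \<Sum>r'<N'. cinner (\<phi> (A i j) (((a' r')\<^sup>\<dagger>) (b' r' (x j)))) (((a' r)\<^sup>\<dagger>) (b' r (x i))))"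
            by (subst dec[of "x j"], subst dec[of "x i"])
              (simp only: blinfun.sum_right cinner_sum_left cinner_sum_right)
          also have "\<dots> = (\<Sum>r<N'. \<Sum>r'<N'. cinner (B (i, r) (j, r') (b' r' (x j))) (b' r (x i)))"
            using ab' F_bops by (intro sum.cong refl) (simp add: B_def cinner_adj_left)
          finally show ?thesis .
        qed
        then have "(\<Sum>i\<in>J. \<Sum>j\<in>J. cinner (\<phi> (A i j) (x j)) (x i))
            = (\<Sum>i\<in>J. \<Sum>j\<in>J. \<Sum>r<N'. \<Sum>r'<N'. cinner (B (i, r) (j, r') (b' r' (x j))) (b' r (x i)))"
          by simp
        also have "\<dots> = (\<Sum>i\<in>J. \<Sum>r<N'. \<Sum>j\<in>J. \<Sum>r'<N'. cinner (B (i, r) (j, r') (b' r' (x j))) (b' r (x i)))"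
          by (intro sum.cong refl sum.swap)
        also have "\<dots> = (\<Sum>k\<in>K. \<Sum>l\<in>K. cinner (B k l (b' (snd l) (x (fst l)))) (b' (snd k) (x (fst k))))"
          by (simp add: K_def sum.cartesian_product')
        also have "\<dots> \<in> \<real>\<^sub>\<ge>\<^sub>0"
          using B[unfolded psd_def, rule_format, of "\<lambda>k. b' (snd k) (x (fst k))"] .
        finally show "(\<Sum>i\<in>J. \<Sum>j\<in>J. cinner (\<phi> (A i j) (x j)) (x i)) \<in> \<real>\<^sub>\<ge>\<^sub>0" .
      qed
      then have "psd J (\<lambda>i j. \<sigma> (\<phi> (A i j)))"
        using A fin by (intro completely_positive_on_psd[OF S.inv_cp]) auto
      then show "psd J A" by (rule psd_cong) (use A in simp)
    qed
  qed
  obtain z where z: "\<And>m n. m \<in> F \<Longrightarrow> n \<in> F \<Longrightarrow> Q m o\<^sub>L (q o\<^sub>L R n) = z *\<^sub>C \<tau> (m o\<^sub>L n\<^sup>\<dagger>)"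
    using scalar[OF q(1,2) q_comm] by blast
  show ?thesis
  proof (cases "z = 0")
    case False
    then show ?thesis using detects[OF q q_comm z] by blast
  next
    \<comment> \<open>The products with \<open>q\<close> vanish, so the complement keeps the full
      scalar \<open>\<gamma>\<close>.\<close>
    case True
    have "detects_positivity S (id_blinfun - q)"
    proof (rule detects[of "id_blinfun - q" \<gamma>])
      show "id_blinfun - q \<in> bops" "(id_blinfun - q)\<^sup>\<dagger> = id_blinfun - q"
        "(id_blinfun - q) o\<^sub>L (id_blinfun - q) = id_blinfun - q"
        using q by (auto simp: cadjoint_diff compose_simps)
      show "(id_blinfun - q) o\<^sub>L s = s o\<^sub>L (id_blinfun - q)" if "s \<in> S" for s
        using q_comm[OF that] by (simp add: compose_simps)
      show "Q m o\<^sub>L ((id_blinfun - q) o\<^sub>L R n) = \<gamma> *\<^sub>C \<tau> (m o\<^sub>L n\<^sup>\<dagger>)" if "m \<in> F" "n \<in> F" for m n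
        using z[OF that] QR[OF that] True by (simp add: compose_simps)
    qed (rule \<gamma>)
    then show ?thesis by blast
  qed
qed

end

section \<open>Completely isometric restrictions\<close>

lemma tuple_norm_square: "(tuple_norm n x)\<^sup>2 = (\<Sum>i<n. (norm (x i))\<^sup>2)"
  by (simp add: tuple_norm_def L2_set_def sum_nonneg)

lemma tuple_norm_nonneg [simp]: "0 \<le> tuple_norm n x"
  by (simp add: tuple_norm_def)

text \<open>The bound is crude; it ensures that the supremum in \<open>opmat_norm_on\<close> is that
  of a bounded set.\<close>

lemma opmat_apply_bound:
  assumes "tuple_norm n x \<le> 1"
  shows "tuple_norm n (opmat_apply n A x) \<le> (\<Sum>i<n. \<Sum>j<n. norm (A i j))"
proof -
  have x: "norm (x j) \<le> 1" if "j < n" for j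
    using member_le_L2_set[of "{..<n}" j "\<lambda>i. norm (x i)"] assms that by (simp add: tuple_norm_def)
  have "tuple_norm n (opmat_apply n A x) \<le> (\<Sum>i<n. norm (opmat_apply n A x i))"
    unfolding tuple_norm_def by (rule L2_set_le_sum) simp
  also have "\<dots> \<le> (\<Sum>i<n. \<Sum>j<n. norm (A i j))"
  proof (rule sum_mono)
    fix i
    have "norm (opmat_apply n A x i) \<le> (\<Sum>j<n. norm (A i j (x j)))"
      unfolding opmat_apply_def by (rule norm_sum)
    also have "\<dots> \<le> (\<Sum>j<n. norm (A i j))"
    proof (rule sum_mono)
      fix j assume "j \<in> {..<n}"
      then have "norm (A i j) * norm (x j) \<le> norm (A i j) * 1" using x by (intro mult_left_mono) auto
      then show "norm (A i j (x j)) \<le> norm (A i j)" using norm_blinfun[of "A i j" "x j"] by simp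
    qed
    finally show "norm (opmat_apply n A x i) \<le> (\<Sum>j<n. norm (A i j))" .
  qed
  finally show ?thesis .
qed

lemma opmat_norm_bdd:
  "bdd_above ((\<lambda>x. tuple_norm n (opmat_apply n A x)) ` {x. (\<forall>j<n. x j \<in> L) \<and> tuple_norm n x \<le> 1})"
  using opmat_apply_bound by (intro bdd_aboveI) blast

lemma tuple_norm_scale: "tuple_norm n (\<lambda>j. of_real r *\<^sub>C x j) = \<bar>r\<bar> * tuple_norm n x"
  by (simp add: tuple_norm_def norm_scaleC L2_set_right_distrib)

text \<open>Positive if and only if \<open>A\<close> has norm at most \<open>c\<close>.\<close>

definition dilation :: "real \<Rightarrow> (nat \<Rightarrow> nat \<Rightarrow> 'a::chilbert_space \<Rightarrow>\<^sub>L 'a) \<Rightarrow>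
    bool \<times> nat \<Rightarrow> bool \<times> nat \<Rightarrow> 'a \<Rightarrow>\<^sub>L 'a"
  where "dilation c A p q =
    (if fst p = fst q then (if snd p = snd q then of_real c *\<^sub>C id_blinfun else 0)
     else if fst q then A (snd p) (snd q) else (A (snd q) (snd p))\<^sup>\<dagger>)"

text \<open>\<open>True\<close> marks the copy on which \<open>A\<close> acts and
  \<open>False\<close> the copy of its values; the two off-diagonal blocks contribute a number and
  its conjugate.\<close>

lemma dilation_form:
  fixes A :: "nat \<Rightarrow> nat \<Rightarrow> 'a::chilbert_space \<Rightarrow>\<^sub>L 'a"
  assumes A: "\<And>i j. i < n \<Longrightarrow> j < n \<Longrightarrow> A i j \<in> bops"
  shows "(\<Sum>p\<in>UNIV \<times> {..<n}. \<Sum>q\<in>UNIV \<times> {..<n}. cinner (dilation c A p q (x q)) (x p))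
    = of_real (c * (tuple_norm n (\<lambda>i. x (False, i)))\<^sup>2 + c * (tuple_norm n (\<lambda>i. x (True, i)))\<^sup>2
      + 2 * Re (\<Sum>i<n. cinner (opmat_apply n A (\<lambda>j. x (True, j)) i) (x (False, i))))"
proof -
  define w where "w = (\<Sum>i<n. \<Sum>j<n. cinner (A i j (x (True, j))) (x (False, i)))"
  have diag: "(\<Sum>i<n. \<Sum>j<n. cinner (dilation c A (e, i) (e, j) (x (e, j))) (x (e, i)))
      = of_real (c * (tuple_norm n (\<lambda>i. x (e, i)))\<^sup>2)" for e
  proof -
    have "(\<Sum>i<n. \<Sum>j<n. cinner (dilation c A (e, i) (e, j) (x (e, j))) (x (e, i)))
        = (\<Sum>i<n. \<Sum>j<n. if j = i then of_real (c * (norm (x (e, i)))\<^sup>2) else 0)"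
      by (intro sum.cong refl) (auto simp: dilation_def cinner_scaleC_left cinner_self)
    also have "\<dots> = of_real (c * (tuple_norm n (\<lambda>i. x (e, i)))\<^sup>2)"
      by (simp add: tuple_norm_square sum_distrib_left)
    finally show ?thesis .
  qed
  have "(\<Sum>i<n. \<Sum>j<n. cinner (dilation c A (True, i) (False, j) (x (False, j))) (x (True, i)))
      = (\<Sum>i<n. \<Sum>j<n. cnj (cinner (A j i (x (True, i))) (x (False, j))))"
    using A by (intro sum.cong refl) (simp add: dilation_def cnj_cinner cinner_adj_right)
  also have "\<dots> = cnj w" unfolding w_def cnj_sum by (rule sum.swap)
  finally have lower: "(\<Sum>i<n. \<Sum>j<n. cinner (dilation c A (True, i) (False, j) (x (False, j))) (x (True, i))) = cnj w" .
  have upper: "(\<Sum>i<n. \<Sum>j<n. cinner (dilation c A (False, i) (True, j) (x (True, j))) (x (False, i))) = w"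
    by (simp add: dilation_def w_def)
  have w: "(\<Sum>i<n. cinner (opmat_apply n A (\<lambda>j. x (True, j)) i) (x (False, i))) = w"
    by (simp add: w_def opmat_apply_def cinner_sum_left)
  have "(\<Sum>p\<in>UNIV \<times> {..<n}. \<Sum>q\<in>UNIV \<times> {..<n}. cinner (dilation c A p q (x q)) (x p))
      = of_real (c * (tuple_norm n (\<lambda>i. x (False, i)))\<^sup>2) + (w + cnj w)
        + of_real (c * (tuple_norm n (\<lambda>i. x (True, i)))\<^sup>2)"
    by (simp add: sum.cartesian_product' UNIV_bool sum.distrib diag lower upper del: of_real_mult)
  also have "w + cnj w = of_real (2 * Re w)" by (simp add: complex_eq_iff)
  finally show ?thesis unfolding w by (simp add: complex_eq_iff)
qed

text \<open>With \<open>c\<close> the norm of the restriction, Cauchy-Schwarz makes the dilation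
  nonnegative on tuples fixed by \<open>p\<close>. It is then positive on all tuples, which bounds
  the norm on the whole space by \<open>c\<close>.\<close>

lemma detects_positivity_isometric:
  fixes S :: "('a::chilbert_space \<Rightarrow>\<^sub>L 'a) set"
  assumes S: "operator_system S" and p: "p \<in> bops" and det: "detects_positivity S p"
    and comm: "\<And>s. s \<in> S \<Longrightarrow> p o\<^sub>L s = s o\<^sub>L p"
  shows "restriction_completely_isometric S {x. p x = x}"
  unfolding restriction_completely_isometric_def
proof (intro allI impI)
  fix n :: nat and A :: "nat \<Rightarrow> nat \<Rightarrow> 'a \<Rightarrow>\<^sub>L 'a"
  assume AS: "\<forall>i<n. \<forall>j<n. A i j \<in> S"
  define L where "L = {x. p x = x}"
  define c where "c = opmat_norm_on L n A"
  define N where "N x = tuple_norm n (opmat_apply n A x)" for x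
  have Ab: "A i j \<in> bops" if "i < n" "j < n" for i j using AS that operator_systemD(1)[OF S] by blast
  have form: "(\<Sum>p\<in>UNIV \<times> {..<n}. \<Sum>q\<in>UNIV \<times> {..<n}. cinner (dilation c A p q (x q)) (x p))
      = of_real (c * (tuple_norm n (\<lambda>i. x (False, i)))\<^sup>2 + c * (tuple_norm n (\<lambda>i. x (True, i)))\<^sup>2
      + 2 * Re (\<Sum>i<n. cinner (opmat_apply n A (\<lambda>j. x (True, j)) i) (x (False, i))))" for x
    by (rule dilation_form) (rule Ab)
  have c_upper: "N x \<le> c" if "\<forall>j<n. x j \<in> L" "tuple_norm n x \<le> 1" for x
    unfolding c_def N_def opmat_norm_on_def using that by (intro cSUP_upper opmat_norm_bdd) auto
  have zero: "\<forall>j<n. (0 :: 'a) \<in> L" "tuple_norm n (\<lambda>j. 0 :: 'a) \<le> 1"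
    by (auto simp: L_def tuple_norm_def L2_set_def)
  have "0 \<le> N (\<lambda>_. 0)" by (simp add: N_def)
  also have "\<dots> \<le> c" by (rule c_upper) (use zero in auto)
  finally have c0: "0 \<le> c" .
  have hom: "N x \<le> c * tuple_norm n x" if x: "\<forall>j<n. x j \<in> L" for x
  proof (cases "tuple_norm n x = 0")
    case True
    then have "\<forall>j<n. x j = 0" by (simp add: tuple_norm_def L2_set_eq_0_iff)
    then have "N x = 0" by (simp add: N_def opmat_apply_def tuple_norm_def L2_set_eq_0_iff)
    then show ?thesis using True by simp
  next
    case False
    then have pos: "tuple_norm n x > 0" using tuple_norm_nonneg[of n x] by linarith
    define r where "r = 1 / tuple_norm n x"
    define y where "y = (\<lambda>j. of_real r *\<^sub>C x j)"
    have r: "r > 0" using pos by (simp add: r_def)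
    have "tuple_norm n y = r * tuple_norm n x" using r by (simp add: y_def tuple_norm_scale)
    then have "tuple_norm n y = 1" using pos by (simp add: r_def)
    moreover have "\<forall>j<n. y j \<in> L" using x p by (simp add: y_def L_def bopsD)
    ultimately have "N y \<le> c" by (intro c_upper) auto
    have "N y = tuple_norm n (\<lambda>i. of_real r *\<^sub>C opmat_apply n A x i)"
      unfolding N_def tuple_norm_def using Ab
      by (intro L2_set_cong refl) (simp add: opmat_apply_def y_def bopsD scaleC_sum_right)
    then have "N y = r * N x" using r by (simp add: tuple_norm_scale N_def)
    then have "N x = N y * tuple_norm n x" using pos by (simp add: r_def)
    also have "\<dots> \<le> c * tuple_norm n x" using \<open>N y \<le> c\<close> by (intro mult_right_mono) auto
    finally show ?thesis .
  qed
  have "psd (UNIV \<times> {..<n}) (dilation c A)"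
  proof (rule det[unfolded detects_positivity_def, rule_format])
    show "finite (UNIV \<times> {..<n} :: (bool \<times> nat) set)" by simp
    show "dilation c A p q \<in> S" if "p \<in> UNIV \<times> {..<n}" "q \<in> UNIV \<times> {..<n}" for p q
      using that AS operator_systemD(3-6)[OF S] by (auto simp: dilation_def)
    show "(\<Sum>p\<in>UNIV \<times> {..<n}. \<Sum>q\<in>UNIV \<times> {..<n}. cinner (dilation c A p q (x q)) (x p)) \<in> \<real>\<^sub>\<ge>\<^sub>0"
      if x: "\<And>i. p (x i) = x i" for x
    proof -
      define u where "u = (\<lambda>i. x (False, i))"
      define v where "v = (\<lambda>i. x (True, i))"
      define w where "w = (\<Sum>i<n. cinner (opmat_apply n A v i) (u i))"
      have "cmod w \<le> (\<Sum>i<n. \<bar>norm (opmat_apply n A v i)\<bar> * \<bar>norm (u i)\<bar>)"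
        unfolding w_def by (intro sum_norm_le) (simp add: cinner_Cauchy_Schwarz)
      also have "\<dots> \<le> N v * tuple_norm n u"
        unfolding N_def tuple_norm_def by (rule L2_set_mult_ineq)
      also have "\<dots> \<le> (c * tuple_norm n v) * tuple_norm n u"
        by (intro mult_right_mono hom) (auto simp: L_def v_def x)
      finally have "\<bar>Re w\<bar> \<le> c * tuple_norm n v * tuple_norm n u"
        using abs_Re_le_cmod[of w] by linarith
      moreover have "2 * (c * tuple_norm n v * tuple_norm n u) \<le> c * (tuple_norm n u)\<^sup>2 + c * (tuple_norm n v)\<^sup>2"
        using mult_left_mono[OF sum_squares_bound[of "tuple_norm n u" "tuple_norm n v"] c0]
        by (simp add: algebra_simps)
      ultimately have "0 \<le> c * (tuple_norm n u)\<^sup>2 + c * (tuple_norm n v)\<^sup>2 + 2 * Re w" by linarith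
      then show ?thesis
        unfolding form by (simp only: w_def u_def v_def nonneg_Reals_of_real_iff)
    qed
  qed
  then have psd: "0 \<le> c * (tuple_norm n (\<lambda>i. x (False, i)))\<^sup>2 + c * (tuple_norm n (\<lambda>i. x (True, i)))\<^sup>2
      + 2 * Re (\<Sum>i<n. cinner (opmat_apply n A (\<lambda>j. x (True, j)) i) (x (False, i)))" for x
    unfolding psd_def form nonneg_Reals_of_real_iff by blast
  have bound: "N v \<le> c" if v: "tuple_norm n v \<le> 1" for v
  proof -
    \<comment> \<open>The dilation is tested at \<open>v\<close> and \<open>- t\<close> times its
      image. The best choice is \<open>t = 1 / c\<close>; for \<open>c = 0\<close> already
      \<open>t = 1\<close> forces \<open>N v\<close> to vanish.\<close>
    have ineq: "0 \<le> c * (t\<^sup>2 * (N v)\<^sup>2) + c * (tuple_norm n v)\<^sup>2 - 2 * (t * (N v)\<^sup>2)" for t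
    proof -
      define x where "x q = (if fst q then v (snd q) else of_real (- t) *\<^sub>C opmat_apply n A v (snd q))" for q
      have "(tuple_norm n (\<lambda>i. of_real (- t) *\<^sub>C opmat_apply n A v i))\<^sup>2 = t\<^sup>2 * (N v)\<^sup>2"
        unfolding tuple_norm_scale N_def by (simp add: power_mult_distrib)
      moreover have "Re (\<Sum>i<n. cinner (opmat_apply n A v i) (of_real (- t) *\<^sub>C opmat_apply n A v i)) = - (t * (N v)\<^sup>2)"
        unfolding cinner_scaleC_right cinner_self N_def tuple_norm_square
        by (simp add: sum_distrib_left sum_negf flip: of_real_power)
      ultimately show ?thesis using psd[of x] by (simp add: x_def)
    qed
    have V: "(tuple_norm n v)\<^sup>2 \<le> 1" using v by (simp add: power_le_one)
    show ?thesis
    proof (cases "c = 0")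
      case True
      then show ?thesis using ineq[of 1] by (simp add: N_def)
    next
      case False
      then have c: "c > 0" using c0 by simp
      have "(N v)\<^sup>2 \<le> c\<^sup>2 * (tuple_norm n v)\<^sup>2"
        using ineq[of "1 / c"] c by (simp add: field_simps power2_eq_square)
      also have "\<dots> \<le> c\<^sup>2 * 1" using V by (intro mult_left_mono) auto
      finally show ?thesis using c by (intro power2_le_imp_le[of "N v" c]) auto
    qed
  qed
  have "opmat_norm_on UNIV n A \<le> c"
    unfolding opmat_norm_on_def
  proof (rule cSUP_least)
    show "{x. (\<forall>j<n. x j \<in> UNIV) \<and> tuple_norm n x \<le> 1} \<noteq> ({} :: (nat \<Rightarrow> 'a) set)" using zero by blast
  qed (use bound in \<open>simp add: N_def\<close>)
  moreover have "c \<le> opmat_norm_on UNIV n A"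
    unfolding c_def opmat_norm_on_def
  proof (rule cSUP_subset_mono[OF _ opmat_norm_bdd])
    have "(\<lambda>_. 0) \<in> {x. (\<forall>j<n. x j \<in> L) \<and> tuple_norm n x \<le> 1}" using zero by simp
    then show "{x. (\<forall>j<n. x j \<in> L) \<and> tuple_norm n x \<le> 1} \<noteq> {}" by (metis emptyE)
    show "{x. (\<forall>j<n. x j \<in> L) \<and> tuple_norm n x \<le> 1} \<subseteq> {x. (\<forall>j<n. x j \<in> UNIV) \<and> tuple_norm n x \<le> 1}"
      by (intro Collect_mono) simp
  qed (rule order_refl)
  ultimately show "opmat_norm_on {x. p x = x} n A = opmat_norm_on UNIV n A"
    by (simp add: c_def L_def)
qed

text \<open>The orthogonal complement of the fixed vectors is invariant because \<open>S\<close> is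
  selfadjoint, so these vectors form one of the subspaces that irreducible action forbids unless
  they are trivial.\<close>

lemma irreducibly_acting_projection:
  fixes S A :: "('h::fin_dim_chilbert_space \<Rightarrow>\<^sub>L 'h) set"
  assumes S: "operator_system S" and irr: "irreducibly_acting S A" and p: "p \<in> bops"
    and det: "detects_positivity S p" and comm: "\<And>s. s \<in> S \<Longrightarrow> p o\<^sub>L s = s o\<^sub>L p"
  shows "(\<forall>x. p x = x \<longrightarrow> x = 0) \<or> (\<forall>x. p x = x)"
proof -
  define L where "L = {x. p x = x}"
  have "csubspace L"
    by (rule complex_vector.subspaceI) (auto simp: L_def blinfun.add_right bopsD[OF p])
  moreover have "closed L"
    unfolding L_def by (intro closed_Collect_eq continuous_intros)
  moreover have "reduces L S"
    unfolding reduces_def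
  proof (intro ballI conjI)
    have inv: "s x \<in> L" if "s \<in> S" "x \<in> L" for s x
    proof -
      have "p (s x) = s (p x)" using arg_cong[OF comm[OF that(1)], of "\<lambda>f. blinfun_apply f x"] by simp
      then show ?thesis using that by (simp add: L_def)
    qed
    fix s assume s: "s \<in> S"
    show "s ` L \<subseteq> L" using inv s by blast
    show "s ` ortho_complement L \<subseteq> ortho_complement L"
      using inv[OF operator_systemD(4)[OF S s]] operator_systemD(1)[OF S s]
      by (auto simp: ortho_complement_def cinner_adj_left)
  qed
  moreover have "restriction_completely_isometric S L"
    unfolding L_def by (rule detects_positivity_isometric[OF S p det comm])
  ultimately have "L = {0} \<or> L = UNIV" using irr unfolding irreducibly_acting_def by blast
  then show ?thesis by (auto simp: L_def)
qed

section \<open>Irreducible operator algebras\<close>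

text \<open>The vectors are indexed by numbers, so that a repetition counts as a relation; the
  coefficients will be those of a polynomial in an operator.\<close>

lemma ex_linear_relation:
  fixes x :: "nat \<Rightarrow> 'a::fin_dim_chilbert_space"
  shows "\<exists>(n::nat) c. (\<Sum>i\<le>n. c i *\<^sub>C x i) = 0 \<and> (\<exists>i\<le>n. c i \<noteq> 0)"
proof (rule ccontr)
  assume neg: "\<not> ?thesis"
  have indep: "c i = 0" if "(\<Sum>i\<le>n. c i *\<^sub>C x i) = 0" "i \<le> n" for n i and c :: "nat \<Rightarrow> complex"
    using neg that by blast
  have inj: "inj_on x {..n}" for n
  proof (rule inj_onI, rule ccontr)
    fix i j assume ij: "i \<in> {..n}" "j \<in> {..n}" "x i = x j" "i \<noteq> j"
    define c :: "nat \<Rightarrow> complex" where "c k = (if k = i then 1 else if k = j then -1 else 0)" for k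
    have "(\<Sum>k\<le>n. c k *\<^sub>C x k) = (\<Sum>k\<in>{i, j}. c k *\<^sub>C x k)"
      by (rule sum.mono_neutral_right) (use ij in \<open>auto simp: c_def\<close>)
    also have "\<dots> = 0" using ij by (simp add: c_def)
    finally have "c i = 0" using ij by (intro indep) auto
    then show False by (simp add: c_def)
  qed
  have ind: "complex_vector.independent (x ` {..n})" for n
  proof (rule complex_vector.independent_if_scalars_zero)
    fix f y assume f: "(\<Sum>y\<in>x ` {..n}. f y *\<^sub>C y) = 0" and y: "y \<in> x ` {..n}"
    then obtain i where i: "i \<le> n" "y = x i" by auto
    have "(\<Sum>i\<le>n. f (x i) *\<^sub>C x i) = 0" using f by (simp add: sum.reindex[OF inj])
    then show "f y = 0" using indep[where c = "\<lambda>i. f (x i)" and n = n and i = i] i by simp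
  qed simp
  obtain B :: "'a set" where B: "finite B" "cspan B = UNIV"
  proof -
    have "y \<in> cspan onb" for y :: 'a
      by (subst onb(3)) (intro complex_vector.span_sum complex_vector.span_scale complex_vector.span_base)
    then show thesis using that[of onb] by auto
  qed
  have "card (x ` {..card B}) \<le> card B"
    using complex_vector.independent_span_bound[OF B(1) ind] B(2) by blast
  then show False by (simp add: card_image[OF inj])
qed

text \<open>A nonzero polynomial in \<open>f\<close> of least degree that annihilates
  \<open>u\<close> has a root \<open>z\<close>. Dividing by the linear factor leaves a vector of
  \<open>U\<close> that is nonzero by minimality and is an eigenvector for \<open>z\<close>.\<close>

lemma ex_eigenvector:
  fixes f :: "'a::fin_dim_chilbert_space \<Rightarrow>\<^sub>L 'a"
  assumes f: "f \<in> bops" and U: "csubspace U" and inv: "\<And>x. x \<in> U \<Longrightarrow> f x \<in> U"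
    and u: "u \<in> U" "u \<noteq> 0"
  shows "\<exists>\<mu> w. w \<in> U \<and> w \<noteq> 0 \<and> f w = \<mu> *\<^sub>C w"
proof -
  define E where "E p = (\<Sum>i\<le>degree p. coeff p i *\<^sub>C ((blinfun_apply f) ^^ i) u)" for p :: "complex poly"
  have E_upto: "E p = (\<Sum>i\<le>n. coeff p i *\<^sub>C ((blinfun_apply f) ^^ i) u)" if "degree p \<le> n" for p n
    unfolding E_def by (rule sum.mono_neutral_left) (use that in \<open>auto simp: coeff_eq_0\<close>)
  have pow_U: "((blinfun_apply f) ^^ i) u \<in> U" for i by (induction i) (auto simp: u inv)
  have E_U: "E p \<in> U" for p
    unfolding E_def by (intro complex_vector.subspace_sum[OF U] complex_vector.subspace_scale[OF U] pow_U)
  obtain n :: nat and c where c: "(\<Sum>i\<le>n. c i *\<^sub>C ((blinfun_apply f) ^^ i) u) = 0" "\<exists>i\<le>n. c i \<noteq> 0"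
    using ex_linear_relation[of "\<lambda>i. ((blinfun_apply f) ^^ i) u"] by blast
  define p0 where "p0 = (\<Sum>i\<le>n. monom (c i) i)"
  have coeff_p0: "coeff p0 i = (if i \<le> n then c i else 0)" for i
    by (simp add: p0_def coeff_sum)
  have "p0 \<noteq> 0" using c(2) coeff_p0 by (metis coeff_0)
  moreover have "E p0 = 0"
    using c(1) E_upto[of p0 n] by (simp add: coeff_p0 degree_le)
  ultimately obtain p where p: "p \<noteq> 0 \<and> E p = 0" and min: "\<And>q. q \<noteq> 0 \<and> E q = 0 \<Longrightarrow> degree p \<le> degree q"
    using ex_has_least_nat[of "\<lambda>p. p \<noteq> 0 \<and> E p = 0" p0 degree] by blast
  have "degree p \<noteq> 0"
  proof
    assume "degree p = 0"
    then have "coeff p 0 *\<^sub>C u = 0" "coeff p 0 \<noteq> 0"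
      using p leading_coeff_0_iff[of p] by (auto simp: E_def)
    then show False using u by simp
  qed
  then obtain z where z: "poly p z = 0"
    using fundamental_theorem_of_algebra[of p] by (auto simp: constant_degree)
  then obtain r where r: "p = [:- z, 1:] * r" by (auto simp: poly_eq_0_iff_dvd elim: dvdE)
  have r0: "r \<noteq> 0" using p r by auto
  have deg: "degree p = Suc (degree r)" unfolding r using r0 by (subst degree_mult_eq) auto
  have "E p = f (E r) - z *\<^sub>C E r"
  proof -
    \<comment> \<open>Multiplication by the variable shifts the coefficients by one place, which on
      the orbit of \<open>u\<close> is one application of \<open>f\<close>.\<close>
    have coeff_p: "coeff p i = (case i of 0 \<Rightarrow> 0 | Suc j \<Rightarrow> coeff r j) - z * coeff r i" for i
      by (simp add: r coeff_pCons split: nat.split)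
    have "E p = (\<Sum>i\<le>Suc (degree r). coeff p i *\<^sub>C ((blinfun_apply f) ^^ i) u)"
      by (rule E_upto) (simp add: deg)
    also have "\<dots> = (\<Sum>i\<le>Suc (degree r). (case i of 0 \<Rightarrow> 0 | Suc j \<Rightarrow> coeff r j) *\<^sub>C ((blinfun_apply f) ^^ i) u)
        - z *\<^sub>C (\<Sum>i\<le>Suc (degree r). coeff r i *\<^sub>C ((blinfun_apply f) ^^ i) u)"
      by (simp only: coeff_p complex_vector.scale_left_diff_distrib sum_subtractf scaleC_sum_right scaleC_scaleC)
    also have "(\<Sum>i\<le>Suc (degree r). coeff r i *\<^sub>C ((blinfun_apply f) ^^ i) u) = E r"
      by (rule E_upto[symmetric]) simp
    also have "(\<Sum>i\<le>Suc (degree r). (case i of 0 \<Rightarrow> 0 | Suc j \<Rightarrow> coeff r j) *\<^sub>C ((blinfun_apply f) ^^ i) u) = f (E r)"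
      unfolding sum.atMost_Suc_shift E_def by (simp add: bops_apply_sum[OF f])
    finally show ?thesis .
  qed
  moreover have "E r \<noteq> 0" using min[of r] r0 deg by auto
  ultimately show ?thesis using p E_U[of r] by (intro exI[of _ z] exI[of _ "E r"]) auto
qed

text \<open>This is the dimension of a subspace; measured by orthonormal sets, it grows along a
  proper inclusion by a single Gram-Schmidt step.\<close>

definition orthonormal_dim :: "'a::fin_dim_chilbert_space set \<Rightarrow> nat"
  where "orthonormal_dim L = Max (card ` {B. finite B \<and> orthonormal B \<and> B \<subseteq> L})"

lemma orthonormal_dim_finite: "finite (card ` {B :: 'a::fin_dim_chilbert_space set. finite B \<and> orthonormal B \<and> B \<subseteq> L})"
proof -
  obtain n where "\<forall>B :: 'a set. orthonormal B \<longrightarrow> finite B \<longrightarrow> card B \<le> n"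
    using orthonormal_card_bound by blast
  then have "card ` {B :: 'a set. finite B \<and> orthonormal B \<and> B \<subseteq> L} \<subseteq> {..n}" by auto
  then show ?thesis by (rule finite_subset) simp
qed

lemma orthonormal_dim_strict_mono:
  assumes L: "csubspace L" and L': "csubspace L'" and sub: "L' \<subset> L"
  shows "orthonormal_dim L' < orthonormal_dim L"
proof -
  have "orthonormal_dim L' \<in> card ` {B. finite B \<and> orthonormal B \<and> B \<subseteq> L'}"
    unfolding orthonormal_dim_def
    by (rule Max_in[OF orthonormal_dim_finite]) (auto intro!: exI[of _ "{}"] simp: orthonormal_def)
  then obtain B where B: "finite B" "orthonormal B" "B \<subseteq> L'" "orthonormal_dim L' = card B" by auto
  obtain y where y: "y \<in> L" "y \<notin> L'" using sub by blast
  have "(\<Sum>b\<in>B. cinner y b *\<^sub>C b) \<in> L'"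
    using B(3) by (intro complex_vector.subspace_sum[OF L'] complex_vector.subspace_scale[OF L']) auto
  then have "y \<noteq> (\<Sum>b\<in>B. cinner y b *\<^sub>C b)" using y by auto
  moreover have "B \<subseteq> L" using B(3) sub by blast
  ultimately obtain v where v: "v \<in> L" "v \<notin> B" "orthonormal (insert v B)"
    using orthonormal_extend[OF L B(1,2) _ y(1)] by blast
  then have "finite (insert v B) \<and> orthonormal (insert v B) \<and> insert v B \<subseteq> L"
    using B(1) \<open>B \<subseteq> L\<close> by simp
  then have "card (insert v B) \<le> orthonormal_dim L"
    unfolding orthonormal_dim_def by (intro Max_ge[OF orthonormal_dim_finite]) blast
  then show ?thesis using B v(2) by simp
qed

lemma orthonormal_dim_bound: "\<exists>n. \<forall>L :: 'a::fin_dim_chilbert_space set. orthonormal_dim L \<le> n"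
proof -
  obtain n where n: "\<forall>B :: 'a set. orthonormal B \<longrightarrow> finite B \<longrightarrow> card B \<le> n"
    using orthonormal_card_bound by blast
  have "orthonormal_dim L \<le> n" for L :: "'a set"
    unfolding orthonormal_dim_def
    by (rule Max.boundedI[OF orthonormal_dim_finite]) (use n in \<open>auto intro!: exI[of _ "{}"] simp: orthonormal_def\<close>)
  then show ?thesis by blast
qed

text \<open>For the orthogonal projection \<open>q\<close>, invariance says that
  \<open>q o\<^sub>L c o\<^sub>L q\<close> equals \<open>c o\<^sub>L q\<close>. The same for the
  adjoint of \<open>c\<close> gives, after taking adjoints, that it equals
  \<open>q o\<^sub>L c\<close>.\<close>

lemma invariant_subspace_projection:
  fixes C :: "('a::fin_dim_chilbert_space \<Rightarrow>\<^sub>L 'a) set"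
  assumes C: "C \<subseteq> bops" "\<And>c. c \<in> C \<Longrightarrow> c\<^sup>\<dagger> \<in> C" and L: "csubspace L"
    and inv: "\<And>c x. c \<in> C \<Longrightarrow> x \<in> L \<Longrightarrow> c x \<in> L"
  shows "\<exists>q\<in>bops. q\<^sup>\<dagger> = q \<and> q o\<^sub>L q = q \<and> (\<forall>c\<in>C. q o\<^sub>L c = c o\<^sub>L q) \<and> L = {x. q x = x}"
proof -
  obtain B where B: "finite B" "orthonormal B" "B \<subseteq> L" "\<And>x. x \<in> L \<Longrightarrow> x = (\<Sum>b\<in>B. cinner x b *\<^sub>C b)"
    using orthonormal_basis_exists[OF L] by blast
  define q where "q = (\<Sum>b\<in>B. ketbra b b)"
  have qb: "q \<in> bops" unfolding q_def by (intro bops_sum ketbra_bops)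
  have q_apply: "q x = (\<Sum>b\<in>B. cinner x b *\<^sub>C b)" for x by (simp add: q_def blinfun_sum_apply)
  have qL: "q x \<in> L" for x
    unfolding q_apply using B(3) by (intro complex_vector.subspace_sum[OF L] complex_vector.subspace_scale[OF L]) auto
  have q_fix: "q x = x" if "x \<in> L" for x using B(4)[OF that] by (simp add: q_apply)
  have q_adj: "q\<^sup>\<dagger> = q"
    by (rule cadjoint_eqI)
      (simp add: q_apply cinner_sum_left cinner_sum_right cinner_scaleC_left cinner_scaleC_right cnj_cinner mult.commute)
  have cq: "q (c (q x)) = c (q x)" if "c \<in> C" for c x using inv[OF that qL] by (rule q_fix)
  have "q o\<^sub>L c = c o\<^sub>L q" if c: "c \<in> C" for c
  proof -
    have cb: "c \<in> bops" using c C by blast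
    have 1: "q o\<^sub>L c o\<^sub>L q = c o\<^sub>L q" if "c \<in> C" for c by (rule blinfun_eqI) (simp add: cq[OF that])
    have "(q o\<^sub>L c\<^sup>\<dagger> o\<^sub>L q)\<^sup>\<dagger> = q o\<^sub>L c o\<^sub>L q"
      using qb cb by (simp add: cadjoint_compose bops_compose cadjoint_bops q_adj blinfun_compose_assoc)
    moreover have "(c\<^sup>\<dagger> o\<^sub>L q)\<^sup>\<dagger> = q o\<^sub>L c" using qb cb by (simp add: cadjoint_compose cadjoint_bops q_adj)
    ultimately show ?thesis using 1[OF C(2)[OF c]] 1[OF c] by simp
  qed
  moreover have "L = {x. q x = x}" using q_fix qL by (metis (mono_tags, lifting) Collect_cong Collect_mem_eq)
  moreover have "q o\<^sub>L q = q" by (rule blinfun_eqI) (simp add: q_fix qL)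
  ultimately show ?thesis using qb q_adj by blast
qed

text \<open>Burnside's theorem. A nonzero operator \<open>a\<close> of the algebra with maximal kernel satisfies
  \<open>a b a = \<mu> a\<close>, because subtracting an eigenvalue of \<open>a b\<close> on the range of \<open>a\<close> enlarges the
  kernel; hence it has rank one.\<close>

lemma burnside:
  fixes C :: "('a::fin_dim_chilbert_space \<Rightarrow>\<^sub>L 'a) set"
  assumes C: "C \<subseteq> bops" "csubspace C" "\<And>a b. a \<in> C \<Longrightarrow> b \<in> C \<Longrightarrow> a o\<^sub>L b \<in> C"
      "\<And>c. c \<in> C \<Longrightarrow> c\<^sup>\<dagger> \<in> C" "id_blinfun \<in> C"
    and irr: "\<And>L. csubspace L \<Longrightarrow> (\<And>c x. c \<in> C \<Longrightarrow> x \<in> L \<Longrightarrow> blinfun_apply c x \<in> L) \<Longrightarrow> L = {0} \<or> L = UNIV"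
  shows "bops \<subseteq> C"
proof (cases "(id_blinfun :: 'a \<Rightarrow>\<^sub>L 'a) = 0")
  case True
  have "x = 0" for x :: "'a \<Rightarrow>\<^sub>L 'a"
    by (rule blinfun_eqI) (metis True blinfun.zero_left blinfun.zero_right id_blinfun.rep_eq)
  then show ?thesis using complex_vector.subspace_0[OF C(2)] by (metis subsetI)
next
  case nontrivial: False
  have Cb: "c \<in> bops" if "c \<in> C" for c using C(1) that by blast
  define ker where "ker a = {x :: 'a. blinfun_apply a x = 0}" for a :: "'a \<Rightarrow>\<^sub>L 'a"
  have ker: "csubspace (ker a)" if "a \<in> C" for a
    using Cb[OF that] by (intro complex_vector.subspaceI) (auto simp: ker_def blinfun.add_right bopsD)
  obtain n where n: "\<And>L :: 'a set. orthonormal_dim L \<le> n" using orthonormal_dim_bound by blast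
  obtain a where a: "a \<in> C \<and> a \<noteq> 0" and max: "\<And>b. b \<in> C \<and> b \<noteq> 0 \<Longrightarrow> orthonormal_dim (ker b) \<le> orthonormal_dim (ker a)"
  proof -
    have "\<exists>a. (a \<in> C \<and> a \<noteq> 0) \<and> (\<forall>b. b \<in> C \<and> b \<noteq> 0 \<longrightarrow> orthonormal_dim (ker b) \<le> orthonormal_dim (ker a))"
      by (rule ex_has_greatest_nat[of _ id_blinfun _ "Suc n"]) (use C(5) nontrivial n in \<open>auto simp: less_Suc_eq_le\<close>)
    then show thesis using that by blast
  qed
  have ab: "a \<in> bops" using a Cb by blast
  obtain v0 where v0: "a v0 \<noteq> 0" using a blinfun_eqI[of a 0] by auto
  have aba: "\<exists>\<mu>. a o\<^sub>L b o\<^sub>L a = \<mu> *\<^sub>C a" if b: "b \<in> C" for b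
  proof -
    have bb: "b \<in> bops" using b Cb by blast
    define U where "U = range (blinfun_apply a)"
    have U: "csubspace U"
      unfolding U_def
    proof (rule complex_vector.subspaceI)
      show "0 \<in> range (blinfun_apply a)" by (metis blinfun.zero_right rangeI)
      show "x + y \<in> range (blinfun_apply a)" if "x \<in> range (blinfun_apply a)" "y \<in> range (blinfun_apply a)" for x y
        using that by (metis (no_types, lifting) blinfun.add_right rangeE rangeI)
      show "c *\<^sub>C x \<in> range (blinfun_apply a)" if "x \<in> range (blinfun_apply a)" for c x
        using that by (metis (no_types, lifting) bopsD[OF ab] rangeE rangeI)
    qed
    obtain \<mu> w where w: "w \<in> U" "w \<noteq> 0" "(a o\<^sub>L b) w = \<mu> *\<^sub>C w"
      using ex_eigenvector[OF bops_compose[OF ab bb] U _ _ v0] by (auto simp: U_def)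
    obtain v where v: "w = a v" using w by (auto simp: U_def)
    define a' where "a' = (a o\<^sub>L b o\<^sub>L a) - \<mu> *\<^sub>C a"
    have a'C: "a' \<in> C"
      unfolding a'_def using a b
      by (intro complex_vector.subspace_diff[OF C(2)] complex_vector.subspace_scale[OF C(2)] C(3)) auto
    have "a' = 0"
    proof (rule ccontr)
      assume "a' \<noteq> 0"
      have "ker a \<subseteq> ker a'" by (auto simp: ker_def a'_def blinfun.diff_left)
      moreover have "v \<in> ker a'" "v \<notin> ker a" using w v by (auto simp: ker_def a'_def blinfun.diff_left)
      ultimately have "ker a \<subset> ker a'" by blast
      then have "orthonormal_dim (ker a) < orthonormal_dim (ker a')"
        using ker a a'C by (intro orthonormal_dim_strict_mono) auto
      then show False using max[of a'] a'C \<open>a' \<noteq> 0\<close> by simp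
    qed
    then show ?thesis by (auto simp: a'_def)
  qed
  \<comment> \<open>The orbit of \<open>w\<close> under \<open>C\<close> is an invariant subspace
    that contains \<open>w\<close>, hence the whole space.\<close>
  have transitive: "\<exists>b\<in>C. b w = v" if w: "w \<noteq> 0" for v w
  proof -
    define L where "L = (\<lambda>b. blinfun_apply b w) ` C"
    have "csubspace L"
      unfolding L_def
    proof (rule complex_vector.subspaceI)
      show "0 \<in> (\<lambda>b. blinfun_apply b w) ` C"
        using complex_vector.subspace_0[OF C(2)] by (intro image_eqI[of _ _ 0]) auto
      show "x + y \<in> (\<lambda>b. blinfun_apply b w) ` C"
        if xy: "x \<in> (\<lambda>b. blinfun_apply b w) ` C" "y \<in> (\<lambda>b. blinfun_apply b w) ` C" for x y
      proof -
        obtain f g where "f \<in> C" "g \<in> C" "x = f w" "y = g w" using xy by auto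
        then show ?thesis
          using complex_vector.subspace_add[OF C(2)] by (intro image_eqI[of _ _ "f + g"]) (auto simp: blinfun.add_left)
      qed
      show "c *\<^sub>C x \<in> (\<lambda>b. blinfun_apply b w) ` C" if x: "x \<in> (\<lambda>b. blinfun_apply b w) ` C" for c x
      proof -
        obtain f where "f \<in> C" "x = f w" using x by auto
        then show ?thesis
          using complex_vector.subspace_scale[OF C(2)] by (intro image_eqI[of _ _ "c *\<^sub>C f"]) auto
      qed
    qed
    moreover have "c x \<in> L" if c: "c \<in> C" and x: "x \<in> L" for c x
    proof -
      obtain f where "f \<in> C" "x = f w" using x by (auto simp: L_def)
      then show ?thesis unfolding L_def using C(3)[OF c] by (intro image_eqI[of _ _ "c o\<^sub>L f"]) auto
    qed
    ultimately have "L = {0} \<or> L = UNIV" by (rule irr)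
    moreover have "w \<in> L" unfolding L_def using C(5) by (intro image_eqI[of _ _ id_blinfun]) auto
    ultimately have "L = UNIV" using w by auto
    then show ?thesis unfolding L_def by (metis UNIV_I imageE)
  qed
  define w where "w = a v0"
  have w: "w \<noteq> 0" using v0 by (simp add: w_def)
  \<comment> \<open>The range of \<open>a\<close> is spanned by \<open>w\<close>, and
    \<open>y\<close> represents the functional that gives the coefficient of \<open>a v\<close>
    along \<open>w\<close>.\<close>
  define y where "y = of_real (inverse ((norm w)\<^sup>2)) *\<^sub>C (a\<^sup>\<dagger>) w"
  have a_eq: "a = ketbra w y"
  proof (rule blinfun_eqI)
    fix v
    obtain b where b: "b \<in> C" "b w = v" using transitive[OF w] by blast
    obtain \<mu> where "a o\<^sub>L b o\<^sub>L a = \<mu> *\<^sub>C a" using aba[OF b(1)] by blast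
    then have "(a o\<^sub>L b o\<^sub>L a) v0 = (\<mu> *\<^sub>C a) v0" by simp
    then have av: "a v = \<mu> *\<^sub>C w" using b by (simp add: w_def)
    have "cinner v y = inverse (of_real ((norm w)\<^sup>2)) * cinner (a v) w"
      unfolding y_def cinner_scaleC_right cinner_adj_left[OF ab] by simp
    also have "\<dots> = \<mu>" using w by (simp add: av cinner_scaleC_left cinner_self)
    finally show "a v = ketbra w y v" by (simp add: av)
  qed
  have y: "y \<noteq> 0" using a a_eq by (auto intro: blinfun_eqI)
  have "ketbra x z \<in> C" for x z
  proof -
    obtain b where b: "b \<in> C" "b w = x" using transitive[OF w] by blast
    obtain b' where b': "b' \<in> C" "b' y = z" using transitive[OF y] by blast
    \<comment> \<open>\<open>w\<close> is moved to \<open>x\<close> by an element of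
      \<open>C\<close> on the left, and \<open>y\<close> to \<open>z\<close> by the adjoint of an
      element of \<open>C\<close> on the right.\<close>
    have "ketbra x z = b o\<^sub>L a o\<^sub>L b'\<^sup>\<dagger>"
    proof (rule blinfun_eqI)
      fix v
      have "cinner ((b'\<^sup>\<dagger>) v) y = cinner v z"
        unfolding b'(2)[symmetric] by (rule cinner_adj_right[OF Cb[OF b'(1)], symmetric])
      then show "ketbra x z v = (b o\<^sub>L a o\<^sub>L b'\<^sup>\<dagger>) v"
        using b Cb by (simp add: a_eq bopsD)
    qed
    then show ?thesis using a b b' C by simp
  qed
  then have sums: "(\<Sum>e\<in>onb. \<Sum>d\<in>onb. cinner (blinfun_apply f e) d *\<^sub>C ketbra d e) \<in> C" for f :: "'a \<Rightarrow>\<^sub>L 'a"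
    by (intro complex_vector.subspace_sum[OF C(2)] complex_vector.subspace_scale[OF C(2)])
  show ?thesis
  proof
    fix f :: "'a \<Rightarrow>\<^sub>L 'a" assume f: "f \<in> bops"
    show "f \<in> C" by (subst bops_expand[OF f]) (rule sums)
  qed
qed

section \<open>Finite-dimensional subspaces are closed\<close>

lemma norm_scaleC_blinfun: "norm (c *\<^sub>C f) = cmod c * norm (f :: 'a::chilbert_space \<Rightarrow>\<^sub>L 'b::chilbert_space)"
proof (cases "c = 0")
  case False
  have "norm f = norm (inverse c *\<^sub>C c *\<^sub>C f)" using False by (simp add: scaleC_scaleC)
  also have "\<dots> \<le> cmod (inverse c) * norm (c *\<^sub>C f)" by (rule norm_scaleC_blinfun_le)
  finally have "cmod c * norm f \<le> cmod c * (cmod (inverse c) * norm (c *\<^sub>C f))" by (intro mult_left_mono) auto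
  also have "\<dots> = norm (c *\<^sub>C f)" using False by (simp add: norm_inverse)
  finally have "cmod c * norm f \<le> norm (c *\<^sub>C f)" .
  then show ?thesis using norm_scaleC_blinfun_le[of c f] by simp
qed simp

text \<open>The ambient operator space may be infinite-dimensional. If \<open>v\<close> has distance
  \<open>d > 0\<close> from the closed span of the others, its coefficient is bounded by the norm
  divided by \<open>d\<close>; so the coefficients along a convergent sequence converge, and the
  remainders converge inside that closed span.\<close>

lemma closed_cspan_finite:
  fixes B :: "('a::chilbert_space \<Rightarrow>\<^sub>L 'b::chilbert_space) set"
  assumes "finite B"
  shows "closed (cspan B)"
  using assms
proof (induction B rule: finite_induct)
  case (insert v B)
  show ?case
  proof (cases "v \<in> cspan B")
    case True
    then show ?thesis using insert.IH by (simp add: complex_vector.span_redundant)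
  next
    case v: False
    define W where "W = cspan B"
    have W: "csubspace W" "closed W" "v \<notin> W" using insert.IH v by (simp_all add: W_def)
    define d where "d = infdist v W"
    have Wne: "W \<noteq> {}" using complex_vector.subspace_0[OF W(1)] by blast
    have d: "d > 0"
      using in_closed_iff_infdist_zero[OF W(2) Wne, of v] W(3) infdist_nonneg[of v W] unfolding d_def by linarith
    have coeff_bound: "cmod k * d \<le> norm (k *\<^sub>C v + w)" if w: "w \<in> W" for k w
    proof (cases "k = 0")
      case False
      have "d \<le> dist v ((- inverse k) *\<^sub>C w)"
        unfolding d_def using w by (intro infdist_le complex_vector.subspace_scale[OF W(1)])
      also have "\<dots> = norm (v + inverse k *\<^sub>C w)" by (simp add: dist_norm)
      finally have "cmod k * d \<le> norm (k *\<^sub>C (v + inverse k *\<^sub>C w))"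
        by (simp add: norm_scaleC_blinfun mult_left_mono)
      then show ?thesis using False by (simp add: scaleC_add_right scaleC_scaleC)
    qed simp
    show ?thesis
      unfolding closed_sequential_limits
    proof (intro allI impI)
      fix X l assume X: "(\<forall>n. X n \<in> cspan (insert v B)) \<and> X \<longlonglongrightarrow> l"
      have "\<exists>k. X n - k *\<^sub>C v \<in> W" for n
        using X unfolding W_def complex_vector.span_insert by blast
      then obtain k where k: "\<And>n. X n - k n *\<^sub>C v \<in> W" by metis
      have diff: "cmod (k m - k n) * d \<le> norm (X m - X n)" for m n
      proof -
        have "(X m - k m *\<^sub>C v) - (X n - k n *\<^sub>C v) \<in> W" by (rule complex_vector.subspace_diff[OF W(1) k k])
        from coeff_bound[OF this, of "k m - k n"] show ?thesis
          by (simp add: complex_vector.scale_left_diff_distrib algebra_simps)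
      qed
      have "Cauchy X" using X LIMSEQ_imp_Cauchy by blast
      have "Cauchy k"
      proof (rule metric_CauchyI)
        fix e :: real assume "e > 0"
        then have "e * d > 0" using d by simp
        from metric_CauchyD[OF \<open>Cauchy X\<close> this] obtain M where M: "\<forall>m\<ge>M. \<forall>n\<ge>M. dist (X m) (X n) < e * d" by blast
        have "dist (k m) (k n) < e" if "m \<ge> M" "n \<ge> M" for m n
        proof -
          have "dist (k m) (k n) * d < e * d" using diff[of m n] M that by (force simp: dist_norm)
          then show ?thesis using d by simp
        qed
        then show "\<exists>M. \<forall>m\<ge>M. \<forall>n\<ge>M. dist (k m) (k n) < e" by blast
      qed
      then obtain c where c: "k \<longlonglongrightarrow> c" unfolding Cauchy_convergent_iff convergent_def by (elim exE)
      have "(\<lambda>n. (k n - c) *\<^sub>C v) \<longlonglongrightarrow> 0"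
        by (rule tendsto_scaleC_blinfun_zero) (use c in \<open>simp add: LIM_zero\<close>)
      then have "(\<lambda>n. X n - c *\<^sub>C v - (k n - c) *\<^sub>C v) \<longlonglongrightarrow> l - c *\<^sub>C v - 0"
        using X by (intro tendsto_intros) auto
      moreover have "X n - c *\<^sub>C v - (k n - c) *\<^sub>C v \<in> W" for n
        using k[of n] by (simp add: complex_vector.scale_left_diff_distrib)
      ultimately have "l - c *\<^sub>C v \<in> W"
        using W(2) unfolding closed_sequential_limits by fastforce
      then show "l \<in> cspan (insert v B)" unfolding W_def complex_vector.span_insert by blast
    qed
  qed
qed simp

lemma closed_subspace_of_finite_span:
  fixes W :: "('a::chilbert_space \<Rightarrow>\<^sub>L 'b::chilbert_space) set"
  assumes W: "csubspace W" and B: "finite B" "W \<subseteq> cspan B"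
  shows "closed W"
proof -
  obtain B0 where B0: "B0 \<subseteq> W" "complex_vector.independent B0" "W \<subseteq> cspan B0"
    using complex_vector.maximal_independent_subset by blast
  have "finite B0" using complex_vector.independent_span_bound[OF B(1) B0(2)] B0(1) B(2) by blast
  moreover have "W = cspan B0" using B0 complex_vector.span_minimal[OF B0(1) W] by blast
  ultimately show ?thesis using closed_cspan_finite by simp
qed

text \<open>\<open>\<phi>\<close> is linear on \<open>S\<close> only, so the spanning set is first
  replaced by an independent set inside \<open>S\<close>.\<close>

lemma (in order_embedding) image_finite_span:
  assumes "finite B" "S \<subseteq> cspan B"
  shows "\<exists>B'. finite B' \<and> \<phi> ` S \<subseteq> cspan B'"
proof -
  obtain B0 where B0: "B0 \<subseteq> S" "complex_vector.independent B0" "S \<subseteq> cspan B0"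
    using complex_vector.maximal_independent_subset by blast
  have fin: "finite B0" using complex_vector.independent_span_bound[OF assms(1) B0(2)] B0(1) assms(2) by blast
  define D where "D = {s \<in> S. \<phi> s \<in> cspan (\<phi> ` B0)}"
  have "csubspace D"
    by (rule complex_vector.subspaceI)
      (auto simp: D_def S_simps map_zero map_add map_scale complex_vector.span_zero
        intro: complex_vector.span_add complex_vector.span_scale)
  moreover have "B0 \<subseteq> D" using B0(1) by (auto simp: D_def intro: complex_vector.span_base)
  ultimately have "cspan B0 \<subseteq> D" by (intro complex_vector.span_minimal)
  then have "\<phi> ` S \<subseteq> cspan (\<phi> ` B0)" using B0(3) by (auto simp: D_def)
  then show ?thesis using fin by blast
qed

lemma bops_finite_span:
  "\<exists>B. finite B \<and> (bops :: ('a::fin_dim_chilbert_space \<Rightarrow>\<^sub>L 'a) set) \<subseteq> cspan B"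
proof -
  define B :: "('a \<Rightarrow>\<^sub>L 'a) set" where "B = (\<lambda>(d, e). ketbra d e) ` (onb \<times> onb)"
  have "f \<in> cspan B" if f: "f \<in> bops" for f :: "'a \<Rightarrow>\<^sub>L 'a"
    by (subst bops_expand[OF f])
      (intro complex_vector.span_sum complex_vector.span_scale complex_vector.span_base, auto simp: B_def)
  then show ?thesis by (intro exI[of _ B]) (auto simp: B_def)
qed

text \<open>Applied to the products of the ternary ring, this removes the closure from
  non-degeneracy: the identity becomes a finite combination of products.\<close>

lemma (in order_embedding) image_subset_closed_cspan:
  fixes B :: "('a \<Rightarrow>\<^sub>L 'a) set"
  assumes "finite B" "S \<subseteq> cspan B" "X \<subseteq> \<phi> ` S"
  shows "closed_cspan X = cspan X"
proof -
  obtain B' where B': "finite B'" "\<phi> ` S \<subseteq> cspan B'" using image_finite_span[OF assms(1,2)] by blast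
  have "cspan X \<subseteq> cspan B'"
    using assms(3) B'(2) by (intro complex_vector.span_minimal) auto
  then have "closed (cspan X)" using closed_subspace_of_finite_span B'(1) by blast
  then show ?thesis by (simp add: closed_cspan_def)
qed

text \<open>The coefficients of a linear combination are absorbed into the factors. A general
  \<open>f\<close> serves both kinds of products, with the adjoint on the left or on the
  right.\<close>

lemma cspan_products:
  assumes x: "x \<in> cspan {f m n | m n. m \<in> M \<and> n \<in> M}"
    and scale: "\<And>c m n. m \<in> M \<Longrightarrow> n \<in> M \<Longrightarrow> \<exists>m'\<in>M. \<exists>n'\<in>M. c *\<^sub>C f m n = f m' n'"
  shows "\<exists>(N::nat) a b. (\<forall>r<N. a r \<in> M \<and> b r \<in> M) \<and> x = (\<Sum>r<N. f (a r) (b r))"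
proof -
  obtain t c where t: "finite t" "t \<subseteq> {f m n | m n. m \<in> M \<and> n \<in> M}" "x = (\<Sum>y\<in>t. c y *\<^sub>C y)"
    using x unfolding complex_vector.span_explicit by blast
  have "\<exists>m n. m \<in> M \<and> n \<in> M \<and> c y *\<^sub>C y = f m n" if y: "y \<in> t" for y
  proof -
    obtain m n where "m \<in> M" "n \<in> M" "y = f m n" using t(2) y by blast
    then show ?thesis using scale[of m n "c y"] by blast
  qed
  then obtain m n where mn: "\<And>y. y \<in> t \<Longrightarrow> m y \<in> M \<and> n y \<in> M \<and> c y *\<^sub>C y = f (m y) (n y)" by metis
  obtain h where h: "bij_betw h {..<card t} t"
    using ex_bij_betw_nat_finite[OF t(1)] by (auto simp: atLeast0LessThan)
  have ht: "h r \<in> t" if "r < card t" for r using h that by (auto simp: bij_betw_def)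
  have "x = (\<Sum>y\<in>t. f (m y) (n y))" using t(3) mn by simp
  also have "\<dots> = (\<Sum>r<card t. f (m (h r)) (n (h r)))" by (rule sum.reindex_bij_betw[OF h, symmetric])
  finally show ?thesis
    using mn ht by (intro exI[of _ "card t"] exI[of _ "\<lambda>r. m (h r)"] exI[of _ "\<lambda>r. n (h r)"]) auto
qed

section \<open>Connectedness is invariant\<close>

lemma (in linked_embeddings) connected:
  assumes irr: "irreducibly_acting S A"
  shows "cstar_generated S = bops"
proof
  have "cstar_subalgebra (bops :: ('h \<Rightarrow>\<^sub>L 'h) set)"
    unfolding cstar_subalgebra_def using csubspace_bops closed_bops by auto
  moreover have "S \<subseteq> bops" using S.S_simps(1) by blast
  ultimately show "cstar_generated S \<subseteq> bops" unfolding cstar_generated_def by (intro hull_minimal)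
  show "bops \<subseteq> cstar_generated S"
  \<comment> \<open>Projections are handled only for nonzero K. If K is zero, so is the embedding
    space of \<open>T\<close>; by \<open>sum_ab'\<close> the identity on that of \<open>S\<close> is
    zero as well, and injectivity of \<open>\<phi>\<close> shows that H is zero.\<close>
  proof (cases "(id_blinfun :: 'k \<Rightarrow>\<^sub>L 'k) = 0")
    case True
    have id_d: "(id_blinfun :: 'd \<Rightarrow>\<^sub>L 'd) = 0" using True T.map_id T.map_zero by simp
    have "b' r = 0" for r using compose_id(2)[of "b' r"] by (simp add: id_d)
    then have "(\<Sum>r<N'. (a' r)\<^sup>\<dagger> o\<^sub>L b' r) = 0" by simp
    then have "\<phi> id_blinfun = \<phi> 0" using sum_ab' by (simp add: S.map_id S.map_zero)
    then have id_h: "(id_blinfun :: 'h \<Rightarrow>\<^sub>L 'h) = 0"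
      using S.S_simps(5,6) S.map_inj by (metis inj_onD)
    have "x = 0" for x :: "'h \<Rightarrow>\<^sub>L 'h" using compose_id(2)[of x] by (simp add: id_h)
    moreover have "0 \<in> cstar_generated S"
      unfolding cstar_generated_def using S.S_simps(6) by (rule hull_inc)
    ultimately show ?thesis by (metis subsetI)
  next
    case nontrivial: False
    have trivial_projection: "q = 0 \<or> q = id_blinfun"
      if q: "q \<in> bops" "q\<^sup>\<dagger> = q" "q o\<^sub>L q = q" and comm: "\<And>s. s \<in> S \<Longrightarrow> q o\<^sub>L s = s o\<^sub>L q" for q
    proof -
      have idem: "q (q x) = q x" for x using arg_cong[OF q(3), of "\<lambda>f. blinfun_apply f x"] by simp
      consider "detects_positivity S q" | "detects_positivity S (id_blinfun - q)"
        using projection_detects_positivity[OF nontrivial q comm] by blast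
      then show ?thesis
      proof cases
        case 1
        then have "(\<forall>x. q x = x \<longrightarrow> x = 0) \<or> (\<forall>x. q x = x)"
          using irreducibly_acting_projection[OF S.op_sys irr q(1) _ comm] by blast
        then show ?thesis
        proof
          assume "\<forall>x. q x = x \<longrightarrow> x = 0"
          then have "q x = 0" for x using idem by blast
          then show ?thesis by (intro disjI1 blinfun_eqI) simp
        next
          assume "\<forall>x. q x = x"
          then show ?thesis by (intro disjI2 blinfun_eqI) simp
        qed
      next
        case 2
        have b: "id_blinfun - q \<in> bops" using q by auto
        have c: "(id_blinfun - q) o\<^sub>L s = s o\<^sub>L (id_blinfun - q)" if "s \<in> S" for s
          using comm[OF that] by (simp add: compose_simps)
        have "(\<forall>x. (id_blinfun - q) x = x \<longrightarrow> x = 0) \<or> (\<forall>x. (id_blinfun - q) x = x)"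
          by (rule irreducibly_acting_projection[OF S.op_sys irr b 2 c])
        then show ?thesis
        proof
          assume *: "\<forall>x. (id_blinfun - q) x = x \<longrightarrow> x = 0"
          have "x - q x = 0" for x using *[rule_format, of "x - q x"] by (simp add: blinfun.diff_left blinfun.diff_right idem)
          then show ?thesis by (intro disjI2 blinfun_eqI) simp
        next
          assume "\<forall>x. (id_blinfun - q) x = x"
          then show ?thesis by (intro disjI1 blinfun_eqI) (simp add: blinfun.diff_left)
        qed
      qed
    qed
    \<comment> \<open>An invariant subspace of \<open>C\<close> gives a projection commuting with
      \<open>C\<close> and in particular with \<open>S\<close>, hence a trivial one. So every
      C*-algebra that contains \<open>S\<close> is everything, and so is the intersection of all of
      them.\<close>
    have "bops \<subseteq> C" if C: "cstar_subalgebra C" "S \<subseteq> C" for C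
    proof (rule burnside)
      show "C \<subseteq> bops" "csubspace C" and star: "\<And>c. c \<in> C \<Longrightarrow> c\<^sup>\<dagger> \<in> C"
        and "\<And>a b. a \<in> C \<Longrightarrow> b \<in> C \<Longrightarrow> a o\<^sub>L b \<in> C" using C(1) by (auto simp: cstar_subalgebra_def)
      show "id_blinfun \<in> C" using C(2) S.S_simps(5) by blast
      fix L assume L: "csubspace L" and inv: "\<And>c x. c \<in> C \<Longrightarrow> x \<in> L \<Longrightarrow> blinfun_apply c x \<in> L"
      obtain q where q: "q \<in> bops" "q\<^sup>\<dagger> = q" "q o\<^sub>L q = q" "\<And>c. c \<in> C \<Longrightarrow> q o\<^sub>L c = c o\<^sub>L q" "L = {x. q x = x}"
        using invariant_subspace_projection[OF \<open>C \<subseteq> bops\<close> star L inv] by blast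
      have "q = 0 \<or> q = id_blinfun" using q(4) C(2) by (intro trivial_projection q(1-3)) blast
      then show "L = {0} \<or> L = UNIV" by (auto simp: q(5))
    qed
    then show ?thesis unfolding cstar_generated_def hull_def by blast
  qed
qed

text \<open>Finite dimension turns the two non-degeneracy conditions into two finite factorisations
  of the identity; the operators that occur in them form the set \<open>F\<close>.\<close>

lemma delta_equivalent_connected:
  fixes S A :: "('h::fin_dim_chilbert_space \<Rightarrow>\<^sub>L 'h) set" and T B :: "('k::fin_dim_chilbert_space \<Rightarrow>\<^sub>L 'k) set"
    and \<phi> :: "('h \<Rightarrow>\<^sub>L 'h) \<Rightarrow> ('c::chilbert_space \<Rightarrow>\<^sub>L 'c)"
    and \<psi> :: "('k \<Rightarrow>\<^sub>L 'k) \<Rightarrow> ('d::chilbert_space \<Rightarrow>\<^sub>L 'd)"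
  assumes S: "order_embedding S \<phi>" and T: "order_embedding T \<psi>"
    and irr: "irreducibly_acting S A" "irreducibly_acting T B"
    and equiv: "tro_equivalent (\<phi> ` S) (\<psi> ` T)"
  shows "cstar_generated S = bops \<longleftrightarrow> cstar_generated T = bops"
proof -
  interpret S: order_embedding S \<phi> by fact
  interpret T: order_embedding T \<psi> by fact
  obtain M where M0: "nondegenerate_tro M \<and>
      (\<forall>m\<in>M. \<forall>n\<in>M. \<forall>t\<in>\<psi> ` T. m\<^sup>\<dagger> o\<^sub>L t o\<^sub>L n \<in> \<phi> ` S) \<and>
      (\<forall>m\<in>M. \<forall>n\<in>M. \<forall>s\<in>\<phi> ` S. m o\<^sub>L s o\<^sub>L n\<^sup>\<dagger> \<in> \<psi> ` T)"
    using equiv unfolding tro_equivalent_def by (elim exE)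
  have M: "nondegenerate_tro M" using M0 by (rule conjunct1)
  have MT: "m\<^sup>\<dagger> o\<^sub>L \<psi> t o\<^sub>L n \<in> \<phi> ` S" if "m \<in> M" "n \<in> M" "t \<in> T" for m n t
    using M0[THEN conjunct2, THEN conjunct1, rule_format, OF that(1,2) imageI[OF that(3)]] .
  have MS: "m o\<^sub>L \<phi> s o\<^sub>L n\<^sup>\<dagger> \<in> \<psi> ` T" if "m \<in> M" "n \<in> M" "s \<in> S" for m n s
    using M0[THEN conjunct2, THEN conjunct2, rule_format, OF that(1,2) imageI[OF that(3)]] .
  have Mb: "m \<in> bops" if "m \<in> M" for m
    using M that unfolding nondegenerate_tro_def tro_def by blast
  have Msub: "csubspace M" using M by (simp add: nondegenerate_tro_def tro_def)
  have Mscale: "c *\<^sub>C m \<in> M" if "m \<in> M" for c m using Msub that by (rule complex_vector.subspace_scale)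
  obtain BS where "finite BS" "(bops :: ('h \<Rightarrow>\<^sub>L 'h) set) \<subseteq> cspan BS" using bops_finite_span by blast
  then have BS: "finite BS" "S \<subseteq> cspan BS" using S.S_simps(1) by blast+
  obtain BT where "finite BT" "(bops :: ('k \<Rightarrow>\<^sub>L 'k) set) \<subseteq> cspan BT" using bops_finite_span by blast
  then have BT: "finite BT" "T \<subseteq> cspan BT" using T.S_simps(1) by blast+
  have "closed_cspan {m\<^sup>\<dagger> o\<^sub>L n | m n. m \<in> M \<and> n \<in> M} = cspan {m\<^sup>\<dagger> o\<^sub>L n | m n. m \<in> M \<and> n \<in> M}"
    by (rule S.image_subset_closed_cspan[OF BS]) (use MT[OF _ _ T.S_simps(5)] in \<open>auto simp: T.map_id\<close>)
  then have "id_blinfun \<in> cspan {m\<^sup>\<dagger> o\<^sub>L n | m n. m \<in> M \<and> n \<in> M}"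
    using M by (simp add: nondegenerate_tro_def)
  then have "\<exists>(N::nat) a b. (\<forall>r<N. a r \<in> M \<and> b r \<in> M) \<and> id_blinfun = (\<Sum>r<N. (a r)\<^sup>\<dagger> o\<^sub>L b r)"
  proof (rule cspan_products)
    fix c m n assume mn: "m \<in> M" "n \<in> M"
    have "c *\<^sub>C (m\<^sup>\<dagger> o\<^sub>L n) = m\<^sup>\<dagger> o\<^sub>L (c *\<^sub>C n)" using Mb[OF mn(1)] by (simp add: compose_scaleC_right cadjoint_bops)
    then show "\<exists>m'\<in>M. \<exists>n'\<in>M. c *\<^sub>C (m\<^sup>\<dagger> o\<^sub>L n) = m'\<^sup>\<dagger> o\<^sub>L n'" using mn Mscale by blast
  qed
  then obtain N' :: nat and a' b' where ab': "\<And>r. r < N' \<Longrightarrow> a' r \<in> M \<and> b' r \<in> M"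
      "(\<Sum>r<N'. (a' r)\<^sup>\<dagger> o\<^sub>L b' r) = id_blinfun" by metis
  have "closed_cspan {m o\<^sub>L n\<^sup>\<dagger> | m n. m \<in> M \<and> n \<in> M} = cspan {m o\<^sub>L n\<^sup>\<dagger> | m n. m \<in> M \<and> n \<in> M}"
    by (rule T.image_subset_closed_cspan[OF BT]) (use MS[OF _ _ S.S_simps(5)] in \<open>auto simp: S.map_id\<close>)
  then have "id_blinfun \<in> cspan {m o\<^sub>L n\<^sup>\<dagger> | m n. m \<in> M \<and> n \<in> M}"
    using M by (simp add: nondegenerate_tro_def)
  then have "\<exists>(N::nat) a b. (\<forall>r<N. a r \<in> M \<and> b r \<in> M) \<and> id_blinfun = (\<Sum>r<N. a r o\<^sub>L (b r)\<^sup>\<dagger>)"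
  proof (rule cspan_products)
    fix c m n assume mn: "m \<in> M" "n \<in> M"
    have "c *\<^sub>C (m o\<^sub>L n\<^sup>\<dagger>) = (c *\<^sub>C m) o\<^sub>L n\<^sup>\<dagger>" by (simp add: compose_scaleC_left)
    then show "\<exists>m'\<in>M. \<exists>n'\<in>M. c *\<^sub>C (m o\<^sub>L n\<^sup>\<dagger>) = m' o\<^sub>L n'\<^sup>\<dagger>" using mn Mscale by blast
  qed
  then obtain N :: nat and a b where ab: "\<And>r. r < N \<Longrightarrow> a r \<in> M \<and> b r \<in> M"
      "(\<Sum>r<N. a r o\<^sub>L (b r)\<^sup>\<dagger>) = id_blinfun" by metis
  define F where "F = a ` {..<N} \<union> b ` {..<N} \<union> a' ` {..<N'} \<union> b' ` {..<N'}"
  have FM: "F \<subseteq> M" using ab ab' by (auto simp: F_def)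
  have fin: "finite F" by (simp add: F_def)
  have Fab: "r < N \<Longrightarrow> a r \<in> F" "r < N \<Longrightarrow> b r \<in> F" "r < N' \<Longrightarrow> a' r \<in> F" "r < N' \<Longrightarrow> b' r \<in> F" for r
    by (auto simp: F_def)
  show ?thesis
  proof
    assume gen: "cstar_generated T = bops"
    interpret linked_embeddings S \<phi> T \<psi> F a b a' b' N N'
      by unfold_locales (use fin Fab FM Mb MT MS ab ab' gen in \<open>auto simp: blinfun_compose_assoc subset_iff\<close>)
    show "cstar_generated S = bops" by (rule connected[OF irr(1)])
  next
    assume gen: "cstar_generated S = bops"
    have adj: "r < N' \<Longrightarrow> (a' r)\<^sup>\<dagger>\<^sup>\<dagger> = a' r" "r < N' \<Longrightarrow> (b' r)\<^sup>\<dagger>\<^sup>\<dagger> = b' r" "r < N \<Longrightarrow> (a r)\<^sup>\<dagger>\<^sup>\<dagger> = a r" for r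
      using ab ab' Mb by auto
    \<comment> \<open>Taking adjoints exchanges the two embedding spaces, and with them the two
      factorisations of the identity and the roles of \<open>S\<close> and \<open>T\<close>.\<close>
    interpret linked_embeddings T \<psi> S \<phi> "cadjoint ` F" "\<lambda>r. (a' r)\<^sup>\<dagger>" "\<lambda>r. (b' r)\<^sup>\<dagger>" "\<lambda>r. (a r)\<^sup>\<dagger>" "\<lambda>r. (b r)\<^sup>\<dagger>" N' N
    proof unfold_locales
      show "finite (cadjoint ` F)" using fin by simp
      show "m \<in> bops" if "m \<in> cadjoint ` F" for m using that FM Mb by auto
      show "m\<^sup>\<dagger> o\<^sub>L (\<phi> s o\<^sub>L n) \<in> \<psi> ` T" if mn: "m \<in> cadjoint ` F" "n \<in> cadjoint ` F" "s \<in> S" for m n s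
      proof -
        obtain m' n' where "m' \<in> M" "n' \<in> M" "m = m'\<^sup>\<dagger>" "n = n'\<^sup>\<dagger>" using mn FM by blast
        then show ?thesis using MS[of m' n' s] Mb[of m'] Mb[of n'] mn by (simp add: blinfun_compose_assoc)
      qed
      show "m o\<^sub>L (\<psi> t o\<^sub>L n\<^sup>\<dagger>) \<in> \<phi> ` S" if mn: "m \<in> cadjoint ` F" "n \<in> cadjoint ` F" "t \<in> T" for m n t
      proof -
        obtain m' n' where "m' \<in> M" "n' \<in> M" "m = m'\<^sup>\<dagger>" "n = n'\<^sup>\<dagger>" using mn FM by blast
        then show ?thesis using MT[of m' n' t] Mb[of m'] Mb[of n'] mn by (simp add: blinfun_compose_assoc)
      qed
      show "(\<Sum>r<N'. (a' r)\<^sup>\<dagger> o\<^sub>L (b' r)\<^sup>\<dagger>\<^sup>\<dagger>) = id_blinfun" using ab'(2) by (simp add: adj)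
      show "(\<Sum>r<N. (a r)\<^sup>\<dagger>\<^sup>\<dagger> o\<^sub>L (b r)\<^sup>\<dagger>) = id_blinfun" using ab(2) by (simp add: adj)
    qed (use Fab gen in auto)
    show "cstar_generated T = bops" by (rule connected[OF irr(2)])
  qed
qed

theorem proposition4p7:
  fixes S A :: "('h::fin_dim_chilbert_space \<Rightarrow>\<^sub>L 'h) set"
    and T B :: "('k::fin_dim_chilbert_space \<Rightarrow>\<^sub>L 'k) set"
  assumes "quantum_graph S A" and "irreducibly_acting S A"
    and "quantum_graph T B" and "irreducibly_acting T B"
    and "delta_equivalent_via TYPE('h1::chilbert_space) TYPE('k1::chilbert_space) S T"
  shows "connected_quantum_graph S A \<longleftrightarrow> connected_quantum_graph T B"
proof -
  obtain \<phi> :: "('h \<Rightarrow>\<^sub>L 'h) \<Rightarrow> ('h1 \<Rightarrow>\<^sub>L 'h1)" and \<psi> :: "('k \<Rightarrow>\<^sub>L 'k) \<Rightarrow> ('k1 \<Rightarrow>\<^sub>L 'k1)"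
    where "unital_complete_order_embedding S \<phi>" "unital_complete_order_embedding T \<psi>"
      and equiv: "tro_equivalent (\<phi> ` S) (\<psi> ` T)"
    using assms(5) unfolding delta_equivalent_via_def by blast
  then have "order_embedding S \<phi>" "order_embedding T \<psi>"
    using assms(1,3) by (simp_all add: order_embedding_def quantum_graph_def)
  then show ?thesis
    unfolding connected_quantum_graph_def
    using delta_equivalent_connected[OF _ _ assms(2,4) equiv] by blast
qed

end
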